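(* Let $N\in\mathbb N$ and $\gamma\in[-1,0)$. Then neither $\dot W^{1,1}(\gamma)/\mathbb R$ nor $\dot{BV}(\gamma)/\mathbb R$ is normable, where $\dot W^{1,1}(\gamma)=\dot W^{1,1}_N(\gamma)$ and $\dot{BV}(\gamma)=\dot{BV}_N(\gamma)$ are the spaces on $\mathbb R^N$ defined in the context.
   Context: $\mathbb N=\{1,2,\ldots\}$. For $\gamma\in\mathbb R$, a measurable function $u$ on $\mathbb R^N$ and $\lambda\in(0,\infty)$, let $$E^{(N)}_{\lambda,\gamma}[u]:=\Big\{(x,y)\in\mathbb R^N\times\mathbb R^N: x\ne y,\ \frac{|u(x)-u(y)|}{|x-y|^{1+\gamma}}>\lambda\Big\},$$ for measurable $E\subset\mathbb R^N\times\mathbb R^N$ let $\nu_{N,\gamma}(E):=\iint_E|x-y|^{\gamma-N}\,dx\,dy$, and let $$[u]_{\dot W_{N,\gamma}}:=\sup_{\lambda\in(0,\infty)}\lambda\,\nu_{N,\gamma}(E^{(N)}_{\lambda,\gamma}[u]).$$ $\dot W^{1,1}(\mathbb R^N)$ is the set of all $u\in L^1_{\rm loc}(\mathbb R^N)$ with distributional gradient $\nabla u\in L^1(\mathbb R^N)$. $\dot{BV}(\mathbb R^N)$ is the set of all $u\in L^1_{\rm loc}(\mathbb R^N)$ whose distributional gradient is a bounded $\mathbb R^N$-valued Borel measure, with $\|\nabla u\|_{\mathcal M}:=|\nabla u|(\mathbb R^N)$ (total variation). Set $$\dot W^{1,1}_N(\gamma):=\{u\in\dot W^{1,1}(\mathbb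 R^N):[u]_{\dot W_{N,\gamma}}<\infty\},\quad \|u\|_{\dot W^{1,1}_N(\gamma)}:=\|\nabla u\|_{L^1(\mathbb R^N)}+[u]_{\dot W_{N,\gamma}},$$ $$\dot{BV}_N(\gamma):=\{u\in\dot{BV}(\mathbb R^N):[u]_{\dot W_{N,\gamma}}<\infty\},\quad \|u\|_{\dot{BV}_N(\gamma)}:=\|\nabla u\|_{\mathcal M}+[u]_{\dot W_{N,\gamma}}.$$ These are quasi-seminorms which vanish on constants and are invariant under adding constants. For $\mathcal X\in\{\dot W^{1,1}_N(\gamma),\dot{BV}_N(\gamma)\}$, the quotient $\mathcal X/\mathbb R$ by constant functions carries the quasi-norm $\|u+\mathbb R\|_{\mathcal X/\mathbb R}:=\|u\|_{\mathcal X}$. $\mathcal X/\mathbb R$ is called normable if this quasi-norm is equivalent to a norm on $\mathcal X/\mathbb R$, i.e. there exist a norm $|||\cdot|||$ on $\mathcal X/\mathbb R$ and a constant $C\in[1,\infty)$ with $C^{-1}|||\cdot|||\le\|\cdot\|_{\mathcal X/\mathbb R}\le C|||\cdot|||$. *)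

theory Defs
  imports "HOL-Analysis.Analysis"
begin

text \<open>Euclidean space of dimension \<open>N\<close> is \<open>real ^ 'n\<close> with \<open>N = CARD('n)\<close>. Elements of the
  spaces below are Lebesgue measurable functions, not classes modulo null sets; the identification
  of almost everywhere equal functions is made together with the quotient by constants.\<close>

section \<open>The weak-type quasi-seminorm\<close>

definition level_set ::
    "real \<Rightarrow> real \<Rightarrow> (real^'n \<Rightarrow> real) \<Rightarrow> ((real^'n) \<times> (real^'n)) set" where
  "level_set l \<gamma> u =
     {(x, y). x \<noteq> y \<and> \<bar>u x - u y\<bar> / norm (x - y) powr (1 + \<gamma>) > l}"

definition nu :: "real \<Rightarrow> ((real^'n) \<times> (real^'n)) set \<Rightarrow> ennreal" where
  "nu \<gamma> E = (\<integral>\<^sup>+ z \<in> E. ennreal (norm (fst z - snd z) powr (\<gamma> - real CARD('n))) \<partial>lebesgue)"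

definition weak_seminorm :: "real \<Rightarrow> (real^'n \<Rightarrow> real) \<Rightarrow> ennreal" where
  "weak_seminorm \<gamma> u = (SUP l \<in> {0<..}. ennreal l * nu \<gamma> (level_set l \<gamma> u))"

section \<open>Test functions and distributional derivatives\<close>

definition partial_deriv :: "'n \<Rightarrow> (real^'n \<Rightarrow> real) \<Rightarrow> real^'n \<Rightarrow> real" where
  "partial_deriv i \<phi> x = frechet_derivative \<phi> (at x) (axis i 1)"

primrec C_k :: "nat \<Rightarrow> (real^'n \<Rightarrow> real) \<Rightarrow> bool" where
  "C_k 0 \<phi> \<longleftrightarrow> continuous_on UNIV \<phi>"
| "C_k (Suc k) \<phi> \<longleftrightarrow> (\<forall>x. \<phi> differentiable at x) \<and> (\<forall>i. C_k k (partial_deriv i \<phi>))"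

definition test_function :: "(real^'n \<Rightarrow> real) \<Rightarrow> bool" where
  "test_function \<phi> \<longleftrightarrow> (\<forall>k. C_k k \<phi>) \<and> compact (closure {x. \<phi> x \<noteq> 0})"

definition L1_loc :: "(real^'n \<Rightarrow> real) set" where
  "L1_loc = {u \<in> borel_measurable lebesgue. \<forall>K. compact K \<longrightarrow> set_integrable lebesgue K u}"

definition distr_partial :: "(real^'n \<Rightarrow> real) \<Rightarrow> 'n \<Rightarrow> (real^'n \<Rightarrow> real) \<Rightarrow> real" where
  "distr_partial u i \<phi> = - (\<integral>x. u x * partial_deriv i \<phi> x \<partial>lebesgue)"

section \<open>The homogeneous Sobolev space\<close>

definition is_L1_gradient :: "(real^'n \<Rightarrow> real) \<Rightarrow> (real^'n \<Rightarrow> real^'n) \<Rightarrow> bool" where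
  "is_L1_gradient u g \<longleftrightarrow> integrable lebesgue g \<and>
     (\<forall>\<phi> i. test_function \<phi> \<longrightarrow> distr_partial u i \<phi> = (\<integral>x. (g x $ i) * \<phi> x \<partial>lebesgue))"

definition W11 :: "(real^'n \<Rightarrow> real) set" where
  "W11 = {u \<in> L1_loc. \<exists>g. is_L1_gradient u g}"

text \<open>The gradient is determined almost everywhere, so the choice does not affect its norm.\<close>

definition L1_gradient :: "(real^'n \<Rightarrow> real) \<Rightarrow> real^'n \<Rightarrow> real^'n" where
  "L1_gradient u = (SOME g. is_L1_gradient u g)"

definition W11_gamma :: "real \<Rightarrow> (real^'n \<Rightarrow> real) set" where
  "W11_gamma \<gamma> = {u \<in> W11. weak_seminorm \<gamma> u < \<infinity>}"

definition W11_gamma_norm :: "real \<Rightarrow> (real^'n \<Rightarrow> real) \<Rightarrow> real" where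
  "W11_gamma_norm \<gamma> u =
     (\<integral>x. norm (L1_gradient u x) \<partial>lebesgue) + enn2real (weak_seminorm \<gamma> u)"

section \<open>The homogeneous space of functions of bounded variation\<close>

text \<open>A vector-valued Borel measure is a countably additive set function; its values outside the
  Borel sets are irrelevant. (Putting all sets of the sequence equal to the empty set shows
  \<open>\<mu> {} = 0\<close>.)\<close>

definition vector_measure :: "((real^'n) set \<Rightarrow> real^'n) \<Rightarrow> bool" where
  "vector_measure \<mu> \<longleftrightarrow>
     (\<forall>A :: nat \<Rightarrow> (real^'n) set. range A \<subseteq> sets borel \<longrightarrow> disjoint_family A \<longrightarrow>
        (\<lambda>k. \<mu> (A k)) sums \<mu> (\<Union>k. A k))"

definition total_variation :: "((real^'n) set \<Rightarrow> real^'n) \<Rightarrow> (real^'n) set \<Rightarrow> ennreal" where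
  "total_variation \<mu> E =
     (SUP A \<in> {A :: nat \<Rightarrow> (real^'n) set.
                 range A \<subseteq> sets borel \<and> disjoint_family A \<and> (\<Union>k. A k) = E}.
        (\<Sum>k. ennreal (norm (\<mu> (A k)))))"

text \<open>Upper variation of a real-valued measure: the positive part of its Jordan decomposition.
  The empty set is among the \<open>B\<close>, so negative values being truncated by \<open>ennreal\<close> is harmless.\<close>

definition upper_variation :: "((real^'n) set \<Rightarrow> real) \<Rightarrow> (real^'n) measure" where
  "upper_variation m =
     measure_of UNIV (sets borel) (\<lambda>A. SUP B \<in> {B \<in> sets borel. B \<subseteq> A}. ennreal (m B))"

definition signed_integral :: "((real^'n) set \<Rightarrow> real) \<Rightarrow> (real^'n \<Rightarrow> real) \<Rightarrow> real" where
  "signed_integral m \<phi> =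
     (\<integral>x. \<phi> x \<partial>upper_variation m) - (\<integral>x. \<phi> x \<partial>upper_variation (\<lambda>A. - m A))"

definition is_measure_gradient ::
    "(real^'n \<Rightarrow> real) \<Rightarrow> ((real^'n) set \<Rightarrow> real^'n) \<Rightarrow> bool" where
  "is_measure_gradient u \<mu> \<longleftrightarrow> vector_measure \<mu> \<and> total_variation \<mu> UNIV < \<infinity> \<and>
     (\<forall>\<phi> i. test_function \<phi> \<longrightarrow> distr_partial u i \<phi> = signed_integral (\<lambda>A. \<mu> A $ i) \<phi>)"

definition BV :: "(real^'n \<Rightarrow> real) set" where
  "BV = {u \<in> L1_loc. \<exists>\<mu>. is_measure_gradient u \<mu>}"

text \<open>Unique on the Borel sets.\<close>

definition measure_gradient :: "(real^'n \<Rightarrow> real) \<Rightarrow> (real^'n) set \<Rightarrow> real^'n" where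
  "measure_gradient u = (SOME \<mu>. is_measure_gradient u \<mu>)"

definition BV_gamma :: "real \<Rightarrow> (real^'n \<Rightarrow> real) set" where
  "BV_gamma \<gamma> = {u \<in> BV. weak_seminorm \<gamma> u < \<infinity>}"

definition BV_gamma_norm :: "real \<Rightarrow> (real^'n \<Rightarrow> real) \<Rightarrow> real" where
  "BV_gamma_norm \<gamma> u =
     enn2real (total_variation (measure_gradient u) UNIV) + enn2real (weak_seminorm \<gamma> u)"

section \<open>Normability of the quotient by constants\<close>

definition const_rel ::
    "(real^'n \<Rightarrow> real) set \<Rightarrow> ((real^'n \<Rightarrow> real) \<times> (real^'n \<Rightarrow> real)) set" where
  "const_rel X = {(u, v). u \<in> X \<and> v \<in> X \<and> (\<exists>c. AE x in lebesgue. v x = u x + c)}"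

lemma equiv_const_rel: "equiv X (const_rel X)"
proof (rule equivI)
  show "const_rel X \<subseteq> X \<times> X"
    by (auto simp: const_rel_def)
  show "refl_on X (const_rel X)"
    by (auto simp: refl_on_def const_rel_def intro: exI[of _ 0])
  show "sym (const_rel X)"
  proof (rule symI)
    fix u v assume "(u, v) \<in> const_rel X"
    then obtain c where "u \<in> X" "v \<in> X" and c: "AE x in lebesgue. v x = u x + c"
      by (auto simp: const_rel_def)
    moreover have "AE x in lebesgue. u x = v x + (- c)"
      using c by eventually_elim simp
    ultimately show "(v, u) \<in> const_rel X"
      by (auto simp: const_rel_def)
  qed
  show "trans (const_rel X)"
  proof (rule transI)
    fix u v w assume "(u, v) \<in> const_rel X" "(v, w) \<in> const_rel X"
    then obtain c d where "u \<in> X" "w \<in> X" and c: "AE x in lebesgue. v x = u x + c"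
        and d: "AE x in lebesgue. w x = v x + d"
      by (auto simp: const_rel_def)
    moreover have "AE x in lebesgue. w x = u x + (c + d)"
      using c d by eventually_elim simp
    ultimately show "(u, w) \<in> const_rel X"
      by (auto simp: const_rel_def)
  qed
qed

definition coset :: "(real^'n \<Rightarrow> real) set \<Rightarrow> (real^'n \<Rightarrow> real) \<Rightarrow> (real^'n \<Rightarrow> real) set" where
  "coset X u = const_rel X `` {u}"

text \<open>Norms on the quotient space \<open>X // const_rel X\<close>, whose linear operations act on
  representatives.\<close>

definition quotient_norm ::
    "(real^'n \<Rightarrow> real) set \<Rightarrow> ((real^'n \<Rightarrow> real) set \<Rightarrow> real) \<Rightarrow> bool" where
  "quotient_norm X p \<longleftrightarrow>
     (\<forall>A \<in> X // const_rel X. 0 \<le> p A \<and> (p A = 0 \<longleftrightarrow> A = coset X (\<lambda>x. 0))) \<and>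
     (\<forall>u \<in> X. \<forall>c. p (coset X (\<lambda>x. c * u x)) = \<bar>c\<bar> * p (coset X u)) \<and>
     (\<forall>u \<in> X. \<forall>v \<in> X. p (coset X (\<lambda>x. u x + v x)) \<le> p (coset X u) + p (coset X v))"

text \<open>\<open>q\<close> is the quasi-seminorm on \<open>X\<close>; the quasi-norm of \<open>coset X u\<close> is \<open>q u\<close>.\<close>

definition normable_mod_constants ::
    "(real^'n \<Rightarrow> real) set \<Rightarrow> ((real^'n \<Rightarrow> real) \<Rightarrow> real) \<Rightarrow> bool" where
  "normable_mod_constants X q \<longleftrightarrow>
     (\<exists>p. quotient_norm X p \<and>
       (\<exists>C \<ge> 1. \<forall>u \<in> X. inverse C * p (coset X u) \<le> q u \<and> q u \<le> C * p (coset X u)))"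

end

theory Submission
  imports Defs
begin

text \<open>Put \<open>s = 1 + \<gamma>\<close>, so that \<open>0 \<le> s < 1\<close>. The seminorm is a weak \<open>L\<^sup>1\<close> quasi-norm, with respect to the
  measure \<open>norm (x - y) powr (\<gamma> - N)\<close>, of the difference quotient
  \<open>\<bar>u x - u y\<bar> / norm (x - y) powr s\<close>. If it came from a norm up to constants, the quasi-norm of an
  average of functions would be at most a constant times the largest of their quasi-norms, however
  many functions are averaged (\<open>normable_average\<close>). As for weak \<open>L\<^sup>1\<close> itself, averaging
  rearrangements of a harmonic sequence violates this, once a building block is available whose
  seminorm is much larger than the \<open>L\<^sup>1\<close> norm of its gradient.

  The block comes from a Cantor set of dimension \<open>s\<close>. At each stage an interval is replaced by \<open>K\<close>
  copies contracted by \<open>\<delta>\<close>, where \<open>K * \<delta> powr s = 1\<close>. The Cantor function, stopped after \<open>m\<close> stages and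
  with smooth steps, rises by \<open>(1 / K) ^ j = (\<delta> ^ j) powr s\<close> over an interval of stage \<open>j\<close>, which has
  length \<open>\<delta> ^ j\<close>. Hence the difference quotient across such an interval has the same size for all \<open>j\<close>,
  and the pairs of points lying on both sides of an interval of stage \<open>j\<close> also have the same mass for
  all \<open>j\<close> (\<open>block_level\<close>). Multiplied by a cutoff of the unit cube of \<open>\<real>\<^sup>N\<close>, the Cantor function
  becomes a block whose level set, at one fixed height, has mass at least a constant times \<open>m\<close>, while
  the \<open>L\<^sup>1\<close> norm of its gradient is bounded independently of \<open>m\<close>.

  The large mass sits at a single height. For the rest, the seminorm of a continuously
  differentiable function splits into short increments, controlled by the \<open>L\<^sup>1\<close> norm of the gradient,
  and long increments, controlled by the weak \<open>L\<^sup>1\<close> norm of the function itself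
  (\<open>weak_seminorm_le\<close>). Take \<open>n\<close> disjoint translates of the block with the weights
  \<open>1 / (k * harm n)\<close>, in any order. The weights add up to one, so the short increments are bounded
  independently of \<open>m\<close>; the weak \<open>l\<^sup>1\<close> norm of the weights is \<open>1 / harm n\<close>, so the long increments
  are negligible once \<open>n\<close> is large in terms of \<open>m\<close>. The \<open>n\<close> cyclic permutations of the
  weights therefore give functions of bounded quasi-norm. Their average is the average of the
  translates with equal weights, and the seminorm of this average is still at least a constant times
  \<open>m\<close> (\<open>block_average_weak_seminorm_ge\<close>). As \<open>m\<close> is arbitrary, no equivalent norm exists.

  The gradients in the two quasi-norms are chosen among all weak gradients. They are identified
  with the classical gradient because test functions determine finite measures
  (\<open>measures_eq_if_test_integrals_eq\<close>), which covers both spaces at once.\<close>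

section \<open>Test functions determine finite Borel measures\<close>

text \<open>The family of all \<open>flat_exp n\<close> is closed under differentiation up to linear combinations; its
  member with \<open>n = 0\<close> is the usual smooth function that vanishes exactly on the nonpositive half-line.\<close>

definition flat_exp :: "nat \<Rightarrow> real \<Rightarrow> real" where
  "flat_exp n t = (if 0 < t then exp (- inverse t) * inverse t ^ n else 0)"

lemma flat_exp_right_limit: "(flat_exp n \<longlongrightarrow> 0) (at_right 0)"
proof -
  have "((\<lambda>y. y ^ n / exp y) \<longlongrightarrow> 0) (at_top :: real filter)"
    by (rule tendsto_power_div_exp_0)
  then have "((\<lambda>t. inverse t ^ n / exp (inverse t)) \<longlongrightarrow> 0) (at_right (0::real))"
    by (rule filterlim_compose) (rule filterlim_inverse_at_top_right)
  moreover have "\<forall>\<^sub>F t in at_right (0::real). inverse t ^ n / exp (inverse t) = flat_exp n t"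
    by (auto simp: eventually_at_right_less flat_exp_def exp_minus field_simps
        intro!: eventually_mono[OF eventually_at_right_less[of 0]])
  ultimately show ?thesis
    using tendsto_cong by fast
qed

lemma flat_exp_deriv:
  "(flat_exp n has_real_derivative flat_exp (n + 2) t - real n * flat_exp (n + 1) t) (at t)"
proof -
  consider "t > 0" | "t < 0" | "t = 0" by linarith
  then show ?thesis
  proof cases
    case 1
    have "((\<lambda>t. exp (- inverse t) * inverse t ^ n) has_real_derivative
        flat_exp (n + 2) t - real n * flat_exp (n + 1) t) (at t)"
      proof (cases n)
      case 0
      with 1 show ?thesis
        by (auto intro!: derivative_eq_intros simp: flat_exp_def power2_eq_square algebra_simps)
    next
      case (Suc k)
      have D: "((\<lambda>t. exp (- inverse t) * inverse t ^ n) has_real_derivative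
          exp (- inverse t) * (inverse t * inverse t) * inverse t ^ n
          + exp (- inverse t) * (real n * inverse t ^ k * - (inverse t * inverse t))) (at t)"
        using 1 Suc by (auto intro!: derivative_eq_intros simp del: power_Suc)
      show ?thesis
        by (rule DERIV_cong[OF D]) (use 1 Suc in \<open>simp add: flat_exp_def algebra_simps\<close>)
    qed
    then show ?thesis
      by (rule has_field_derivative_transform_within_open[where S = "{0<..}"])
         (use 1 in \<open>auto simp: flat_exp_def\<close>)
  next
    case 2
    have "((\<lambda>t. 0) has_real_derivative flat_exp (n + 2) t - real n * flat_exp (n + 1) t) (at t)"
      using 2 by (simp add: flat_exp_def)
    then show ?thesis
      by (rule has_field_derivative_transform_within_open[where S = "{..<0}"])
         (use 2 in \<open>auto simp: flat_exp_def\<close>)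
  next
    case 3
    have "((\<lambda>t. (flat_exp n t - flat_exp n 0) / (t - 0)) \<longlongrightarrow> 0) (at 0)"
      unfolding filterlim_at_split
    proof
      show "((\<lambda>t. (flat_exp n t - flat_exp n 0) / (t - 0)) \<longlongrightarrow> 0) (at_left 0)"
        by (rule tendsto_eventually)
           (auto simp: flat_exp_def eventually_at_left_field intro!: exI[of _ "-1"])
      have "\<forall>\<^sub>F t in at_right (0::real).
          (flat_exp n t - flat_exp n 0) / (t - 0) = flat_exp (Suc n) t"
        by (auto simp: flat_exp_def field_simps
            intro!: eventually_mono[OF eventually_at_right_less[of 0]])
      then show "((\<lambda>t. (flat_exp n t - flat_exp n 0) / (t - 0)) \<longlongrightarrow> 0) (at_right 0)"
        using flat_exp_right_limit[of "Suc n"] tendsto_cong by fast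
    qed
    then show ?thesis
      using 3 by (simp add: has_field_derivative_iff flat_exp_def)
  qed
qed

lemma partial_derivI:
  assumes "(\<phi> has_derivative D) (at x)"
  shows "partial_deriv i \<phi> x = D (axis i 1)"
  using assms by (simp add: partial_deriv_def frechet_derivative_at[symmetric])

lemma C_k_add: "C_k k f \<Longrightarrow> C_k k g \<Longrightarrow> C_k k (\<lambda>x. f x + g x)"
proof (induction k arbitrary: f g)
  case (Suc k)
  have "partial_deriv i (\<lambda>x. f x + g x) = (\<lambda>x. partial_deriv i f x + partial_deriv i g x)" for i
  proof
    fix x
    have "(f has_derivative frechet_derivative f (at x)) (at x)"
      "(g has_derivative frechet_derivative g (at x)) (at x)"
      using Suc.prems by (auto simp: frechet_derivative_works)
    from partial_derivI[OF has_derivative_add[OF this]]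
    show "partial_deriv i (\<lambda>x. f x + g x) x = partial_deriv i f x + partial_deriv i g x"
      by (simp add: partial_deriv_def)
  qed
  with Suc show ?case by simp
qed (simp add: continuous_on_add)

lemma C_k_Suc: "C_k (Suc k) f \<Longrightarrow> C_k k f"
proof (induction k arbitrary: f)
  case 0
  then show ?case
    by (auto simp: continuous_on_eq_continuous_at intro: differentiable_imp_continuous_within)
qed auto

lemma C_k_mult: "C_k k f \<Longrightarrow> C_k k g \<Longrightarrow> C_k k (\<lambda>x. f x * g x)"
proof (induction k arbitrary: f g)
  case (Suc k)
  have "partial_deriv i (\<lambda>x. f x * g x)
      = (\<lambda>x. f x * partial_deriv i g x + partial_deriv i f x * g x)" for i
  proof
    fix x
    have "(f has_derivative frechet_derivative f (at x)) (at x)"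
      "(g has_derivative frechet_derivative g (at x)) (at x)"
      using Suc.prems by (auto simp: frechet_derivative_works)
    from partial_derivI[OF has_derivative_mult[OF this]]
    show "partial_deriv i (\<lambda>x. f x * g x) x
        = f x * partial_deriv i g x + partial_deriv i f x * g x"
      by (simp add: partial_deriv_def)
  qed
  moreover have "C_k k f" "C_k k g"
    using Suc.prems C_k_Suc by blast+
  ultimately show ?case
    using Suc by (auto intro!: C_k_add Suc.IH)
qed (simp add: continuous_on_mult)

lemma C_k_const: "C_k k (\<lambda>x::real^'n. c)"
proof (induction k arbitrary: c)
  case (Suc k)
  have "partial_deriv i (\<lambda>x::real^'n. c) = (\<lambda>x. 0)" for i :: 'n
    by (rule ext) (rule partial_derivI[of _ "\<lambda>_. 0"], simp)
  with Suc show ?case by simp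
qed simp

lemma C_k_prod:
  assumes "finite I" "\<And>i. i \<in> I \<Longrightarrow> C_k k (f i)"
  shows "C_k k (\<lambda>x. \<Prod>i\<in>I. f i x)"
  using assms by (induction I rule: finite_induct) (auto simp: C_k_const C_k_mult)

lemma flat_exp_coord_derivative:
  fixes i :: "'n::finite"
  shows "((\<lambda>x::real^'n. flat_exp n (c * x $ i + d)) has_derivative
    (\<lambda>h. (flat_exp (n + 2) (c * x $ i + d) - real n * flat_exp (n + 1) (c * x $ i + d)) * (c * h $ i)))
    (at x)"
  by (rule has_derivative_eq_rhs, rule has_derivative_compose[OF _ has_field_derivative_imp_has_derivative[OF flat_exp_deriv]])
     (auto intro!: derivative_eq_intros bounded_linear_imp_has_derivative bounded_linear_vec_nth
       simp: mult_ac)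

text \<open>The induction on \<open>k\<close> has to treat all \<open>n\<close> together, since a derivative involves two larger values
  of \<open>n\<close>.\<close>

lemma C_k_flat_exp_coord:
  fixes i :: "'n::finite"
  shows "C_k k (\<lambda>x::real^'n. flat_exp n (c * x $ i + d))"
proof (induction k arbitrary: n)
  case 0
  show ?case
    using flat_exp_coord_derivative[of n c i d]
    by (auto simp: continuous_on_eq_continuous_at intro: has_derivative_continuous)
next
  case (Suc k)
  have "partial_deriv j (\<lambda>x::real^'n. flat_exp n (c * x $ i + d)) =
    (\<lambda>x. (flat_exp (n + 2) (c * x $ i + d) + (- real n) * flat_exp (n + 1) (c * x $ i + d))
      * (c * axis j 1 $ i))" for j
    by (rule ext) (simp add: partial_derivI[OF flat_exp_coord_derivative])
  moreover have "C_k k (\<lambda>x::real^'n.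
      (flat_exp (n + 2) (c * x $ i + d) + (- real n) * flat_exp (n + 1) (c * x $ i + d))
      * (c * axis j 1 $ i))" for j
    by (intro C_k_mult C_k_add C_k_const Suc.IH)
  moreover have "\<forall>x. (\<lambda>x::real^'n. flat_exp n (c * x $ i + d)) differentiable at x"
    using flat_exp_coord_derivative differentiable_def by blast
  ultimately show ?case by simp
qed

text \<open>Letting \<open>k\<close> tend to infinity drives every factor to one inside the box, while each function of the
  sequence vanishes outside.\<close>

definition box_bump :: "nat \<Rightarrow> real^'n \<Rightarrow> real^'n \<Rightarrow> real^'n \<Rightarrow> real" where
  "box_bump k a b x = (\<Prod>i\<in>UNIV. flat_exp 0 (real k * x $ i + (- real k * a $ i))
     * flat_exp 0 (- real k * x $ i + real k * b $ i))"

lemma flat_exp_0_bounds: "0 \<le> flat_exp 0 t" "flat_exp 0 t \<le> 1"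
  by (auto simp: flat_exp_def)

lemma box_bump_bounds: "0 \<le> box_bump k a b x" "box_bump k a b x \<le> 1"
  unfolding box_bump_def
  by (auto intro!: prod_nonneg prod_le_1 mult_nonneg_nonneg mult_le_one flat_exp_0_bounds)

lemma box_bump_outside: "x \<notin> box a b \<Longrightarrow> box_bump k a b x = 0"
proof -
  assume "x \<notin> box a b"
  then obtain i where "\<not> (a $ i < x $ i \<and> x $ i < b $ i)"
    by (auto simp: mem_box_cart)
  then have "real k * x $ i + (- real k * a $ i) \<le> 0 \<or> - real k * x $ i + real k * b $ i \<le> 0"
    by (metis add.commute add_uminus_conv_diff diff_le_0_iff_le linorder_not_less
        minus_mult_left mult_left_mono of_nat_0_le_iff)
  then show ?thesis
    unfolding box_bump_def by (intro prod_zero bexI[of _ i]) (auto simp: flat_exp_def)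
qed

lemma test_function_box_bump: "test_function (box_bump k a b)"
  unfolding test_function_def
proof
  show "\<forall>j. C_k j (box_bump k a b)"
    unfolding box_bump_def[abs_def] by (intro allI C_k_prod C_k_mult C_k_flat_exp_coord) auto
  have "{x. box_bump k a b x \<noteq> 0} \<subseteq> cbox a b"
    using box_bump_outside box_subset_cbox by blast
  then show "compact (closure {x. box_bump k a b x \<noteq> 0})"
    by (meson bounded_cbox bounded_subset compact_closure)
qed

lemma flat_exp_0_limit:
  assumes "0 < c"
  shows "(\<lambda>k. flat_exp 0 (real k * c)) \<longlonglongrightarrow> 1"
proof -
  have "(\<lambda>k. exp (- inverse (real k * c))) \<longlonglongrightarrow> exp (- 0)"
  proof (intro tendsto_intros tendsto_inverse_0_at_top)
    show "filterlim (\<lambda>k. real k * c) at_top sequentially"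
      by (rule filterlim_at_top_mult_tendsto_pos[OF tendsto_const assms filterlim_real_sequentially])
  qed
  then have "(\<lambda>k. exp (- inverse (real k * c))) \<longlonglongrightarrow> 1"
    by simp
  moreover have "\<forall>\<^sub>F k in sequentially. exp (- inverse (real k * c)) = flat_exp 0 (real k * c)"
    using eventually_gt_at_top[of 0] by eventually_elim (use assms in \<open>simp add: flat_exp_def\<close>)
  ultimately show ?thesis
    by (rule Lim_transform_eventually)
qed

lemma box_bump_limit: "(\<lambda>k. box_bump k a b x) \<longlonglongrightarrow> indicator (box a b) x"
proof (cases "x \<in> box a b")
  case True
  then have "0 < x $ i - a $ i" "0 < b $ i - x $ i" for i
    by (auto simp: mem_box_cart)
  from flat_exp_0_limit[OF this(1)] flat_exp_0_limit[OF this(2)]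
  have "(\<lambda>k. \<Prod>i\<in>UNIV. flat_exp 0 (real k * (x $ i - a $ i)) * flat_exp 0 (real k * (b $ i - x $ i)))
      \<longlonglongrightarrow> (\<Prod>i\<in>(UNIV::'a set). 1 * 1)"
    by (intro tendsto_prod tendsto_mult)
  moreover have "real k * x $ i + (- real k * a $ i) = real k * (x $ i - a $ i)"
    "- real k * x $ i + real k * b $ i = real k * (b $ i - x $ i)" for k i
    by (simp_all add: right_diff_distrib)
  ultimately have "(\<lambda>k. box_bump k a b x) \<longlonglongrightarrow> (\<Prod>i\<in>(UNIV::'a set). 1 * 1)"
    by (simp only: box_bump_def)
  with True show ?thesis by simp
qed (simp add: box_bump_outside)

lemma test_function_continuous: "test_function \<phi> \<Longrightarrow> continuous_on UNIV \<phi>"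
  unfolding test_function_def using C_k.simps(1) by blast

lemma integral_box_bump_limit:
  fixes M :: "(real^'n) measure"
  assumes "finite_measure M" "sets M = sets borel"
  shows "(\<lambda>k. \<integral>x. box_bump k a b x \<partial>M) \<longlonglongrightarrow> measure M (box a b)"
proof -
  interpret finite_measure M by fact
  have [measurable]: "box_bump k a b \<in> borel_measurable M" for k
    using borel_measurable_continuous_onI[OF test_function_continuous[OF test_function_box_bump]]
    by (simp add: assms(2) cong: measurable_cong_sets)
  have [measurable]: "box a b \<in> sets M"
    by (simp add: assms(2))
  have "(\<lambda>k. \<integral>x. box_bump k a b x \<partial>M) \<longlonglongrightarrow> (\<integral>x. indicator (box a b) x \<partial>M)"
    by (rule integral_dominated_convergence[where w = "\<lambda>x. 1"])
       (auto simp: box_bump_limit box_bump_bounds abs_of_nonneg)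
  moreover have "space M = UNIV"
    using assms(2) sets_eq_imp_space_eq by fastforce
  ultimately show ?thesis by simp
qed

text \<open>Bump functions converge boundedly to indicators of boxes, and boxes form an
  intersection-stable generator of the Borel sets. The statement is about differences of
  measures so that it applies to signed measures through their Jordan decompositions.\<close>

lemma measures_eq_if_test_integrals_eq:
  fixes M M' N N' :: "(real^'n) measure"
  assumes fin: "finite_measure M" "finite_measure M'" "finite_measure N" "finite_measure N'"
    and sets: "sets M = sets borel" "sets M' = sets borel" "sets N = sets borel"
      "sets N' = sets borel"
    and eq: "\<And>\<phi>. test_function \<phi> \<Longrightarrow>
      (\<integral>x. \<phi> x \<partial>M) - (\<integral>x. \<phi> x \<partial>M') = (\<integral>x. \<phi> x \<partial>N) - (\<integral>x. \<phi> x \<partial>N')"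
    and A: "A \<in> sets borel"
  shows "measure M A - measure M' A = measure N A - measure N' A"
proof -
  define d where "d A = measure M A - measure M' A - (measure N A - measure N' A)" for A
  have sp: "space M = UNIV" "space M' = UNIV" "space N = UNIV" "space N' = UNIV"
    using sets[THEN sets_eq_imp_space_eq] by simp_all
  have box: "d (box a b) = 0" for a b
  proof -
    have "(\<lambda>k. (\<integral>x. box_bump k a b x \<partial>M) - (\<integral>x. box_bump k a b x \<partial>M')
        - ((\<integral>x. box_bump k a b x \<partial>N) - (\<integral>x. box_bump k a b x \<partial>N'))) \<longlonglongrightarrow> d (box a b)"
      unfolding d_def by (intro tendsto_intros integral_box_bump_limit fin sets)
    then show ?thesis
      by (simp add: eq[OF test_function_box_bump] LIMSEQ_const_iff)
  qed
  have sums: "(\<lambda>i. d (B i)) sums d (\<Union>i. B i)"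
    if "range B \<subseteq> sets borel" "disjoint_family B" for B :: "nat \<Rightarrow> (real^'n) set"
    unfolding d_def using that sets
    by (intro sums_diff finite_measure.finite_measure_UNION fin) auto
  have un: "d UNIV = 0"
  proof -
    define C :: "nat \<Rightarrow> (real^'n) set"
      where "C n = box (\<chi> i. - real n) (\<chi> i. real n)" for n
    have C: "range C \<subseteq> sets borel"
      by (auto simp: C_def)
    have "C m \<subseteq> C n" if "m \<le> n" for m n
    proof
      fix x assume "x \<in> C m"
      then have "- real m < x $ i \<and> x $ i < real m" for i
        by (simp add: C_def mem_box_cart)
      moreover have "real m \<le> real n" using that by simp
      ultimately show "x \<in> C n"
        unfolding C_def mem_box_cart by (auto; smt (verit))
    qed
    then have C': "incseq C" by (simp add: incseq_def)
    have UN: "(\<Union>n. C n) = (UNIV :: (real^'n) set)"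
    proof (intro equalityI subsetI)
      fix x :: "real^'n"
      obtain n where "norm x < real n" using reals_Archimedean2 by blast
      then have "\<bar>x $ i\<bar> < real n" for i
        using component_le_norm_cart[of x i] by linarith
      then have "x \<in> C n"
        by (simp add: C_def mem_box_cart abs_less_iff minus_less_iff)
      then show "x \<in> (\<Union>n. C n)" by auto
    qed auto
    then have "(\<lambda>n. d (C n)) \<longlonglongrightarrow> d UNIV"
      unfolding d_def
      using fin[THEN finite_measure.finite_Lim_measure_incseq, of C] C C' sets
      by (intro tendsto_diff) simp_all
    then show ?thesis
      using box by (simp add: C_def LIMSEQ_const_iff)
  qed
  have "Int_stable (range (\<lambda>(a, b). box a b :: (real^'n) set))"
    by (auto simp: Int_stable_def box_Int_box)
  moreover have "range (\<lambda>(a, b). box a b :: (real^'n) set) \<subseteq> Pow UNIV"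
    by simp
  moreover have "A \<in> sigma_sets UNIV (range (\<lambda>(a, b). box a b))"
    using A unfolding borel_eq_box by (simp add: sets_measure_of)
  ultimately have "d A = 0"
  proof (induction rule: sigma_sets_induct_disjoint[consumes 3])
    case (basic A) then show ?case using box by auto
  next
    case empty show ?case by (simp add: d_def)
  next
    case (compl A)
    then have "A \<in> sets borel" unfolding borel_eq_box by (simp add: sets_measure_of)
    with sets have "d (UNIV - A) = d UNIV - d A"
      unfolding d_def
      using fin[THEN finite_measure.finite_measure_compl, of A] sp by simp
    with compl un show ?case by simp
  next
    case (union B)
    then have "range B \<subseteq> sets borel"
      unfolding borel_eq_box by (auto simp: sets_measure_of)
    from sums[OF this] union show ?case
      by (simp add: sums_iff)
  qed
  then show ?thesis by (simp add: d_def)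
qed

section \<open>Distributional gradients\<close>

lemma integrable_lebesgue_borel_version:
  fixes g :: "'a::euclidean_space \<Rightarrow> real"
  assumes "integrable lebesgue g"
  obtains g' where "integrable lborel g'" "AE x in lebesgue. g x = g' x"
proof -
  obtain g' where g': "g' \<in> borel_measurable lborel" "AE x in lborel. g x = g' x"
    using completion_ex_borel_measurable_real[of g lborel] assms by auto
  then have AE: "AE x in lebesgue. g x = g' x"
    by (simp add: AE_completion)
  then have "integrable lebesgue g'"
    using assms g' by (subst integrable_cong_AE[of g' lebesgue g])
      (auto intro: measurable_completion)
  then show ?thesis
    using that AE g' by (simp add: integrable_completion)
qed

text \<open>Since \<open>ennreal\<close> maps negative numbers to zero, the density is the positive part of \<open>g\<close>, and
  \<open>density_measure g\<close> together with \<open>density_measure (\<lambda>x. - g x)\<close> is the Jordan decomposition of the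
  signed measure with density \<open>g\<close>.\<close>

definition density_measure :: "(real^'n \<Rightarrow> real) \<Rightarrow> (real^'n) measure" where
  "density_measure g = density lborel (\<lambda>x. ennreal (g x))"

lemma sets_density_measure [simp]: "sets (density_measure g) = sets borel"
  by (simp add: density_measure_def)

lemma density_measure_eq_max: "density_measure g = density lborel (\<lambda>x. ennreal (max 0 (g x)))"
proof -
  have "ennreal (g x) = ennreal (max 0 (g x))" for x
    by (cases "0 \<le> g x") (auto simp: ennreal_neg max_def)
  then show ?thesis by (simp add: density_measure_def)
qed

lemma finite_density_measure:
  assumes g: "integrable lborel g"
  shows "finite_measure (density_measure g)"
proof
  have [measurable]: "g \<in> borel_measurable borel"
    using g by auto
  have "emeasure (density_measure g) (space (density_measure g)) = (\<integral>\<^sup>+x. ennreal (max 0 (g x)) \<partial>lborel)"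
    by (simp add: density_measure_eq_max emeasure_density cong: nn_integral_cong)
  also have "\<dots> \<noteq> \<infinity>"
    using g by (simp add: nn_integral_eq_integral)
  finally show "emeasure (density_measure g) (space (density_measure g)) \<noteq> \<infinity>" .
qed

lemma integral_density_measure:
  fixes \<phi> :: "real^'n \<Rightarrow> real"
  assumes g: "integrable lborel g" and [measurable]: "\<phi> \<in> borel_measurable borel"
    and b: "\<And>x. \<bar>\<phi> x\<bar> \<le> B"
  shows "(\<integral>x. \<phi> x \<partial>density_measure g) - (\<integral>x. \<phi> x \<partial>density_measure (\<lambda>x. - g x))
    = (\<integral>x. g x * \<phi> x \<partial>lborel)" (is "?l = _")
proof -
  have [measurable]: "g \<in> borel_measurable borel"
    using g by auto
  have I: "integrable lborel (\<lambda>x. max 0 (f x) * \<phi> x)" if f: "integrable lborel f" for f :: "real^'n \<Rightarrow> real"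
  proof (rule Bochner_Integration.integrable_bound)
    show "integrable lborel (\<lambda>x. max 0 (f x) * B)"
      using f by simp
    have [measurable]: "f \<in> borel_measurable borel"
      using f by auto
    show "(\<lambda>x. max 0 (f x) * \<phi> x) \<in> borel_measurable lborel"
      by measurable
    show "AE x in lborel. norm (max 0 (f x) * \<phi> x) \<le> norm (max 0 (f x) * B)"
      using b by (auto simp: abs_mult intro!: mult_left_mono order_trans[OF b] AE_I2)
  qed
  have "?l = (\<integral>x. max 0 (g x) * \<phi> x \<partial>lborel) - (\<integral>x. max 0 (- g x) * \<phi> x \<partial>lborel)"
    unfolding density_measure_eq_max by (simp add: integral_density)
  also have "\<dots> = (\<integral>x. max 0 (g x) * \<phi> x - max 0 (- g x) * \<phi> x \<partial>lborel)"
    using I[of g] I[of "\<lambda>x. - g x"] g by (simp add: Bochner_Integration.integral_diff)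
  also have "\<dots> = (\<integral>x. g x * \<phi> x \<partial>lborel)"
    by (rule Bochner_Integration.integral_cong) (auto simp: max_def)
  finally show ?thesis .
qed

lemma measure_density_measure:
  assumes g: "integrable lborel g" and A: "A \<in> sets borel"
  shows "measure (density_measure g) A - measure (density_measure (\<lambda>x. - g x)) A
    = (\<integral>x. g x * indicator A x \<partial>lborel)"
  using integral_density_measure[OF g, of "indicator A" 1] A
  by (simp add: density_measure_def)

lemma test_function_bounded:
  assumes "test_function \<phi>"
  obtains B where "\<And>x. \<bar>\<phi> x\<bar> \<le> B"
proof -
  have "compact (\<phi> ` closure {x. \<phi> x \<noteq> 0})"
    using assms test_function_continuous[OF assms]
    by (intro compact_continuous_image) (auto simp: test_function_def intro: continuous_on_subset)
  then have "bounded (\<phi> ` closure {x. \<phi> x \<noteq> 0})"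
    by (rule compact_imp_bounded)
  then obtain B where B: "\<forall>y\<in>\<phi> ` closure {x. \<phi> x \<noteq> 0}. \<bar>y\<bar> \<le> B"
    unfolding bounded_real by auto
  have "\<bar>\<phi> x\<bar> \<le> max B 0" for x
  proof (cases "\<phi> x = 0")
    case False
    then have "x \<in> closure {x. \<phi> x \<noteq> 0}"
      using closure_subset[of "{x. \<phi> x \<noteq> 0}"] by auto
    then have "\<bar>\<phi> x\<bar> \<le> B" using B by blast
    then show ?thesis by simp
  qed simp
  with that show ?thesis by blast
qed

lemma test_function_measurable [measurable_dest]:
  "test_function \<phi> \<Longrightarrow> \<phi> \<in> borel_measurable borel"
  by (intro borel_measurable_continuous_onI test_function_continuous)

lemma test_integral_density_measure:
  assumes g: "integrable lborel g" and \<phi>: "test_function \<phi>"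
  shows "(\<integral>x. \<phi> x \<partial>density_measure g) - (\<integral>x. \<phi> x \<partial>density_measure (\<lambda>x. - g x))
    = (\<integral>x. g x * \<phi> x \<partial>lborel)"
proof -
  obtain B where "\<And>x. \<bar>\<phi> x\<bar> \<le> B" using test_function_bounded[OF \<phi>] by blast
  then show ?thesis by (rule integral_density_measure[OF g test_function_measurable[OF \<phi>]])
qed

text \<open>The two functions have equal integrals over all Borel sets, in particular over the sets on which
  one of them exceeds the other.\<close>

lemma AE_eq_if_test_integrals_eq:
  fixes g h :: "real^'n \<Rightarrow> real"
  assumes g: "integrable lborel g" and h: "integrable lborel h"
    and eq: "\<And>\<phi>. test_function \<phi> \<Longrightarrow> (\<integral>x. g x * \<phi> x \<partial>lborel) = (\<integral>x. h x * \<phi> x \<partial>lborel)"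
  shows "AE x in lborel. g x = h x"
proof -
  have [measurable]: "g \<in> borel_measurable borel" "h \<in> borel_measurable borel"
    using g h by auto
  have set: "(\<integral>x. g x * indicator A x \<partial>lborel) = (\<integral>x. h x * indicator A x \<partial>lborel)"
    if A: "A \<in> sets borel" for A
    unfolding measure_density_measure[OF g A, symmetric] measure_density_measure[OF h A, symmetric]
  proof (rule measures_eq_if_test_integrals_eq[OF _ _ _ _ _ _ _ _ _ A])
    fix \<phi> :: "real^'n \<Rightarrow> real" assume \<phi>: "test_function \<phi>"
    show "integral\<^sup>L (density_measure g) \<phi> - integral\<^sup>L (density_measure (\<lambda>x. - g x)) \<phi>
        = integral\<^sup>L (density_measure h) \<phi> - integral\<^sup>L (density_measure (\<lambda>x. - h x)) \<phi>"
      using test_integral_density_measure[OF g \<phi>]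
        test_integral_density_measure[OF h \<phi>] eq[OF \<phi>] by simp
  qed (use g h in \<open>auto intro!: finite_density_measure\<close>)
  have pos: "AE x in lborel. f x \<le> k x"
    if f: "integrable lborel f" and k: "integrable lborel k"
      and e: "\<And>A. A \<in> sets borel \<Longrightarrow>
        (\<integral>x. f x * indicator A x \<partial>lborel) = (\<integral>x. k x * indicator A x \<partial>lborel)"
    for f k :: "real^'n \<Rightarrow> real"
  proof -
    have [measurable]: "f \<in> borel_measurable borel" "k \<in> borel_measurable borel"
      using f k by auto
    define A where "A = {x. k x < f x}"
    have [measurable]: "A \<in> sets borel"
      unfolding A_def by measurable
    have "(\<integral>x. max 0 (f x - k x) \<partial>lborel)
        = (\<integral>x. f x * indicator A x - k x * indicator A x \<partial>lborel)"
      by (rule Bochner_Integration.integral_cong) (auto simp: A_def max_def indicator_def)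
    also have "\<dots> = 0"
      using e[of A] f k by (subst Bochner_Integration.integral_diff)
        (auto intro!: integrable_real_mult_indicator)
    finally have "AE x in lborel. max 0 (f x - k x) = 0"
      using f k by (subst (asm) integral_nonneg_eq_0_iff_AE) auto
    then show ?thesis by eventually_elim (auto simp: max_def split: if_splits)
  qed
  have "AE x in lborel. g x \<le> h x" "AE x in lborel. h x \<le> g x"
    using set by (auto intro!: pos g h)
  then show ?thesis
    by eventually_elim auto
qed

lemma test_integral_lebesgue:
  assumes "AE x in lebesgue. g x = g' x" "g' \<in> borel_measurable borel" "g \<in> borel_measurable lebesgue"
    "\<phi> \<in> borel_measurable borel"
  shows "(\<integral>x. g x * \<phi> x \<partial>lebesgue) = (\<integral>x. g' x * (\<phi> x :: real) \<partial>(lborel :: (real^'n) measure))"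
proof -
  have [measurable]: "\<phi> \<in> borel_measurable lebesgue" "g' \<in> borel_measurable lebesgue"
    "g \<in> borel_measurable lebesgue"
    using assms by (auto intro: measurable_completion)
  have "(\<integral>x. g x * \<phi> x \<partial>lebesgue) = (\<integral>x. g' x * \<phi> x \<partial>lebesgue)"
    using assms(1) by (intro integral_cong_AE) (auto elim: eventually_mono)
  then show ?thesis
    using assms by (simp add: integral_completion)
qed

lemma L1_gradient_AE_unique:
  assumes g: "is_L1_gradient u g" and h: "is_L1_gradient u h"
  shows "AE x in lebesgue. g x = h x"
proof -
  have "AE x in lebesgue. g x $ i = h x $ i" for i
  proof -
    have ig: "integrable lebesgue (\<lambda>x. g x $ i)" and ih: "integrable lebesgue (\<lambda>x. h x $ i)"
      using g h by (auto simp: is_L1_gradient_def intro: integrable_bounded_linear[OF bounded_linear_vec_nth])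
    obtain g' where g': "integrable lborel g'" "AE x in lebesgue. g x $ i = g' x"
      using integrable_lebesgue_borel_version[OF ig] .
    obtain h' where h': "integrable lborel h'" "AE x in lebesgue. h x $ i = h' x"
      using integrable_lebesgue_borel_version[OF ih] .
    have "AE x in lborel. g' x = h' x"
    proof (rule AE_eq_if_test_integrals_eq[OF g'(1) h'(1)])
      fix \<phi> :: "real^'a \<Rightarrow> real" assume \<phi>: "test_function \<phi>"
      have "(\<integral>x. g' x * \<phi> x \<partial>lborel) = distr_partial u i \<phi>"
        using g g' ig \<phi> by (subst test_integral_lebesgue[symmetric]) (auto simp: is_L1_gradient_def
            test_function_measurable)
      also have "\<dots> = (\<integral>x. h' x * \<phi> x \<partial>lborel)"
        using h h' ih \<phi> by (subst test_integral_lebesgue[of "\<lambda>x. h x $ i" h', symmetric])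
          (auto simp: is_L1_gradient_def test_function_measurable)
      finally show "(\<integral>x. g' x * \<phi> x \<partial>lborel) = (\<integral>x. h' x * \<phi> x \<partial>lborel)" .
    qed
    then have "AE x in lebesgue. g' x = h' x" by (simp add: AE_completion)
    with g'(2) h'(2) show ?thesis by eventually_elim simp
  qed
  then have "AE x in lebesgue. \<forall>i\<in>UNIV. g x $ i = h x $ i"
    by (subst AE_finite_all) auto
  then show ?thesis by eventually_elim (simp add: vec_eq_iff)
qed

lemma integral_norm_L1_gradient:
  assumes g: "is_L1_gradient u g"
  shows "(\<integral>x. norm (L1_gradient u x) \<partial>lebesgue) = (\<integral>x. norm (g x) \<partial>lebesgue)"
proof -
  have h: "is_L1_gradient u (L1_gradient u)"
    unfolding L1_gradient_def by (rule someI[of _ g]) (rule g)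
  show ?thesis
    using L1_gradient_AE_unique[OF g h] g h
    by (intro integral_cong_AE) (auto simp: is_L1_gradient_def elim: eventually_mono)
qed

section \<open>Gradient measures\<close>

text \<open>The supremum that defines the positive part is attained on the subset where \<open>g\<close> is positive.\<close>

lemma upper_variation_integral:
  fixes g :: "real^'n \<Rightarrow> real"
  assumes g: "integrable lborel g"
    and m: "\<And>A. A \<in> sets borel \<Longrightarrow> m A = (\<integral>x. g x * indicator A x \<partial>lborel)"
  shows "upper_variation m = density_measure g"
proof -
  have [measurable]: "g \<in> borel_measurable borel"
    using g by auto
  have fm: "finite_measure (density_measure g)"
    by (rule finite_density_measure[OF g])
  have "(SUP B \<in> {B \<in> sets borel. B \<subseteq> A}. ennreal (m B)) = emeasure (density_measure g) A"
    if A: "A \<in> sets borel" for A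
  proof (rule antisym)
    show "(SUP B \<in> {B \<in> sets borel. B \<subseteq> A}. ennreal (m B)) \<le> emeasure (density_measure g) A"
    proof (rule SUP_least)
      fix B assume B: "B \<in> {B \<in> sets borel. B \<subseteq> A}"
      then have "m B \<le> measure (density_measure g) B"
        using m[of B] measure_density_measure[OF g, of B]
          measure_nonneg[of "density_measure (\<lambda>x. - g x)" B]
        by (smt (verit) mem_Collect_eq)
      then have "ennreal (m B) \<le> emeasure (density_measure g) B"
        by (simp add: finite_measure.emeasure_eq_measure[OF fm] ennreal_leI)
      also have "\<dots> \<le> emeasure (density_measure g) A"
        using A B by (intro emeasure_mono) auto
      finally show "ennreal (m B) \<le> emeasure (density_measure g) A" .
    qed
    define P where "P = A \<inter> {x. 0 < g x}"
    have P: "P \<in> sets borel"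
      using A unfolding P_def by measurable
    have "emeasure (density_measure g) A = (\<integral>\<^sup>+x. ennreal (g x * indicator P x) \<partial>lborel)"
      using A unfolding density_measure_def
      by (subst emeasure_density) (auto intro!: nn_integral_cong simp: P_def indicator_def ennreal_neg)
    also have "\<dots> = ennreal (m P)"
      unfolding m[OF P] using g P
      by (intro nn_integral_eq_integral integrable_real_mult_indicator)
         (auto simp: P_def indicator_def)
    also have "\<dots> \<le> (SUP B \<in> {B \<in> sets borel. B \<subseteq> A}. ennreal (m B))"
      using P by (intro SUP_upper) (auto simp: P_def)
    finally show "emeasure (density_measure g) A \<le> (SUP B \<in> {B \<in> sets borel. B \<subseteq> A}. ennreal (m B))" .
  qed
  then have "upper_variation m = measure_of UNIV (sets borel) (emeasure (density_measure g))"
    unfolding upper_variation_def by (intro measure_of_eq) (auto simp: sets.sigma_sets_eq[of borel, simplified])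
  also have "\<dots> = density_measure g"
    using measure_of_of_measure[of "density_measure g"] by (simp add: density_measure_def)
  finally show ?thesis .
qed

definition signed_measure :: "((real^'n) set \<Rightarrow> real) \<Rightarrow> bool" where
  "signed_measure m \<longleftrightarrow>
     (\<forall>F :: nat \<Rightarrow> (real^'n) set. range F \<subseteq> sets borel \<longrightarrow> disjoint_family F \<longrightarrow>
        (\<lambda>k. m (F k)) sums m (\<Union>k. F k))"

lemma signed_measure_uminus: "signed_measure m \<Longrightarrow> signed_measure (\<lambda>A. - m A)"
  by (auto simp: signed_measure_def intro: sums_minus)

lemma signed_measure_empty:
  assumes "signed_measure m"
  shows "m {} = 0"
proof -
  have "(\<lambda>k::nat. m {}) sums m {}"
    using assms[unfolded signed_measure_def, rule_format, of "\<lambda>_. {}"]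
    by (simp add: disjoint_family_on_def)
  from summable_LIMSEQ_zero[OF sums_summable[OF this]] show ?thesis
    by (simp add: LIMSEQ_const_iff)
qed

lemma signed_measure_Un:
  assumes m: "signed_measure m" and AB: "A \<in> sets borel" "B \<in> sets borel" "A \<inter> B = {}"
  shows "m (A \<union> B) = m A + m B"
proof -
  have "(\<lambda>k. m (binaryset A B k)) sums m (\<Union>k. binaryset A B k)"
    using AB by (intro m[unfolded signed_measure_def, rule_format])
      (auto simp: binaryset_def disjoint_family_on_def)
  moreover have "(\<lambda>k. m (binaryset A B k)) sums (m A + m B)"
    by (rule binaryset_sums[of m A B, OF signed_measure_empty[OF m]])
  ultimately show ?thesis
    using sums_unique2 by (simp add: UN_binaryset_eq)
qed

text \<open>Superadditivity on disjoint sets follows from additivity of \<open>m\<close>, by joining nearly optimal subsets;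
  countable subadditivity follows by cutting a subset of the union into its pieces. Together they
  make the supremum a measure.\<close>

lemma upper_variation_measure:
  fixes m :: "(real^'n) set \<Rightarrow> real"
  assumes m: "signed_measure m" and bound: "\<forall>A\<in>sets borel. \<bar>m A\<bar> \<le> K"
  shows "finite_measure (upper_variation m)" "sets (upper_variation m) = sets borel"
    "A \<in> sets borel \<Longrightarrow>
      emeasure (upper_variation m) A = (SUP B \<in> {B \<in> sets borel. B \<subseteq> A}. ennreal (m B))"
proof -
  define U where "U A = (SUP B \<in> {B \<in> sets borel. B \<subseteq> A}. ennreal (m B))" for A
  have U_upper: "ennreal (m B) \<le> U A" if "B \<in> sets borel" "B \<subseteq> A" for A B
    unfolding U_def using that by (intro SUP_upper) auto
  have empty: "m {} = 0"
    by (rule signed_measure_empty[OF m])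
  have superadd: "U A + U B \<le> U (A \<union> B)" if "A \<inter> B = {}" for A B
  proof -
    have pair: "ennreal (m A') + ennreal (m B') \<le> U (A \<union> B)"
      if A': "A' \<in> sets borel" "A' \<subseteq> A" and B': "B' \<in> sets borel" "B' \<subseteq> B" for A' B'
    proof -
      consider "m A' \<le> 0" | "m B' \<le> 0" | "0 \<le> m A'" "0 \<le> m B'" by linarith
      then show ?thesis
      proof cases
        case 1
        then show ?thesis using U_upper[of B' "A \<union> B"] B' by (auto simp: ennreal_neg)
      next
        case 2
        then show ?thesis using U_upper[of A' "A \<union> B"] A' by (auto simp: ennreal_neg)
      next
        case 3
        moreover have "m (A' \<union> B') = m A' + m B'"
          using that \<open>A \<inter> B = {}\<close> by (intro signed_measure_Un[OF m]) auto
        moreover have "ennreal (m (A' \<union> B')) \<le> U (A \<union> B)"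
          using A' B' by (intro U_upper) auto
        ultimately show ?thesis by simp
      qed
    qed
    have "U A + U B = (SUP A' \<in> {A' \<in> sets borel. A' \<subseteq> A}. ennreal (m A') + U B)"
      unfolding U_def[of A] by (intro ennreal_SUP_add_left[symmetric]) auto
    also have "\<dots> \<le> U (A \<union> B)"
    proof (rule SUP_least)
      fix A' assume A': "A' \<in> {A' \<in> sets borel. A' \<subseteq> A}"
      have "ennreal (m A') + U B = (SUP B' \<in> {B' \<in> sets borel. B' \<subseteq> B}. ennreal (m A') + ennreal (m B'))"
        unfolding U_def[of B] add.commute[of "ennreal (m A')"]
        by (intro ennreal_SUP_add_left[symmetric]) auto
      also have "\<dots> \<le> U (A \<union> B)"
        using A' by (intro SUP_least pair) auto
      finally show "ennreal (m A') + U B \<le> U (A \<union> B)" .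
    qed
    finally show ?thesis .
  qed
  have mono: "U A \<le> U B" if "A \<subseteq> B" for A B
    unfolding U_def using that by (intro SUP_subset_mono) auto
  have "countably_additive (sets borel) U"
  proof (rule countably_additiveI)
    fix F :: "nat \<Rightarrow> (real^'n) set"
    assume F: "range F \<subseteq> sets borel" "disjoint_family F"
    show "(\<Sum>k. U (F k)) = U (\<Union>k. F k)"
    proof (rule antisym)
      have partial: "(\<Sum>k<n. U (F k)) \<le> U (\<Union>k<n. F k)" for n
      proof (induction n)
        case (Suc n)
        have "(\<Union>k<n. F k) \<inter> F n = {}"
          using F(2) by (auto simp: disjoint_family_on_def dest: less_imp_neq)
        from order_trans[OF add_right_mono[OF Suc] superadd[OF this]]
        show ?case by (simp add: lessThan_Suc Un_commute add.commute)
      qed simp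
      show "(\<Sum>k. U (F k)) \<le> U (\<Union>k. F k)"
        by (intro suminf_le_const order_trans[OF partial mono]) auto
    next
      show "U (\<Union>k. F k) \<le> (\<Sum>k. U (F k))"
        unfolding U_def[of "\<Union>k. F k"]
      proof (rule SUP_least)
        fix B assume B: "B \<in> {B \<in> sets borel. B \<subseteq> (\<Union>k. F k)}"
        have "(\<lambda>k. m (B \<inter> F k)) sums m (\<Union>k. B \<inter> F k)"
          using B F by (intro m[unfolded signed_measure_def, rule_format])
            (auto simp: disjoint_family_on_def)
        moreover have "(\<Union>k. B \<inter> F k) = B" using B by auto
        ultimately have lim: "(\<lambda>n. ennreal (\<Sum>k<n. m (B \<inter> F k))) \<longlonglongrightarrow> ennreal (m B)"
          by (auto simp: sums_def)
        have le: "ennreal (\<Sum>k<n. m (B \<inter> F k)) \<le> (\<Sum>k<n. U (F k))" for n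
        proof (induction n)
          case (Suc n)
          have "ennreal ((\<Sum>k<n. m (B \<inter> F k)) + m (B \<inter> F n))
              \<le> ennreal (\<Sum>k<n. m (B \<inter> F k)) + ennreal (m (B \<inter> F n))"
            by (cases "0 \<le> (\<Sum>k<n. m (B \<inter> F k))"; cases "0 \<le> m (B \<inter> F n)")
               (auto simp: ennreal_neg simp flip: ennreal_plus intro!: ennreal_leI)
          also have "\<dots> \<le> (\<Sum>k<n. U (F k)) + U (F n)"
            using B F by (intro add_mono Suc U_upper) auto
          finally show ?case by simp
        qed simp
        show "ennreal (m B) \<le> (\<Sum>k. U (F k))"
          by (rule LIMSEQ_le_const2[OF lim]) (auto intro!: exI[of _ 0] order_trans[OF le] sum_le_suminf)
      qed
    qed
  qed
  moreover have "positive (sets borel) U"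
  proof -
    have "U {} = 0" unfolding U_def by (simp add: empty cong: conj_cong)
    then show ?thesis by (simp add: positive_def)
  qed
  moreover have eq: "upper_variation m = measure_of UNIV (sets borel) U"
    unfolding upper_variation_def U_def by simp
  ultimately have em: "emeasure (upper_variation m) A = U A" if "A \<in> sets borel" for A
    unfolding eq using that sets.sigma_algebra_axioms[of borel]
    by (intro emeasure_measure_of_sigma) simp_all
  show sets: "sets (upper_variation m) = sets borel"
    unfolding eq using sets.sigma_sets_eq[of borel] by (simp add: sets_measure_of_conv)
  have "U UNIV \<le> ennreal K"
    unfolding U_def using bound by (intro SUP_least ennreal_leI) (auto simp: abs_le_iff)
  then show "finite_measure (upper_variation m)"
    using em[of UNIV] sets_eq_imp_space_eq[OF sets]
    by (intro finite_measureI) (auto simp: top_unique)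
  show "A \<in> sets borel \<Longrightarrow>
      emeasure (upper_variation m) A = (SUP B \<in> {B \<in> sets borel. B \<subseteq> A}. ennreal (m B))"
    using em unfolding U_def .
qed

text \<open>For a subset \<open>B\<close> of \<open>A\<close>, \<open>m B = m A - m (A - B)\<close>. Taking suprema over \<open>B\<close> bounds the
  positive part of \<open>A\<close> by \<open>m A\<close> plus the negative part; applying this to \<open>- m\<close> gives equality.\<close>

lemma jordan_decomposition:
  fixes m :: "(real^'n) set \<Rightarrow> real"
  assumes m: "signed_measure m" and bound: "\<forall>A\<in>sets borel. \<bar>m A\<bar> \<le> K"
    and A: "A \<in> sets borel"
  shows "measure (upper_variation m) A - measure (upper_variation (\<lambda>A. - m A)) A = m A"
proof -
  have half: "measure (upper_variation f) A \<le> f A + measure (upper_variation (\<lambda>A. - f A)) A"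
    if f: "signed_measure f" and fb: "\<forall>A\<in>sets borel. \<bar>f A\<bar> \<le> K"
    for f :: "(real^'n) set \<Rightarrow> real"
  proof -
    have gb: "\<forall>A\<in>sets borel. \<bar>- f A\<bar> \<le> K" using fb by simp
    note pos = upper_variation_measure[OF f fb]
    note neg = upper_variation_measure[OF signed_measure_uminus[OF f] gb]
    let ?V = "measure (upper_variation (\<lambda>A. - f A)) A"
    have le: "f B \<le> f A + ?V" if B: "B \<in> sets borel" "B \<subseteq> A" for B
    proof -
      have "f (B \<union> (A - B)) = f B + f (A - B)"
        using B A by (intro signed_measure_Un[OF f]) auto
      moreover have "B \<union> (A - B) = A" using B by auto
      moreover have "ennreal (- f (A - B)) \<le> ennreal ?V"
        unfolding finite_measure.emeasure_eq_measure[OF neg(1), symmetric] neg(3)[OF A]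
        using A B by (intro SUP_upper) auto
      then have "- f (A - B) \<le> ?V"
        by (simp add: ennreal_le_iff2) (use measure_nonneg in \<open>smt (verit)\<close>)
      ultimately show ?thesis by simp
    qed
    have "0 \<le> f A + ?V"
      using le[of "{}"] signed_measure_empty[OF f] by simp
    moreover have "ennreal (measure (upper_variation f) A) \<le> ennreal (f A + ?V)"
      unfolding finite_measure.emeasure_eq_measure[OF pos(1), symmetric] pos(3)[OF A]
      by (intro SUP_least ennreal_leI le) auto
    ultimately show ?thesis by (simp add: ennreal_le_iff)
  qed
  show ?thesis
    using half[OF m bound] half[OF signed_measure_uminus[OF m]] bound by simp
qed

lemma norm_vector_measure_le:
  assumes "A \<in> sets borel"
  shows "ennreal (norm (\<mu> A)) \<le> total_variation \<mu> UNIV"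
proof -
  define F where "F = (\<lambda>k::nat. binaryset A (- A) k)"
  have "F 0 = A" by (simp add: F_def binaryset_def)
  then have "ennreal (norm (\<mu> A)) = (\<Sum>k<Suc 0. ennreal (norm (\<mu> (F k))))" by simp
  also have "\<dots> \<le> (\<Sum>k. ennreal (norm (\<mu> (F k))))"
    by (rule sum_le_suminf) auto
  also have "\<dots> \<le> total_variation \<mu> UNIV"
    unfolding total_variation_def
  proof (rule SUP_upper)
    have "range F \<subseteq> sets borel" "disjoint_family F"
      using assms by (auto simp: F_def binaryset_def disjoint_family_on_def)
    moreover have "(\<Union>k. F k) = UNIV"
      unfolding F_def by (simp add: UN_binaryset_eq)
    ultimately show "F \<in> {A. range A \<subseteq> sets borel \<and> disjoint_family A \<and> \<Union> (range A) = UNIV}"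
      by simp
  qed
  finally show ?thesis .
qed

definition integral_measure :: "(real^'n \<Rightarrow> real^'n) \<Rightarrow> (real^'n) set \<Rightarrow> real^'n" where
  "integral_measure g A = (\<integral>x. indicator A x *\<^sub>R g x \<partial>lborel)"

lemma integral_measure_component:
  assumes g: "integrable lborel g" and A: "A \<in> sets borel"
  shows "integral_measure g A $ i = (\<integral>x. g x $ i * indicator A x \<partial>lborel)"
proof -
  have "integrable lborel (\<lambda>x. indicator A x *\<^sub>R g x)"
    using A g by (intro integrable_mult_indicator) auto
  from integral_bounded_linear[OF bounded_linear_vec_nth[of i] this]
  show ?thesis by (simp add: integral_measure_def mult.commute)
qed

lemma vector_measure_integral_measure:
  fixes g :: "real^'n \<Rightarrow> real^'n"
  assumes g: "integrable lborel g"
  shows "vector_measure (integral_measure g)"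
  unfolding vector_measure_def
proof (intro allI impI)
  fix F :: "nat \<Rightarrow> (real^'n) set"
  assume F: "range F \<subseteq> sets borel" "disjoint_family F"
  have [measurable]: "F k \<in> sets borel" for k using F by auto
  have [measurable]: "g \<in> borel_measurable borel" using g by auto
  have int: "integrable lborel (\<lambda>x. indicator (F k) x *\<^sub>R g x)" for k
    using g by (intro integrable_mult_indicator) auto
  have "(\<lambda>n. \<integral>x. (\<Sum>k<n. indicator (F k) x *\<^sub>R g x) \<partial>lborel) \<longlonglongrightarrow>
      (\<integral>x. indicator (\<Union>k. F k) x *\<^sub>R g x \<partial>lborel)"
  proof (rule integral_dominated_convergence[where w = "\<lambda>x. norm (g x)"])
    show "AE x in lborel. (\<lambda>n. \<Sum>k<n. indicator (F k) x *\<^sub>R g x) \<longlonglongrightarrow> indicator (\<Union>k. F k) x *\<^sub>R g x"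
    proof (rule AE_I2)
      fix x
      have "(\<lambda>k. indicator (F k) x *\<^sub>R g x) sums (indicator (\<Union>k. F k) x *\<^sub>R g x)"
        using F(2) by (intro sums_scaleR_left indicator_sums) (auto simp: disjoint_family_on_def)
      then show "(\<lambda>n. \<Sum>k<n. indicator (F k) x *\<^sub>R g x) \<longlonglongrightarrow> indicator (\<Union>k. F k) x *\<^sub>R g x"
        unfolding sums_def .
    qed
    show "AE x in lborel. norm (\<Sum>k<n. indicator (F k) x *\<^sub>R g x) \<le> norm (g x)" for n
    proof (rule AE_I2)
      fix x
      have "(\<Sum>k<n. indicator (F k) x) = (indicator (\<Union>k<n. F k) x :: real)"
        using F(2) by (subst indicator_UN_disjoint) (auto simp: disjoint_family_on_def)
      then show "norm (\<Sum>k<n. indicator (F k) x *\<^sub>R g x) \<le> norm (g x)"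
        by (simp add: scaleR_sum_left[symmetric] indicator_def)
    qed
    show "(\<lambda>x. \<Sum>k<n. indicator (F k) x *\<^sub>R g x) \<in> borel_measurable lborel" for n
      using int by (intro borel_measurable_sum) auto
    show "(\<lambda>x. indicator (\<Union>k. F k) x *\<^sub>R g x) \<in> borel_measurable lborel"
      by (intro borel_measurable_scaleR borel_measurable_indicator) auto
  qed (use g in auto)
  then show "(\<lambda>k. integral_measure g (F k)) sums integral_measure g (\<Union>k. F k)"
    unfolding sums_def integral_measure_def
    by (simp only: Bochner_Integration.integral_sum[OF int])
qed

lemma total_variation_integral_measure_le:
  assumes g: "integrable lborel g"
    and \<mu>: "\<And>A. A \<in> sets borel \<Longrightarrow> \<mu> A = integral_measure g A"
  shows "total_variation \<mu> UNIV \<le> ennreal (\<integral>x. norm (g x) \<partial>lborel)"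
  unfolding total_variation_def
proof (rule SUP_least)
  fix F :: "nat \<Rightarrow> (real^'a) set"
  assume F: "F \<in> {A. range A \<subseteq> sets borel \<and> disjoint_family A \<and> (\<Union>k. A k) = UNIV}"
  then have Fk [measurable]: "F k \<in> sets borel" for k by auto
  have [measurable]: "g \<in> borel_measurable borel" using g by auto
  have "ennreal (norm (\<mu> (F k))) \<le> (\<integral>\<^sup>+x. ennreal (norm (g x)) * indicator (F k) x \<partial>lborel)" for k
  proof -
    have "ennreal (norm (\<mu> (F k))) \<le> (\<integral>\<^sup>+x. ennreal (norm (indicator (F k) x *\<^sub>R g x)) \<partial>lborel)"
      unfolding \<mu>[OF Fk] integral_measure_def
      using g by (intro integral_norm_bound_ennreal integrable_mult_indicator) auto
    also have "\<dots> = (\<integral>\<^sup>+x. ennreal (norm (g x)) * indicator (F k) x \<partial>lborel)"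
      by (intro nn_integral_cong) (auto simp: indicator_def)
    finally show ?thesis .
  qed
  then have "(\<Sum>k. ennreal (norm (\<mu> (F k)))) \<le> (\<Sum>k. \<integral>\<^sup>+x. ennreal (norm (g x)) * indicator (F k) x \<partial>lborel)"
    by (intro suminf_le) auto
  also have "\<dots> = (\<integral>\<^sup>+x. (\<Sum>k. ennreal (norm (g x)) * indicator (F k) x) \<partial>lborel)"
    by (subst nn_integral_suminf) auto
  also have "\<dots> = (\<integral>\<^sup>+x. ennreal (norm (g x)) \<partial>lborel)"
    using F by (simp add: ennreal_suminf_cmult suminf_indicator)
  also have "\<dots> = ennreal (\<integral>x. norm (g x) \<partial>lborel)"
    using g by (intro nn_integral_eq_integral) auto
  finally show "(\<Sum>k. ennreal (norm (\<mu> (F k)))) \<le> ennreal (\<integral>x. norm (g x) \<partial>lborel)" .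
qed

lemma L1_gradient_test_integral:
  assumes "is_L1_gradient u g" "integrable lborel g" "test_function \<phi>"
  shows "distr_partial u i \<phi> = (\<integral>x. g x $ i * \<phi> x \<partial>lborel)"
proof -
  have "(\<lambda>x. g x $ i) \<in> borel_measurable borel"
    using integrable_bounded_linear[OF bounded_linear_vec_nth assms(2), of i] by auto
  then have "(\<lambda>x. g x $ i * \<phi> x) \<in> borel_measurable lborel"
    using test_function_measurable[OF assms(3)] by simp
  from integral_completion[OF this] show ?thesis
    using assms unfolding is_L1_gradient_def by simp
qed

lemma is_measure_gradient_integral_measure:
  assumes u: "is_L1_gradient u g" and g: "integrable lborel g"
  shows "is_measure_gradient u (integral_measure g)"
  unfolding is_measure_gradient_def
proof (intro conjI allI impI)
  show "vector_measure (integral_measure g)"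
    by (rule vector_measure_integral_measure[OF g])
  show "total_variation (integral_measure g) UNIV < \<infinity>"
    using total_variation_integral_measure_le[OF g] by (rule order_le_less_trans) auto
  fix \<phi> :: "real^'a \<Rightarrow> real" and i assume \<phi>: "test_function \<phi>"
  have gi: "integrable lborel (\<lambda>x. g x $ i)"
    by (rule integrable_bounded_linear[OF bounded_linear_vec_nth g])
  have "upper_variation (\<lambda>A. integral_measure g A $ i) = density_measure (\<lambda>x. g x $ i)"
    by (rule upper_variation_integral[OF gi integral_measure_component[OF g]])
  moreover have "upper_variation (\<lambda>A. - (integral_measure g A $ i)) = density_measure (\<lambda>x. - (g x $ i))"
    using gi by (intro upper_variation_integral) (simp_all add: integral_measure_component[OF g])
  ultimately show "distr_partial u i \<phi> = signed_integral (\<lambda>A. integral_measure g A $ i) \<phi>"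
    using test_integral_density_measure[OF gi \<phi>]
    by (simp add: signed_integral_def L1_gradient_test_integral[OF u g \<phi>])
qed

text \<open>In each coordinate the positive and negative variations of \<open>\<mu>\<close> and the positive and negative parts
  of the density \<open>g\<close> have the same difference of integrals against test functions.\<close>

lemma measure_gradient_unique:
  assumes u: "is_L1_gradient u g" and g: "integrable lborel g"
    and \<mu>: "is_measure_gradient u \<mu>" and A: "A \<in> sets borel"
  shows "\<mu> A = integral_measure g A"
proof -
  have "\<mu> A $ i = integral_measure g A $ i" for i
  proof -
    have gi: "integrable lborel (\<lambda>x. g x $ i)"
      by (rule integrable_bounded_linear[OF bounded_linear_vec_nth g])
    then have gi': "integrable lborel (\<lambda>x. - (g x $ i))" by simp
    define m where "m A = \<mu> A $ i" for A
    have m: "signed_measure m"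
      unfolding m_def signed_measure_def using \<mu>
      by (auto intro!: bounded_linear.sums[OF bounded_linear_vec_nth]
          simp: is_measure_gradient_def vector_measure_def)
    have bound: "\<forall>A\<in>sets borel. \<bar>m A\<bar> \<le> enn2real (total_variation \<mu> UNIV)"
    proof
      fix A :: "(real^'a) set" assume that: "A \<in> sets borel"
      have "\<bar>m A\<bar> \<le> norm (\<mu> A)"
        unfolding m_def by (rule component_le_norm_cart)
      also have "\<dots> = enn2real (ennreal (norm (\<mu> A)))" by simp
      also have "\<dots> \<le> enn2real (total_variation \<mu> UNIV)"
        using norm_vector_measure_le[OF that, of \<mu>] \<mu>
        by (intro enn2real_mono) (auto simp: is_measure_gradient_def)
      finally show "\<bar>m A\<bar> \<le> enn2real (total_variation \<mu> UNIV)" .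
    qed
    have nbound: "\<forall>A\<in>sets borel. \<bar>- m A\<bar> \<le> enn2real (total_variation \<mu> UNIV)"
      using bound by simp
    note up = upper_variation_measure[OF m bound]
    note down = upper_variation_measure[OF signed_measure_uminus[OF m] nbound]
    have "measure (upper_variation m) A - measure (upper_variation (\<lambda>A. - m A)) A
      = measure (density_measure (\<lambda>x. g x $ i)) A - measure (density_measure (\<lambda>x. - (g x $ i))) A"
    proof (rule measures_eq_if_test_integrals_eq[OF up(1) down(1)
          finite_density_measure[OF gi] finite_density_measure[OF gi'] up(2) down(2) _ _ _ A])
      fix \<phi> :: "real^'a \<Rightarrow> real" assume \<phi>: "test_function \<phi>"
      have "distr_partial u i \<phi> = signed_integral m \<phi>"
        using \<mu> \<phi> by (simp add: is_measure_gradient_def m_def[abs_def])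
      then show "integral\<^sup>L (upper_variation m) \<phi> - integral\<^sup>L (upper_variation (\<lambda>A. - m A)) \<phi>
        = integral\<^sup>L (density_measure (\<lambda>x. g x $ i)) \<phi> - integral\<^sup>L (density_measure (\<lambda>x. - (g x $ i))) \<phi>"
        using test_integral_density_measure[OF gi \<phi>]
        by (simp add: signed_integral_def L1_gradient_test_integral[OF u g \<phi>])
    qed simp_all
    then show ?thesis
      using jordan_decomposition[OF m bound A] measure_density_measure[OF gi A]
      unfolding integral_measure_component[OF g A] m_def[of A, symmetric] by linarith
  qed
  then show ?thesis by (simp add: vec_eq_iff)
qed

lemma total_variation_measure_gradient_le:
  assumes u: "is_L1_gradient u g" and g: "integrable lborel g"
  shows "enn2real (total_variation (measure_gradient u) UNIV) \<le> (\<integral>x. norm (g x) \<partial>lborel)"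
proof -
  have \<mu>: "is_measure_gradient u (measure_gradient u)"
    unfolding measure_gradient_def
    by (rule someI[of _ "integral_measure g"]) (rule is_measure_gradient_integral_measure[OF u g])
  have "total_variation (measure_gradient u) UNIV \<le> ennreal (\<integral>x. norm (g x) \<partial>lborel)"
    by (rule total_variation_integral_measure_le[OF g measure_gradient_unique[OF u g \<mu>]])
  then show ?thesis
    by (intro enn2real_leI) auto
qed

section \<open>Continuously differentiable functions with bounded support\<close>

text \<open>Continuously differentiable functions with bounded support. The gradient is an explicit argument
  because the norms are estimated in terms of it.\<close>

definition C1c_grad :: "(real^'n \<Rightarrow> real) \<Rightarrow> (real^'n \<Rightarrow> real^'n) \<Rightarrow> bool" where
  "C1c_grad u g \<longleftrightarrow> continuous_on UNIV g \<and> (\<forall>x. (u has_derivative (\<lambda>h. g x \<bullet> h)) (at x)) \<and>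
     bounded {x. u x \<noteq> 0}"

lemma has_derivative_imp_continuous_on_UNIV:
  "(\<And>x. (f has_derivative f' x) (at x)) \<Longrightarrow> continuous_on UNIV f"
  by (auto simp: continuous_on_eq_continuous_at intro: has_derivative_continuous)

lemma C1c_grad_continuous: "C1c_grad u g \<Longrightarrow> continuous_on UNIV u"
  by (auto simp: C1c_grad_def intro: has_derivative_imp_continuous_on_UNIV)

lemma C1c_grad_support:
  assumes "C1c_grad u g"
  obtains R where "0 < R" "\<And>x. R < norm x \<Longrightarrow> u x = 0" "\<And>x. R < norm x \<Longrightarrow> g x = 0"
proof -
  obtain R where R: "0 < R" "\<And>x. u x \<noteq> 0 \<Longrightarrow> norm x \<le> R"
    using assms unfolding C1c_grad_def bounded_pos by auto
  have u0: "u x = 0" if "R < norm x" for x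
    using R(2)[of x] that by force
  have "g x = 0" if "R < norm x" for x
  proof -
    have "open {x :: real^'a. R < norm x}"
      by (intro open_Collect_less continuous_intros)
    moreover have "(u has_derivative (\<lambda>h. g x \<bullet> h)) (at x)"
      using assms by (simp add: C1c_grad_def)
    ultimately have "((\<lambda>x. 0) has_derivative (\<lambda>h. g x \<bullet> h)) (at x)"
      using u0 that
      by (elim has_derivative_transform_within_open[where s = "{x. R < norm x}"]) auto
    moreover have "((\<lambda>x. 0) has_derivative (\<lambda>h. 0 :: real)) (at x)" by simp
    ultimately have "(\<lambda>h. g x \<bullet> h) = (\<lambda>h. 0)"
      by (rule has_derivative_unique)
    then have "g x \<bullet> g x = 0" by meson
    then show ?thesis by simp
  qed
  then show ?thesis
    using that[OF R(1) u0] by blast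
qed

lemma integrable_continuous_bounded_support:
  fixes f :: "'a::euclidean_space \<Rightarrow> 'b::euclidean_space"
  assumes "continuous_on UNIV f" "\<And>x. R < norm x \<Longrightarrow> f x = 0"
  shows "integrable lborel f"
proof -
  have "integrable lborel (\<lambda>x. indicator (cball 0 R) x *\<^sub>R f x)"
    using assms(1) by (intro borel_integrable_compact) (auto intro: continuous_on_subset)
  moreover have "(\<lambda>x. indicator (cball 0 R) x *\<^sub>R f x) = f"
    using assms(2) by (auto simp: fun_eq_iff indicator_def not_le)
  ultimately show ?thesis by simp
qed

lemma continuous_bounded_support_bounded:
  fixes f :: "'a::euclidean_space \<Rightarrow> 'b::real_normed_vector"
  assumes "continuous_on UNIV f" "\<And>x. R < norm x \<Longrightarrow> f x = 0"
  obtains B where "0 \<le> B" "\<And>x. norm (f x) \<le> B"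
proof -
  have "compact (f ` cball 0 R)"
    using assms(1) by (intro compact_continuous_image) (auto intro: continuous_on_subset)
  from compact_imp_bounded[OF this] obtain B where B: "\<forall>y\<in>f ` cball 0 R. norm y \<le> B"
    unfolding bounded_iff by auto
  have "norm (f x) \<le> max B 0" for x
    using B assms(2)[of x] by (cases "R < norm x") (force simp: not_less)+
  then show ?thesis using that[of "max B 0"] by simp
qed

lemma C1c_grad_integrable:
  assumes "C1c_grad u g"
  shows "integrable lborel u" "integrable lborel g"
proof -
  obtain R where "0 < R" and R: "\<And>x. R < norm x \<Longrightarrow> u x = 0" "\<And>x. R < norm x \<Longrightarrow> g x = 0"
    using C1c_grad_support[OF assms] by metis
  show "integrable lborel u"
    by (rule integrable_continuous_bounded_support[OF C1c_grad_continuous[OF assms] R(1)])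
  show "integrable lborel g"
    using assms by (intro integrable_continuous_bounded_support[OF _ R(2)]) (simp_all add: C1c_grad_def)
qed

lemma C1c_grad_add:
  assumes "C1c_grad u g" "C1c_grad v h"
  shows "C1c_grad (\<lambda>x. u x + v x) (\<lambda>x. g x + h x)"
proof -
  have "bounded ({x. u x \<noteq> 0} \<union> {x. v x \<noteq> 0})"
    using assms by (simp add: C1c_grad_def)
  then have "bounded {x. u x + v x \<noteq> 0}"
    by (rule bounded_subset) auto
  then show ?thesis
    using assms unfolding C1c_grad_def
    by (auto intro!: continuous_intros has_derivative_eq_rhs[OF has_derivative_add]
        simp: inner_add_left)
qed

lemma C1c_grad_scale:
  assumes "C1c_grad u g"
  shows "C1c_grad (\<lambda>x. c * u x) (\<lambda>x. c *\<^sub>R g x)"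
proof -
  have "bounded {x. c * u x \<noteq> 0}"
    using assms unfolding C1c_grad_def by (auto intro: bounded_subset)
  then show ?thesis
    using assms unfolding C1c_grad_def
    by (auto intro!: continuous_intros has_derivative_eq_rhs[OF has_derivative_mult_right])
qed

lemma C1c_grad_zero: "C1c_grad (\<lambda>x. 0) (\<lambda>x. 0)"
  by (simp add: C1c_grad_def)

lemma C1c_grad_sum:
  assumes "\<And>i. i \<in> I \<Longrightarrow> C1c_grad (u i) (g i)"
  shows "C1c_grad (\<lambda>x. \<Sum>i\<in>I. u i x) (\<lambda>x. \<Sum>i\<in>I. g i x)"
  using assms by (induction I rule: infinite_finite_induct) (auto simp: C1c_grad_zero C1c_grad_add)

lemma continuous_on_translate:
  fixes f :: "'a::real_normed_vector \<Rightarrow> 'b::topological_space"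
  assumes "continuous_on UNIV f"
  shows "continuous_on UNIV (\<lambda>x. f (x + c))"
proof (rule continuous_on_compose2[OF assms])
  show "continuous_on UNIV (\<lambda>x. x + c)" by (intro continuous_intros)
qed simp

lemma C1c_grad_translate:
  assumes "C1c_grad u g"
  shows "C1c_grad (\<lambda>x. u (x - z)) (\<lambda>x. g (x - z))"
proof -
  have "{x. u (x - z) \<noteq> 0} = (\<lambda>x. z + x) ` {x. u x \<noteq> 0}"
  proof (intro equalityI subsetI)
    fix x assume "x \<in> {x. u (x - z) \<noteq> 0}"
    then show "x \<in> (\<lambda>x. z + x) ` {x. u x \<noteq> 0}"
      by (intro image_eqI[of _ _ "x - z"]) auto
  qed auto
  then have "bounded {x. u (x - z) \<noteq> 0}"
    using assms by (simp add: C1c_grad_def bounded_translation)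
  moreover have "((\<lambda>x. u (x - z)) has_derivative (\<lambda>h. g (x - z) \<bullet> h)) (at x)" for x
  proof -
    have "(u has_derivative (\<lambda>h. g (x - z) \<bullet> h)) (at (x - z))"
      using assms by (simp add: C1c_grad_def)
    moreover have "((\<lambda>x. x - z) has_derivative (\<lambda>h. h)) (at x)"
      by (auto intro!: derivative_eq_intros)
    ultimately show ?thesis
      by (rule has_derivative_compose[rotated])
  qed
  moreover have "continuous_on UNIV (\<lambda>x. g (x - z))"
    using assms continuous_on_translate[of g "- z"] by (simp add: C1c_grad_def)
  ultimately show ?thesis
    by (simp add: C1c_grad_def)
qed

lemma nn_integral_lborel_translate:
  fixes f :: "'a::euclidean_space \<Rightarrow> ennreal"
  assumes [measurable]: "f \<in> borel_measurable borel"
  shows "(\<integral>\<^sup>+x. f (x + z) \<partial>lborel) = (\<integral>\<^sup>+x. f x \<partial>lborel)"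
  by (subst (2) lborel_distr_plus[of z, symmetric]) (simp add: nn_integral_distr add.commute)

lemma integral_lborel_translate:
  fixes f :: "'a::euclidean_space \<Rightarrow> real"
  assumes [measurable]: "f \<in> borel_measurable borel"
  shows "(\<integral>x. f (x + z) \<partial>lborel) = (\<integral>x. f x \<partial>lborel)"
  by (subst (2) lborel_distr_plus[of z, symmetric]) (simp add: integral_distr add.commute)

lemma line_derivative:
  fixes F :: "'a::real_normed_vector \<Rightarrow> real"
  assumes "(F has_derivative F') (at (x + s *\<^sub>R e))"
  shows "((\<lambda>s. F (x + s *\<^sub>R e)) has_real_derivative F' e) (at s)"
proof -
  have "((\<lambda>s. F (x + s *\<^sub>R e)) has_derivative (\<lambda>h. F' (h *\<^sub>R e))) (at s)"
    by (rule has_derivative_compose[of "\<lambda>s. x + s *\<^sub>R e" "\<lambda>h. h *\<^sub>R e" _ _ F, OF _ assms])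
       (auto intro!: derivative_eq_intros)
  moreover have "(\<lambda>h. F' (h *\<^sub>R e)) = (*) (F' e)"
    using linear_cmul[OF has_derivative_linear[OF assms]] by (auto simp: mult.commute)
  ultimately show ?thesis
    by (simp add: has_field_derivative_def)
qed

text \<open>The difference quotients in direction \<open>e\<close> have integral zero by translation invariance and
  converge boundedly, on a fixed bounded set, to the derivative.\<close>

lemma integral_directional_derivative_zero:
  fixes F :: "'a::euclidean_space \<Rightarrow> real"
  assumes F: "\<And>x. (F has_derivative F' x) (at x)"
    and cont: "continuous_on UNIV (\<lambda>x. F' x e)"
    and supp: "\<And>x. R < norm x \<Longrightarrow> F x = 0" "\<And>x. R < norm x \<Longrightarrow> F' x e = 0"
    and e: "norm e \<le> 1"
  shows "(\<integral>x. F' x e \<partial>lborel) = 0"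
proof -
  define t where "t n = inverse (real (Suc n))" for n
  have t: "0 < t n" "t n \<le> 1" for n
    by (simp_all add: t_def field_simps)
  have contF: "continuous_on UNIV F"
    using F by (rule has_derivative_imp_continuous_on_UNIV)
  then have [measurable]: "F \<in> borel_measurable borel"
    by (rule borel_measurable_continuous_onI)
  have [measurable]: "(\<lambda>x. F' x e) \<in> borel_measurable borel"
    using cont by (rule borel_measurable_continuous_onI)
  obtain B where B: "0 \<le> B" "\<And>x. norm (F' x e) \<le> B"
    using continuous_bounded_support_bounded[OF cont supp(2)] by metis
  have intF: "integrable lborel F"
    by (rule integrable_continuous_bounded_support[OF contF supp(1)])
  have intFt: "integrable lborel (\<lambda>x. F (x + t n *\<^sub>R e))" for n
  proof (rule integrable_continuous_bounded_support[where R = "R + 1"])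
    show "continuous_on UNIV (\<lambda>x. F (x + t n *\<^sub>R e))"
      by (rule continuous_on_translate[OF contF])
    show "F (x + t n *\<^sub>R e) = 0" if "R + 1 < norm x" for x
    proof (rule supp(1))
      have "norm (t n *\<^sub>R e) \<le> 1"
        using t[of n] e by (simp add: mult_le_one)
      then show "R < norm (x + t n *\<^sub>R e)"
        using that norm_diff_ineq[of x "t n *\<^sub>R e"] by linarith
    qed
  qed
  have lim: "(\<lambda>n. \<integral>x. (F (x + t n *\<^sub>R e) - F x) / t n \<partial>lborel) \<longlonglongrightarrow> (\<integral>x. F' x e \<partial>lborel)"
  proof (rule integral_dominated_convergence[where w = "\<lambda>x. B * indicator (cball 0 (R + 1)) x"])
    show "integrable lborel (\<lambda>x::'a. B * indicator (cball 0 (R + 1)) x)"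
      by (intro integrable_mult_right integrable_real_indicator)
        (auto simp: emeasure_lborel_cball_finite[unfolded infinity_ennreal_def])
    show "AE x in lborel. (\<lambda>n. (F (x + t n *\<^sub>R e) - F x) / t n) \<longlonglongrightarrow> F' x e"
    proof (rule AE_I2)
      fix x
      have "((\<lambda>s. F (x + s *\<^sub>R e)) has_real_derivative F' x e) (at 0)"
        using F[of x] by (intro line_derivative) simp
      then have "((\<lambda>h. (F (x + h *\<^sub>R e) - F x) / h) \<longlongrightarrow> F' x e) (at 0)"
        by (simp add: DERIV_def)
      moreover have "filterlim t (at 0) sequentially"
        unfolding t_def[abs_def] filterlim_at
        using LIMSEQ_inverse_real_of_nat by auto
      ultimately show "(\<lambda>n. (F (x + t n *\<^sub>R e) - F x) / t n) \<longlonglongrightarrow> F' x e"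
        by (rule filterlim_compose)
    qed
    show "AE x in lborel. norm ((F (x + t n *\<^sub>R e) - F x) / t n) \<le> B * indicator (cball 0 (R + 1)) x" for n
    proof (rule AE_I2)
      fix x
      show "norm ((F (x + t n *\<^sub>R e) - F x) / t n) \<le> B * indicator (cball 0 (R + 1)) x"
      proof (cases "x \<in> cball 0 (R + 1)")
        case True
        have "\<exists>s. 0 < s \<and> s < t n \<and> F (x + t n *\<^sub>R e) - F (x + 0 *\<^sub>R e) = (t n - 0) * F' (x + s *\<^sub>R e) e"
          using t by (intro MVT2 line_derivative F) auto
        then obtain s where "F (x + t n *\<^sub>R e) - F x = t n * F' (x + s *\<^sub>R e) e" by auto
        then show ?thesis
          using B(2)[of "x + s *\<^sub>R e"] t[of n] True by simp
      next
        case False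
        have "norm (t n *\<^sub>R e) \<le> 1"
          using t[of n] e by (simp add: mult_le_one)
        then have "R < norm (x + t n *\<^sub>R e)" "R < norm x"
          using False norm_diff_ineq[of x "t n *\<^sub>R e"] by auto
        then show ?thesis
          using B(1) by (simp add: supp)
      qed
    qed
  qed simp_all
  have zero: "(\<integral>x. (F (x + t n *\<^sub>R e) - F x) / t n \<partial>lborel) = 0" for n
    using intF intFt[of n] integral_lborel_translate[of F "t n *\<^sub>R e"]
    by (simp add: Bochner_Integration.integral_diff)
  from lim show ?thesis
    unfolding zero LIMSEQ_const_iff by (rule sym)
qed

lemma C1c_grad_is_L1_gradient:
  assumes u: "C1c_grad u g"
  shows "is_L1_gradient u g"
  unfolding is_L1_gradient_def
proof (intro conjI allI impI)
  show "integrable lebesgue g"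
    using C1c_grad_integrable(2)[OF u] by (subst integrable_completion) auto
  fix \<phi> :: "real^'a \<Rightarrow> real" and i assume \<phi>: "test_function \<phi>"
  obtain R where "0 < R" and R: "\<And>x. R < norm x \<Longrightarrow> u x = 0" "\<And>x. R < norm x \<Longrightarrow> g x = 0"
    using C1c_grad_support[OF u] by metis
  have "C_k (Suc 0) \<phi>" using \<phi> unfolding test_function_def by blast
  then have d: "\<And>x. \<phi> differentiable at x" and cd: "continuous_on UNIV (partial_deriv i \<phi>)"
    by auto
  note c\<phi> = test_function_continuous[OF \<phi>]
  note cu = C1c_grad_continuous[OF u]
  have cg: "continuous_on UNIV (\<lambda>x. g x $ i)"
    using u by (auto simp: C1c_grad_def intro!: continuous_intros)
  define F' where "F' x h = u x * frechet_derivative \<phi> (at x) h + (g x \<bullet> h) * \<phi> x" for x h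
  have F'_axis: "F' x (axis i 1) = u x * partial_deriv i \<phi> x + g x $ i * \<phi> x" for x
    by (simp add: F'_def partial_deriv_def inner_axis)
  have "(\<integral>x. F' x (axis i 1) \<partial>lborel) = 0"
  proof (rule integral_directional_derivative_zero[where F = "\<lambda>x. u x * \<phi> x" and R = R])
    show "((\<lambda>x. u x * \<phi> x) has_derivative F' x) (at x)" for x
      unfolding F'_def using u d[of x]
      by (intro has_derivative_mult) (auto simp: C1c_grad_def frechet_derivative_works)
    show "continuous_on UNIV (\<lambda>x. F' x (axis i 1))"
      unfolding F'_axis by (intro continuous_intros cu cd cg c\<phi>)
  qed (use R in \<open>auto simp: F'_def\<close>)
  moreover have "integrable lborel (\<lambda>x. u x * partial_deriv i \<phi> x)"
    "integrable lborel (\<lambda>x. g x $ i * \<phi> x)"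
    by (rule integrable_continuous_bounded_support[where R = R];
        use R in \<open>auto intro!: continuous_intros cu cd cg c\<phi>\<close>)+
  moreover from this have "(\<integral>x. u x * partial_deriv i \<phi> x \<partial>lebesgue) = (\<integral>x. u x * partial_deriv i \<phi> x \<partial>lborel)"
    "(\<integral>x. g x $ i * \<phi> x \<partial>lebesgue) = (\<integral>x. g x $ i * \<phi> x \<partial>lborel)"
    by (auto intro!: integral_completion)
  ultimately show "distr_partial u i \<phi> = (\<integral>x. (g x $ i) * \<phi> x \<partial>lebesgue)"
    unfolding distr_partial_def F'_axis by (simp add: Bochner_Integration.integral_add)
qed

lemma C1c_grad_L1_loc:
  assumes u: "C1c_grad u g"
  shows "u \<in> L1_loc"
proof -
  have [measurable]: "u \<in> borel_measurable borel"
    using C1c_grad_continuous[OF u] by (rule borel_measurable_continuous_onI)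
  have "set_integrable lebesgue K u" if "compact K" for K
  proof -
    have "integrable lborel (\<lambda>x. indicator K x *\<^sub>R u x)"
      using C1c_grad_continuous[OF u] that
      by (intro borel_integrable_compact) (auto intro: continuous_on_subset)
    moreover have "K \<in> sets borel" using that by (rule borel_compact)
    ultimately show ?thesis
      unfolding set_integrable_def by (subst integrable_completion) auto
  qed
  then show ?thesis
    by (auto simp: L1_loc_def intro: measurable_completion)
qed

text \<open>The same bounds hold for both quasi-norms, so the two spaces can be treated together from here on.\<close>

lemma C1c_grad_norms:
  assumes u: "C1c_grad u g" and fin: "weak_seminorm \<gamma> u < \<infinity>"
  shows "u \<in> W11_gamma \<gamma>" "u \<in> BV_gamma \<gamma>"
    "W11_gamma_norm \<gamma> u \<le> (\<integral>x. norm (g x) \<partial>lborel) + enn2real (weak_seminorm \<gamma> u)"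
    "BV_gamma_norm \<gamma> u \<le> (\<integral>x. norm (g x) \<partial>lborel) + enn2real (weak_seminorm \<gamma> u)"
proof -
  note grad = C1c_grad_is_L1_gradient[OF u] and int = C1c_grad_integrable(2)[OF u]
  show "u \<in> W11_gamma \<gamma>" "u \<in> BV_gamma \<gamma>"
    using grad is_measure_gradient_integral_measure[OF grad int] C1c_grad_L1_loc[OF u] fin
    by (auto simp: W11_gamma_def BV_gamma_def W11_def BV_def)
  have "(\<integral>x. norm (g x) \<partial>lebesgue) = (\<integral>x. norm (g x) \<partial>lborel)"
    using int by (intro integral_completion) auto
  then show "W11_gamma_norm \<gamma> u \<le> (\<integral>x. norm (g x) \<partial>lborel) + enn2real (weak_seminorm \<gamma> u)"
    by (simp add: W11_gamma_norm_def integral_norm_L1_gradient[OF grad])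
  show "BV_gamma_norm \<gamma> u \<le> (\<integral>x. norm (g x) \<partial>lborel) + enn2real (weak_seminorm \<gamma> u)"
    using total_variation_measure_gradient_le[OF grad int] by (simp add: BV_gamma_norm_def)
qed

lemma weak_seminorm_le_norms:
  "enn2real (weak_seminorm \<gamma> u) \<le> W11_gamma_norm \<gamma> u"
  "enn2real (weak_seminorm \<gamma> u) \<le> BV_gamma_norm \<gamma> u"
  by (simp_all add: W11_gamma_norm_def BV_gamma_norm_def)

section \<open>An upper bound for the weak-type seminorm\<close>

text \<open>The integral of \<open>norm h powr (\<gamma> - N)\<close> over the complement of a ball of radius \<open>\<rho>\<close> is at most this
  constant times \<open>\<rho> powr \<gamma>\<close>: the dyadic shells contribute the terms of a geometric series of ratio
  \<open>2 powr \<gamma>\<close>.\<close>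

definition tail_const :: "'n itself \<Rightarrow> real \<Rightarrow> real" where
  "tail_const _ \<gamma> = unit_ball_vol (real CARD('n)) * 2 ^ CARD('n) / (1 - 2 powr \<gamma>)"

lemma tail_const_nonneg: "\<gamma> < 0 \<Longrightarrow> 0 \<le> tail_const TYPE('n) \<gamma>"
  unfolding tail_const_def
  by (intro divide_nonneg_nonneg mult_nonneg_nonneg)
     (auto simp: powr_less_one less_imp_le unit_ball_vol_nonneg)

lemma tail_integral_le:
  assumes \<gamma>: "\<gamma> < 0" and \<rho>: "0 < \<rho>"
  shows "(\<integral>\<^sup>+h. ennreal (norm h powr (\<gamma> - real CARD('n))) * indicator {h. \<rho> \<le> norm h} h
      \<partial>(lborel :: (real^'n) measure)) \<le> ennreal (tail_const TYPE('n) \<gamma> * \<rho> powr \<gamma>)"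
proof -
  let ?N = "CARD('n)"
  define r where "r k = \<rho> * 2 ^ k" for k :: nat
  have r: "0 < r k" for k using \<rho> by (simp add: r_def)
  have shell: "ennreal (norm h powr (\<gamma> - ?N)) * indicator {h. \<rho> \<le> norm h} h
      \<le> (\<Sum>k. ennreal (r k powr (\<gamma> - ?N)) * indicator (ball 0 (r (Suc k))) h)" for h :: "real^'n"
  proof (cases "\<rho> \<le> norm h")
    case True
    obtain n where "norm h / \<rho> < 2 ^ n"
      using real_arch_pow[of 2 "norm h / \<rho>"] by auto
    then have "norm h < r n"
      using \<rho> by (simp add: r_def field_simps)
    define k where "k = (LEAST k. norm h < r (Suc k))"
    have "norm h < r (Suc n)"
      using \<open>norm h < r n\<close> r[of n] by (simp add: r_def)
    then have k: "norm h < r (Suc k)"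
      unfolding k_def by (rule LeastI)
    have k': "r k \<le> norm h"
    proof (cases k)
      case 0
      then show ?thesis using True by (simp add: r_def)
    next
      case (Suc j)
      then show ?thesis
        using not_less_Least[of j "\<lambda>k. norm h < r (Suc k)"] by (simp add: k_def not_less)
    qed
    have "norm h powr (\<gamma> - ?N) \<le> r k powr (\<gamma> - ?N)"
      using \<gamma> r[of k] k' by (intro powr_mono2') auto
    then have "ennreal (norm h powr (\<gamma> - ?N)) * indicator {h. \<rho> \<le> norm h} h
        \<le> ennreal (r k powr (\<gamma> - ?N)) * indicator (ball 0 (r (Suc k))) h"
      using True k by (simp add: ennreal_leI)
    also have "\<dots> \<le> (\<Sum>k. ennreal (r k powr (\<gamma> - ?N)) * indicator (ball 0 (r (Suc k))) h)"
      using sum_le_suminf[OF summableI, of "{k}" "\<lambda>k. ennreal (r k powr (\<gamma> - ?N)) * indicator (ball 0 (r (Suc k))) h"]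
      by (simp only: finite.emptyI finite.insertI sum.insert sum.empty empty_iff not_False_eq_True
          add_0_right zero_le simp_thms)
    finally show ?thesis .
  qed simp
  define f where "f k h = ennreal (r k powr (\<gamma> - ?N)) * indicator (ball 0 (r (Suc k))) h"
    for k and h :: "real^'n"
  have f_meas: "f k \<in> borel_measurable lborel" for k
  proof -
    have [measurable]: "ball 0 (r (Suc k)) \<in> sets (lborel :: (real^'n) measure)" by simp
    show ?thesis unfolding f_def[abs_def] by measurable
  qed
  have f_int: "(\<integral>\<^sup>+h. f k h \<partial>lborel) = ennreal (r k powr (\<gamma> - ?N)) * emeasure lborel (ball (0 :: real^'n) (r (Suc k)))" for k
    unfolding f_def by (rule nn_integral_cmult_indicator) simp
  have "(\<integral>\<^sup>+h. ennreal (norm h powr (\<gamma> - ?N)) * indicator {h. \<rho> \<le> norm h} h \<partial>(lborel :: (real^'n) measure))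
      \<le> (\<integral>\<^sup>+h. (\<Sum>k. f k h) \<partial>lborel)"
    unfolding f_def by (rule nn_integral_mono) (rule shell)
  also have "\<dots> = (\<Sum>k. \<integral>\<^sup>+h. f k h \<partial>lborel)"
    by (rule nn_integral_suminf[OF f_meas])
  also have "\<dots> = (\<Sum>k. ennreal (r k powr (\<gamma> - ?N)) * emeasure lborel (ball (0 :: real^'n) (r (Suc k))))"
    unfolding f_int ..
  also have "\<dots> = (\<Sum>k. ennreal (unit_ball_vol (real ?N) * 2 ^ ?N * \<rho> powr \<gamma> * (2 powr \<gamma>) ^ k))"
  proof (intro suminf_cong)
    fix k
    have "r k powr (\<gamma> - ?N) * (unit_ball_vol (real ?N) * r (Suc k) ^ ?N)
        = unit_ball_vol (real ?N) * 2 ^ ?N * (r k powr (\<gamma> - ?N) * r k ^ ?N)"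
      by (simp add: r_def power_mult_distrib)
    also have "r k powr (\<gamma> - ?N) * r k ^ ?N = r k powr \<gamma>"
      using r[of k] by (simp add: powr_realpow[symmetric] powr_add[symmetric])
    also have "r k powr \<gamma> = \<rho> powr \<gamma> * (2 powr \<gamma>) ^ k"
      using \<rho> by (simp add: r_def powr_mult powr_realpow[symmetric] powr_powr mult.commute)
    finally have "r k powr (\<gamma> - ?N) * (unit_ball_vol (real ?N) * r (Suc k) ^ ?N)
        = unit_ball_vol (real ?N) * 2 ^ ?N * \<rho> powr \<gamma> * (2 powr \<gamma>) ^ k"
      by simp
    then show "ennreal (r k powr (\<gamma> - ?N)) * emeasure lborel (ball (0 :: real^'n) (r (Suc k)))
        = ennreal (unit_ball_vol (real ?N) * 2 ^ ?N * \<rho> powr \<gamma> * (2 powr \<gamma>) ^ k)"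
      using r[of "Suc k"] by (simp add: emeasure_ball ennreal_mult[symmetric] unit_ball_vol_nonneg)
  qed
  also have "\<dots> = ennreal (unit_ball_vol (real ?N) * 2 ^ ?N * \<rho> powr \<gamma> * (1 / (1 - 2 powr \<gamma>)))"
    using \<gamma> by (intro suminf_ennreal_eq sums_mult geometric_sums)
      (auto simp: unit_ball_vol_nonneg powr_less_one)
  also have "\<dots> = ennreal (tail_const TYPE('n) \<gamma> * \<rho> powr \<gamma>)"
    by (simp add: tail_const_def)
  finally show ?thesis .
qed

text \<open>Coordinates in which the weight \<open>norm (x - y) powr (\<gamma> - N)\<close> depends on one variable only.\<close>

lemma nn_integral_pairs:
  fixes f :: "'a::euclidean_space \<times> 'a \<Rightarrow> ennreal"
  assumes [measurable]: "f \<in> borel_measurable borel"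
  shows "(\<integral>\<^sup>+z. f z \<partial>lebesgue) = (\<integral>\<^sup>+h. \<integral>\<^sup>+x. f (x, x + h) \<partial>lborel \<partial>lborel)"
proof -
  have [measurable]: "f \<in> borel_measurable (borel \<Otimes>\<^sub>M borel)"
    by (simp add: borel_prod)
  have "(\<integral>\<^sup>+z. f z \<partial>lebesgue) = (\<integral>\<^sup>+z. f z \<partial>(lborel \<Otimes>\<^sub>M lborel))"
    by (simp add: nn_integral_completion lborel_prod)
  also have "\<dots> = (\<integral>\<^sup>+x. \<integral>\<^sup>+y. f (x, y) \<partial>lborel \<partial>lborel)"
    by (rule lborel.nn_integral_fst[symmetric]) simp
  also have "\<dots> = (\<integral>\<^sup>+x. \<integral>\<^sup>+h. f (x, x + h) \<partial>lborel \<partial>lborel)"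
  proof (rule nn_integral_cong)
    fix x :: 'a
    show "(\<integral>\<^sup>+y. f (x, y) \<partial>lborel) = (\<integral>\<^sup>+h. f (x, x + h) \<partial>lborel)"
      using nn_integral_lborel_translate[of "\<lambda>y. f (x, y)" x] by (simp add: add.commute)
  qed
  also have "\<dots> = (\<integral>\<^sup>+h. \<integral>\<^sup>+x. f (x, x + h) \<partial>lborel \<partial>lborel)"
    by (rule lborel_pair.Fubini') measurable
  finally show ?thesis .
qed

text \<open>Short increments contribute at most the integral of the local Lipschitz bound \<open>G\<close>, because
  \<open>G x * norm h powr (- \<gamma>) > l\<close> bounds \<open>norm h\<close> from below. A long increment that
  belongs to the level set forces \<open>u\<close> to be large at one of its two ends.\<close>

lemma nu_level_set_le:
  fixes u G :: "real^'n \<Rightarrow> real"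
  assumes \<gamma>: "- 1 \<le> \<gamma>" "\<gamma> < 0" and l: "0 < l" and r: "0 < r"
    and [measurable]: "u \<in> borel_measurable borel" "G \<in> borel_measurable borel"
    and G: "\<And>x. 0 \<le> G x"
    and lip: "\<And>x h. norm h \<le> r \<Longrightarrow> \<bar>u (x + h) - u x\<bar> \<le> norm h * G x"
  shows "nu \<gamma> (level_set l \<gamma> u) \<le> ennreal (tail_const TYPE('n) \<gamma> / l) * (\<integral>\<^sup>+x. ennreal (G x) \<partial>lborel)
    + 2 * ennreal (tail_const TYPE('n) \<gamma> * r powr \<gamma>)
      * emeasure lborel {x. l * r powr (1 + \<gamma>) / 2 \<le> \<bar>u x\<bar>}"
proof -
  let ?N = "real CARD('n)"
  let ?K = "tail_const TYPE('n) \<gamma>"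
  define w where "w h = ennreal (norm h powr (\<gamma> - ?N))" for h :: "real^'n"
  have [measurable]: "w \<in> borel_measurable borel"
    unfolding w_def[abs_def] by measurable
  define S where "S = {x. l * r powr (1 + \<gamma>) / 2 \<le> \<bar>u x\<bar>}"
  have [measurable]: "S \<in> sets borel"
    unfolding S_def by measurable
  define T where "T = {h :: real^'n. r \<le> norm h}"
  have [measurable]: "T \<in> sets borel"
    unfolding T_def by measurable
  \<comment> \<open>\<open>P\<close> holds the increments that the local Lipschitz bound does not exclude from the level set;
    the long increments in \<open>T\<close> are handled through the set \<open>S\<close> on which \<open>u\<close> is large.\<close>
  define P :: "((real^'n) \<times> (real^'n)) set"
    where "P = {(x, h). h \<noteq> 0 \<and> l < G x * norm h powr (- \<gamma>)}"
  have P [measurable]: "P \<in> sets (borel \<Otimes>\<^sub>M borel)"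
  proof -
    have "P = {z \<in> space (borel \<Otimes>\<^sub>M borel). snd z \<noteq> 0 \<and> l < G (fst z) * norm (snd z) powr (- \<gamma>)}"
      by (auto simp: P_def space_pair_measure)
    also have "\<dots> \<in> sets (borel \<Otimes>\<^sub>M borel)" by measurable
    finally show ?thesis .
  qed
  have K: "0 \<le> ?K" using \<gamma> by (intro tail_const_nonneg)
  define f where "f z = w (snd z - fst z) * indicator P (fst z, snd z - fst z)
     + (w (snd z - fst z) * indicator T (snd z - fst z) * indicator S (fst z)
      + w (snd z - fst z) * indicator T (snd z - fst z) * indicator S (snd z))" for z
  have f_meas: "f \<in> borel_measurable borel"
    unfolding f_def borel_prod[symmetric] by measurable
  have bound: "w (fst z - snd z) * indicator (level_set l \<gamma> u) z \<le> f z" for z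
  proof (cases "z \<in> level_set l \<gamma> u")
    case True
    obtain x y where z: "z = (x, y)" by (cases z)
    define h where "h = y - x"
    have y: "y = x + h" by (simp add: h_def)
    have h: "h \<noteq> 0" and gt: "l * norm h powr (1 + \<gamma>) < \<bar>u (x + h) - u x\<bar>"
      using True by (auto simp: z y level_set_def field_simps abs_minus_commute norm_minus_commute)
    have sym: "w (x - y) = w h" by (simp add: w_def y)
    have disj: "(x, h) \<in> P \<or> (h \<in> T \<and> (x \<in> S \<or> y \<in> S))"
    proof (cases "norm h \<le> r")
      case True
      have "l * norm h powr (1 + \<gamma>) < norm h * G x"
        using gt lip[OF True, of x] by linarith
      then have "l * norm h powr (1 + \<gamma>) * norm h powr (- 1 - \<gamma>) < norm h * G x * norm h powr (- 1 - \<gamma>)"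
        using h by (intro mult_strict_right_mono) auto
      moreover have "norm h powr (1 + \<gamma>) * norm h powr (- 1 - \<gamma>) = 1"
        using h by (simp add: powr_add[symmetric])
      moreover have "norm h * norm h powr (- 1 - \<gamma>) = norm h powr (- \<gamma>)"
        using h powr_add[of "norm h" 1 "- 1 - \<gamma>"] by simp
      ultimately have "l < G x * norm h powr (- \<gamma>)"
        by (simp add: mult.assoc mult.left_commute mult.commute)
      then show ?thesis using h by (simp add: P_def)
    next
      case False
      have "r powr (1 + \<gamma>) \<le> norm h powr (1 + \<gamma>)"
        using False \<gamma> r by (intro powr_mono2) auto
      then have "l * r powr (1 + \<gamma>) \<le> l * norm h powr (1 + \<gamma>)"
        using l by simp
      then have "l * r powr (1 + \<gamma>) < \<bar>u (x + h)\<bar> + \<bar>u x\<bar>"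
        using gt by linarith
      then have "x \<in> S \<or> y \<in> S"
        by (auto simp: S_def y field_simps)
      then show ?thesis using False by (simp add: T_def)
    qed
    have "f z = w h * indicator P (x, h) + (w h * indicator T h * indicator S x + w h * indicator T h * indicator S y)"
      by (simp add: f_def z h_def)
    moreover have "w h \<le> \<dots>"
      using disj by (auto simp: indicator_def intro: add_increasing add_increasing2)
    ultimately show ?thesis using True by (simp add: z sym)
  qed simp
  have inner: "(\<integral>\<^sup>+h. w h * indicator P (x, h) \<partial>lborel) \<le> ennreal (?K / l) * ennreal (G x)" for x
  proof (cases "G x = 0")
    case True
    then have "indicator P (x, h) = (0 :: ennreal)" for h
      using l by (simp add: P_def indicator_def)
    then show ?thesis by simp
  next
    case False
    then have Gx: "0 < G x" using G[of x] by simp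
    define \<rho> where "\<rho> = (l / G x) powr (- 1 / \<gamma>)"
    have \<rho>: "0 < \<rho>" using l Gx by (simp add: \<rho>_def)
    have "\<rho> \<le> norm h" if "(x, h) \<in> P" for h
    proof -
      have "l / G x \<le> norm h powr (- \<gamma>)"
        using that Gx by (simp add: P_def field_simps)
      then have "\<rho> \<le> (norm h powr (- \<gamma>)) powr (- 1 / \<gamma>)"
        unfolding \<rho>_def using l Gx \<gamma> by (intro powr_mono2) (auto simp: divide_nonpos_neg)
      also have "\<dots> = norm h"
        using \<gamma> that by (simp add: powr_powr P_def)
      finally show ?thesis .
    qed
    then have "(\<integral>\<^sup>+h. w h * indicator P (x, h) \<partial>lborel)
        \<le> (\<integral>\<^sup>+h. w h * indicator {h. \<rho> \<le> norm h} h \<partial>lborel)"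
      by (intro nn_integral_mono mult_left_mono) (auto simp: indicator_def)
    also have "\<dots> \<le> ennreal (?K * \<rho> powr \<gamma>)"
      unfolding w_def by (rule tail_integral_le[OF \<gamma>(2) \<rho>])
    also have "\<rho> powr \<gamma> = (l / G x) powr (- 1)"
      using \<gamma> by (simp add: \<rho>_def powr_powr)
    also have "\<dots> = G x / l"
      using l Gx by (simp add: powr_minus_divide)
    also have "ennreal (?K * (G x / l)) = ennreal (?K / l) * ennreal (G x)"
      using K l G[of x] by (simp add: ennreal_mult[symmetric])
    finally show ?thesis .
  qed
  have tail: "(\<integral>\<^sup>+h. w h * indicator T h \<partial>lborel) \<le> ennreal (?K * r powr \<gamma>)"
    unfolding w_def T_def by (rule tail_integral_le[OF \<gamma>(2) r])
  have S_shift: "(\<integral>\<^sup>+x. indicator S (x + h) \<partial>lborel) = emeasure lborel S" for h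
    using nn_integral_lborel_translate[of "indicator S" h] by simp
  have "nu \<gamma> (level_set l \<gamma> u) \<le> (\<integral>\<^sup>+z. f z \<partial>lebesgue)"
    unfolding nu_def by (intro nn_integral_mono) (use bound in \<open>simp add: w_def\<close>)
  also have "\<dots> = (\<integral>\<^sup>+h. \<integral>\<^sup>+x. w h * indicator P (x, h)
      + (w h * indicator T h * indicator S x + w h * indicator T h * indicator S (x + h)) \<partial>lborel \<partial>lborel)"
    by (subst nn_integral_pairs[OF f_meas]) (simp add: f_def)
  also have "\<dots> = (\<integral>\<^sup>+h. (\<integral>\<^sup>+x. w h * indicator P (x, h) \<partial>lborel)
      + 2 * emeasure lborel S * (w h * indicator T h) \<partial>lborel)"
  proof (rule nn_integral_cong)
    fix h
    define c where "c = w h * indicator T h"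
    have "(\<integral>\<^sup>+x. c * indicator S x \<partial>lborel) = c * emeasure lborel S"
      by (rule nn_integral_cmult_indicator) simp
    moreover have "(\<integral>\<^sup>+x. c * indicator S (x + h) \<partial>lborel) = c * emeasure lborel S"
      by (subst nn_integral_cmult) (simp_all add: S_shift)
    ultimately have "(\<integral>\<^sup>+x. c * indicator S x + c * indicator S (x + h) \<partial>lborel) = 2 * emeasure lborel S * c"
      by (subst nn_integral_add) (simp_all add: mult_2 distrib_right distrib_left mult.commute)
    then show "(\<integral>\<^sup>+x. w h * indicator P (x, h) + (w h * indicator T h * indicator S x
        + w h * indicator T h * indicator S (x + h)) \<partial>lborel)
      = (\<integral>\<^sup>+x. w h * indicator P (x, h) \<partial>lborel) + 2 * emeasure lborel S * (w h * indicator T h)"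
      unfolding c_def by (subst nn_integral_add) simp_all
  qed
  also have "\<dots> = (\<integral>\<^sup>+h. \<integral>\<^sup>+x. w h * indicator P (x, h) \<partial>lborel \<partial>lborel)
      + 2 * emeasure lborel S * (\<integral>\<^sup>+h. w h * indicator T h \<partial>lborel)"
    by (subst nn_integral_add) (simp_all add: nn_integral_cmult)
  also have "(\<integral>\<^sup>+h. \<integral>\<^sup>+x. w h * indicator P (x, h) \<partial>lborel \<partial>lborel)
      = (\<integral>\<^sup>+x. \<integral>\<^sup>+h. w h * indicator P (x, h) \<partial>lborel \<partial>lborel)"
    by (rule lborel_pair.Fubini') measurable
  also have "\<dots> \<le> (\<integral>\<^sup>+x. ennreal (?K / l) * ennreal (G x) \<partial>lborel)"
    by (intro nn_integral_mono inner)
  also have "\<dots> = ennreal (?K / l) * (\<integral>\<^sup>+x. ennreal (G x) \<partial>lborel)"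
    by (simp add: nn_integral_cmult)
  also have "2 * emeasure lborel S * (\<integral>\<^sup>+h. w h * indicator T h \<partial>lborel)
      \<le> 2 * emeasure lborel S * ennreal (?K * r powr \<gamma>)"
    by (intro mult_left_mono tail) simp
  finally show ?thesis
    by (simp add: S_def mult_ac add_mono)
qed

text \<open>Short increments of \<open>u\<close> are bounded by a function \<open>G\<close> of integral at most \<open>a\<close>. For a
  continuously differentiable function, \<open>G\<close> can be taken close to the norm of the gradient.\<close>

definition lipschitz_control ::
    "(real^'n \<Rightarrow> real) \<Rightarrow> real \<Rightarrow> (real^'n \<Rightarrow> real) \<Rightarrow> real \<Rightarrow> bool" where
  "lipschitz_control u r G a \<longleftrightarrow> 0 < r \<and> 0 \<le> a \<and> G \<in> borel_measurable borel \<and> (\<forall>x. 0 \<le> G x) \<and>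
     (\<forall>x h. norm h \<le> r \<longrightarrow> \<bar>u (x + h) - u x\<bar> \<le> norm h * G x) \<and>
     (\<integral>\<^sup>+x. ennreal (G x) \<partial>lborel) \<le> ennreal a"

text \<open>The hypothesis on \<open>b\<close> says that the weak \<open>L\<^sup>1\<close> norm of \<open>u\<close> is at most \<open>b\<close>. The radius \<open>r\<close> may be very
  small, so the bound is useful only for functions with a correspondingly small \<open>b\<close>.\<close>

lemma weak_seminorm_le:
  fixes u G :: "real^'n \<Rightarrow> real"
  assumes \<gamma>: "- 1 \<le> \<gamma>" "\<gamma> < 0" and u: "u \<in> borel_measurable borel" and ctrl: "lipschitz_control u r G a"
    and b: "0 \<le> b" "\<And>t. 0 < t \<Longrightarrow> ennreal t * emeasure lborel {x. t \<le> \<bar>u x\<bar>} \<le> ennreal b"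
  shows "weak_seminorm \<gamma> u \<le> ennreal (tail_const TYPE('n) \<gamma> * (a + 4 * b / r))"
  unfolding weak_seminorm_def
proof (rule SUP_least)
  have r: "0 < r" and G: "G \<in> borel_measurable borel" "\<And>x. 0 \<le> G x"
    and lip: "\<And>x h. norm h \<le> r \<Longrightarrow> \<bar>u (x + h) - u x\<bar> \<le> norm h * G x"
    and a: "0 \<le> a" "(\<integral>\<^sup>+x. ennreal (G x) \<partial>lborel) \<le> ennreal a"
    using ctrl by (auto simp: lipschitz_control_def)
  let ?K = "tail_const TYPE('n) \<gamma>"
  fix l :: real assume "l \<in> {0<..}"
  then have l: "0 < l" by simp
  have K: "0 \<le> ?K" using \<gamma> by (intro tail_const_nonneg)
  define t where "t = l * r powr (1 + \<gamma>) / 2"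
  have t: "0 < t" using l r by (simp add: t_def)
  let ?E = "emeasure lborel {x. t \<le> \<bar>u x\<bar>}"
  have "r powr (1 + \<gamma>) = r * r powr \<gamma>"
    using r by (simp add: powr_add)
  then have lr: "l * (?K * r powr \<gamma>) = (2 * ?K / r) * t"
    using r by (simp add: t_def field_simps)
  have "ennreal l * nu \<gamma> (level_set l \<gamma> u)
      \<le> ennreal l * (ennreal (?K / l) * ennreal a + 2 * ennreal (?K * r powr \<gamma>) * ?E)"
    unfolding t_def
    by (intro mult_left_mono order_trans[OF nu_level_set_le[OF \<gamma> l r u G lip]] add_mono a order_refl) auto
  also have "\<dots> = ennreal (?K * a) + 2 * (ennreal (l * (?K * r powr \<gamma>)) * ?E)"
    using l K a by (simp add: distrib_left ennreal_mult mult_ac) (simp add: ennreal_mult[symmetric] mult.assoc[symmetric])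
  also have "ennreal (l * (?K * r powr \<gamma>)) * ?E = ennreal (2 * ?K / r) * (ennreal t * ?E)"
    unfolding lr using K r t by (subst ennreal_mult) (simp_all only: mult.assoc, auto)
  also have "\<dots> \<le> ennreal (2 * ?K / r) * ennreal b"
    by (intro mult_left_mono b t) simp
  also have "ennreal (?K * a) + 2 * (ennreal (2 * ?K / r) * ennreal b)
      = ennreal (?K * a) + ennreal (2 * (2 * ?K / r * b))"
    using K r b ennreal_mult[of 2 "2 * ?K / r * b"] ennreal_mult[of "2 * ?K / r" b] by simp
  also have "\<dots> = ennreal (?K * a + 2 * (2 * ?K / r * b))"
    using K r a b by (intro ennreal_plus[symmetric]) auto
  also have "?K * a + 2 * (2 * ?K / r * b) = ?K * (a + 4 * b / r)"
    using r by (simp add: field_simps)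
  finally show "ennreal l * nu \<gamma> (level_set l \<gamma> u) \<le> ennreal (?K * (a + 4 * b / r))"
    by (simp add: mult_left_mono)
qed

section \<open>A lower bound for the weak-type seminorm\<close>

text \<open>The measure of a set of increments in the coordinates of \<open>nn_integral_pairs\<close>.\<close>

definition increment_mass :: "real \<Rightarrow> (real^'n) set \<Rightarrow> ennreal" where
  "increment_mass \<gamma> H = (\<integral>\<^sup>+h. ennreal (norm h powr (\<gamma> - real CARD('n))) * indicator H h \<partial>lborel)"

text \<open>The product sets of \<open>A j\<close> and \<open>H j\<close> are disjoint because the \<open>H j\<close> are, so the \<open>m\<close> scales add up. The
  sets \<open>A j\<close> themselves may overlap.\<close>

lemma nu_ge:
  fixes A H :: "nat \<Rightarrow> (real^'n) set"
  assumes A: "\<And>j. A j \<in> sets borel" and H: "\<And>j. H j \<in> sets borel"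
    and disj: "disjoint_family_on H {..<m}"
    and E: "\<And>j x h. j < m \<Longrightarrow> x \<in> A j \<Longrightarrow> h \<in> H j \<Longrightarrow> (x, x + h) \<in> E"
    and c: "\<And>j. j < m \<Longrightarrow> c \<le> emeasure lborel (A j) * increment_mass \<gamma> (H j)"
  shows "of_nat m * c \<le> nu \<gamma> E"
proof -
  note [measurable] = A H
  define w where "w h = ennreal (norm h powr (\<gamma> - real CARD('n)))" for h :: "real^'n"
  have [measurable]: "w \<in> borel_measurable borel"
    unfolding w_def[abs_def] by measurable
  define f where "f z = (\<Sum>j<m. w (snd z - fst z) * indicator (H j) (snd z - fst z) * indicator (A j) (fst z))"
    for z :: "(real^'n) \<times> (real^'n)"
  have f_meas: "f \<in> borel_measurable borel"
    unfolding f_def borel_prod[symmetric] by measurable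
  have le: "f z \<le> w (fst z - snd z) * indicator E z" for z
  proof (cases "\<exists>j<m. snd z - fst z \<in> H j \<and> fst z \<in> A j")
    case True
    then obtain j where j: "j < m" "snd z - fst z \<in> H j" "fst z \<in> A j" by blast
    have "snd z - fst z \<notin> H k" if "k < m" "k \<noteq> j" for k
      using disjoint_family_onD[OF disj, of k j] that j by auto
    then have "f z = (\<Sum>k<m. if k = j then w (snd z - fst z) else 0)"
      unfolding f_def using j by (intro sum.cong) (auto simp: indicator_def)
    also have "\<dots> = w (snd z - fst z)" using j by simp
    also have "\<dots> = w (fst z - snd z)" by (simp add: w_def norm_minus_commute)
    finally show ?thesis using E[OF j(1,3,2)] by simp
  next
    case False
    then have "f z = 0" unfolding f_def by (intro sum.neutral) (auto simp: indicator_def)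
    then show ?thesis by simp
  qed
  have inner: "(\<integral>\<^sup>+x. f (x, x + h) \<partial>lborel) = (\<Sum>j<m. emeasure lborel (A j) * (w h * indicator (H j) h))" for h
  proof -
    have "(\<integral>\<^sup>+x. f (x, x + h) \<partial>lborel)
        = (\<integral>\<^sup>+x. (\<Sum>j<m. (w h * indicator (H j) h) * indicator (A j) x) \<partial>lborel)"
      unfolding f_def by simp
    also have "\<dots> = (\<Sum>j<m. \<integral>\<^sup>+x. (w h * indicator (H j) h) * indicator (A j) x \<partial>lborel)"
      by (rule nn_integral_sum) simp
    also have "\<dots> = (\<Sum>j<m. emeasure lborel (A j) * (w h * indicator (H j) h))"
      by (intro sum.cong refl) (subst nn_integral_cmult_indicator, simp_all add: mult.commute)
    finally show ?thesis .
  qed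
  have "of_nat m * c = (\<Sum>j<m. c)" by simp
  also have "\<dots> \<le> (\<Sum>j<m. emeasure lborel (A j) * (\<integral>\<^sup>+h. w h * indicator (H j) h \<partial>lborel))"
    using c by (intro sum_mono) (simp add: w_def increment_mass_def)
  also have "\<dots> = (\<Sum>j<m. \<integral>\<^sup>+h. emeasure lborel (A j) * (w h * indicator (H j) h) \<partial>lborel)"
    by (intro sum.cong refl nn_integral_cmult[symmetric]) simp
  also have "\<dots> = (\<integral>\<^sup>+h. (\<Sum>j<m. emeasure lborel (A j) * (w h * indicator (H j) h)) \<partial>lborel)"
    by (rule nn_integral_sum[symmetric]) simp
  also have "\<dots> = (\<integral>\<^sup>+z. f z \<partial>lebesgue)"
    unfolding nn_integral_pairs[OF f_meas] inner ..
  also have "\<dots> \<le> nu \<gamma> E"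
    unfolding nu_def by (intro nn_integral_mono) (use le in \<open>simp add: w_def\<close>)
  finally show ?thesis .
qed

section \<open>Cantor functions\<close>

lemma DERIV_max_square: "((\<lambda>t::real. (max 0 t)\<^sup>2) has_real_derivative 2 * max 0 t) (at t)"
proof -
  consider "t > 0" | "t < 0" | "t = 0" by linarith
  then show ?thesis
  proof cases
    case 1
    have "((\<lambda>t. t\<^sup>2) has_real_derivative 2 * max 0 t) (at t)"
      using 1 by (auto intro!: derivative_eq_intros)
    then show ?thesis
      by (rule has_field_derivative_transform_within_open[where S = "{0<..}"]) (use 1 in auto)
  next
    case 2
    have "((\<lambda>t. 0) has_real_derivative 2 * max 0 t) (at t)"
      using 2 by simp
    then show ?thesis
      by (rule has_field_derivative_transform_within_open[where S = "{..<0}"]) (use 2 in auto)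
  next
    case 3
    have "((\<lambda>h::real. ((max 0 (0 + h))\<^sup>2 - (max 0 0)\<^sup>2) / h) \<longlongrightarrow> 0) (at 0)"
    proof (rule Lim_null_comparison)
      show "\<forall>\<^sub>F h in at (0::real). norm (((max 0 (0 + h))\<^sup>2 - (max 0 0)\<^sup>2) / h) \<le> \<bar>h\<bar>"
        by (intro always_eventually allI) (auto simp: max_def power2_eq_square)
      show "((\<lambda>h::real. \<bar>h\<bar>) \<longlongrightarrow> 0) (at 0)"
        by (auto intro!: tendsto_eq_intros)
    qed
    with 3 show ?thesis by (simp add: DERIV_def)
  qed
qed

text \<open>A second difference of the function \<open>(max 0 t)\<^sup>2\<close>: the integral of a hat function on the unit
  interval, hence continuously differentiable and constant outside that interval.\<close>

definition step :: "real \<Rightarrow> real" where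
  "step t = 2 * (max 0 t)\<^sup>2 - 4 * (max 0 (t - 1/2))\<^sup>2 + 2 * (max 0 (t - 1))\<^sup>2"

definition step' :: "real \<Rightarrow> real" where
  "step' t = 4 * max 0 t - 8 * max 0 (t - 1/2) + 4 * max 0 (t - 1)"

lemma step_deriv: "(step has_real_derivative step' t) (at t)"
proof -
  have shift: "((\<lambda>t. (max 0 (t - c))\<^sup>2) has_real_derivative 2 * max 0 (t - c)) (at t)" for c :: real
    using DERIV_shift[of "\<lambda>t. (max 0 t)\<^sup>2" "2 * max 0 (t - c)" t "- c"] DERIV_max_square[of "t - c"]
    by simp
  show ?thesis
    unfolding step_def[abs_def] step'_def
    by (rule DERIV_cong[OF DERIV_add[OF DERIV_diff[OF DERIV_cmult[OF DERIV_max_square]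
            DERIV_cmult[OF shift]] DERIV_cmult[OF shift]]]) simp
qed

lemma step'_nonneg: "0 \<le> step' t"
  by (auto simp: step'_def max_def)

lemma step'_continuous: "continuous_on UNIV step'"
  unfolding step'_def[abs_def] by (intro continuous_intros)

lemma step'_zero: "t \<le> 0 \<or> 1 \<le> t \<Longrightarrow> step' t = 0"
  by (auto simp: step'_def max_def)

lemma step_zero: "t \<le> 0 \<Longrightarrow> step t = 0"
  by (auto simp: step_def max_def)

lemma step_one: "1 \<le> t \<Longrightarrow> step t = 1"
  by (auto simp: step_def max_def power2_eq_square algebra_simps)

lemma step_mono: "s \<le> t \<Longrightarrow> step s \<le> step t"
  by (rule DERIV_nonneg_imp_nondecreasing) (use step_deriv step'_nonneg in blast)+

lemma step_bounds: "0 \<le> step t" "step t \<le> 1"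
  using step_mono[of "min t 0" t] step_mono[of t "max t 1"] by (auto simp: step_zero step_one)

text \<open>The \<open>K\<close> contracted copies of the unit interval are adjacent to each other and leave a gap at both
  ends of it. The Cantor function is constant on the two end gaps, so every increment from the left one
  to the right one is the full rise.\<close>

locale cantor_scheme =
  fixes K :: nat and \<delta> :: real
  assumes K: "1 \<le> K" and \<delta>: "0 < \<delta>" and K\<delta>: "real K * \<delta> < 1"
begin

definition gap :: real where
  "gap = (1 - real K * \<delta>) / 2"

lemma gap: "0 < gap" "gap < 1 / 2" "\<delta> * (1 - gap / 2) < 1 - gap"
proof -
  show "0 < gap" using K\<delta> by (simp add: gap_def)
  have Kd: "\<delta> \<le> real K * \<delta>" using K \<delta> by simp
  then show "gap < 1 / 2" using \<delta> by (simp add: gap_def)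
  have "\<delta> * (1 - gap / 2) \<le> \<delta>"
    using \<delta> \<open>0 < gap\<close> by (simp add: mult_le_cancel_left2)
  also have "\<delta> < 1 - gap" using Kd K\<delta> by (simp add: gap_def field_simps)
  finally show "\<delta> * (1 - gap / 2) < 1 - gap" .
qed

primrec cantor :: "nat \<Rightarrow> real \<Rightarrow> real" where
  "cantor 0 t = step t"
| "cantor (Suc m) t = (\<Sum>k<K. cantor m ((t - (gap + real k * \<delta>)) / \<delta>)) / real K"

primrec cantor' :: "nat \<Rightarrow> real \<Rightarrow> real" where
  "cantor' 0 t = step' t"
| "cantor' (Suc m) t = (\<Sum>k<K. cantor' m ((t - (gap + real k * \<delta>)) / \<delta>) / \<delta>) / real K"

lemma cantor_deriv: "(cantor m has_real_derivative cantor' m t) (at t)"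
proof (induction m arbitrary: t)
  case 0
  have "cantor 0 = step" by (rule ext) simp
  then show ?case using step_deriv[of t] by simp
next
  case (Suc m)
  have "((\<lambda>t. cantor m ((t - c) / \<delta>)) has_real_derivative cantor' m ((t - c) / \<delta>) * (1 / \<delta>)) (at t)" for c
    by (rule DERIV_chain2[OF Suc]) (use \<delta> in \<open>auto intro!: derivative_eq_intros\<close>)
  then have "((\<lambda>t. (\<Sum>k<K. cantor m ((t - (gap + real k * \<delta>)) / \<delta>)) / real K) has_real_derivative
      (\<Sum>k<K. cantor' m ((t - (gap + real k * \<delta>)) / \<delta>) * (1 / \<delta>)) / real K) (at t)"
    using K by (intro DERIV_cdivide DERIV_sum) auto
  then show ?case by simp
qed

lemma cantor'_nonneg: "0 \<le> cantor' m t"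
  using \<delta> by (induction m arbitrary: t) (auto simp: step'_nonneg intro!: divide_nonneg_nonneg sum_nonneg)

lemma cantor'_continuous: "continuous_on UNIV (cantor' m)"
proof (induction m)
  case 0
  have "cantor' 0 = step'" by (rule ext) simp
  then show ?case using step'_continuous by simp
next
  case (Suc m)
  have "continuous_on UNIV (\<lambda>t. cantor' m ((t - (gap + real k * \<delta>)) / \<delta>))" for k
    by (rule continuous_on_compose2[OF Suc]) (use \<delta> in \<open>auto intro!: continuous_intros\<close>)
  then have "continuous_on UNIV (\<lambda>t. (\<Sum>k<K. cantor' m ((t - (gap + real k * \<delta>)) / \<delta>) / \<delta>) / real K)"
    using \<delta> K by (intro continuous_on_divide continuous_on_sum continuous_on_const) auto
  then show ?case by simp
qed

lemma cantor_mono: "s \<le> t \<Longrightarrow> cantor m s \<le> cantor m t"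
  by (rule DERIV_nonneg_imp_nondecreasing) (use cantor_deriv cantor'_nonneg in blast)+

lemma cantor_Suc_zero:
  assumes low: "\<And>t. t \<le> 0 \<Longrightarrow> cantor m t = 0" and t: "t \<le> gap"
  shows "cantor (Suc m) t = 0"
proof -
  have "(t - (gap + real k * \<delta>)) / \<delta> \<le> 0" for k
    using t \<delta> by (intro divide_nonpos_pos) (auto simp: add_increasing2)
  then show ?thesis by (simp add: low)
qed

lemma cantor_Suc_one:
  assumes high: "\<And>t. 1 \<le> t \<Longrightarrow> cantor m t = 1" and t: "1 - gap \<le> t"
  shows "cantor (Suc m) t = 1"
proof -
  have "1 \<le> (t - (gap + real k * \<delta>)) / \<delta>" if "k < K" for k
  proof -
    have "real (Suc k) * \<delta> \<le> real K * \<delta>"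
      using that \<delta> by (intro mult_right_mono) auto
    then have "\<delta> + real k * \<delta> \<le> real K * \<delta>" by (simp add: algebra_simps)
    moreover have "real K * \<delta> = 1 - 2 * gap" by (simp add: gap_def field_simps)
    ultimately show ?thesis using t \<delta> by (simp add: le_divide_eq)
  qed
  then have "cantor (Suc m) t = (\<Sum>k<K. 1) / real K"
    unfolding cantor.simps by (intro arg_cong2[of _ _ _ _ "(/)"] sum.cong refl high) auto
  then show ?thesis using K by simp
qed

lemma cantor_zero: "t \<le> 0 \<Longrightarrow> cantor m t = 0"
proof (induction m arbitrary: t)
  case (Suc m)
  then show ?case using gap by (intro cantor_Suc_zero) auto
qed (simp add: step_zero)

lemma cantor_one: "1 \<le> t \<Longrightarrow> cantor m t = 1"
proof (induction m arbitrary: t)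
  case (Suc m)
  then show ?case using gap by (intro cantor_Suc_one) auto
qed (simp add: step_one)

lemma cantor_bounds: "0 \<le> cantor m t" "cantor m t \<le> 1"
  using cantor_mono[of "min t 0" t m] cantor_mono[of t "max t 1" m]
  by (auto simp: cantor_zero cantor_one)

lemma emeasure_affine_preimage:
  fixes B :: "real set"
  assumes [measurable]: "B \<in> sets borel"
  shows "{t. (t - c) / \<delta> \<in> B} \<in> sets borel"
    "emeasure lborel {t. (t - c) / \<delta> \<in> B} = ennreal \<delta> * emeasure lborel B"
proof -
  show *[measurable]: "{t. (t - c) / \<delta> \<in> B} \<in> sets borel"
    by measurable
  have "emeasure lborel {t. (t - c) / \<delta> \<in> B} = (\<integral>\<^sup>+t. indicator {t. (t - c) / \<delta> \<in> B} t \<partial>lborel)"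
    by simp
  also have "\<dots> = ennreal \<delta> * (\<integral>\<^sup>+t. indicator {t. (t - c) / \<delta> \<in> B} (c + \<delta> * t) \<partial>lborel)"
    using \<delta> by (subst nn_integral_real_affine[where c = \<delta> and t = c]) auto
  also have "(\<lambda>t. indicator {t. (t - c) / \<delta> \<in> B} (c + \<delta> * t)) = (indicator B :: real \<Rightarrow> ennreal)"
    using \<delta> by (auto simp: indicator_def fun_eq_iff)
  finally show "emeasure lborel {t. (t - c) / \<delta> \<in> B} = ennreal \<delta> * emeasure lborel B"
    by simp
qed

text \<open>Meant for the set \<open>B\<close> of the points in the first halves of the left end gaps of all intervals of
  stage \<open>j\<close>.
  From such a point the admitted increments lead into the right end gap of the same interval, so the
  Cantor function rises at least by its increase over the interval, \<open>(1 / K) ^ j\<close>.\<close>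

definition level_points :: "nat \<Rightarrow> nat \<Rightarrow> real set \<Rightarrow> bool" where
  "level_points m j B \<longleftrightarrow> B \<in> sets borel \<and> B \<subseteq> {0..<1} \<and>
     emeasure lborel B = ennreal ((real K * \<delta>) ^ j * (gap / 2)) \<and>
     (\<forall>t\<in>B. \<forall>\<eta>. \<delta> ^ j * (1 - gap) \<le> \<eta> \<and> \<eta> \<le> \<delta> ^ j * (1 - gap / 2) \<longrightarrow>
        t + \<eta> \<le> 1 \<and> (1 / real K) ^ j \<le> cantor m (t + \<eta>) - cantor m t)"

lemma level_points_0: "level_points (Suc m) 0 {0..gap / 2}"
proof -
  have "cantor (Suc m) (t + \<eta>) - cantor (Suc m) t = 1"
    if "0 \<le> t" "t \<le> gap / 2" "1 - gap \<le> \<eta>" for t \<eta>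
  proof -
    have "cantor (Suc m) (t + \<eta>) = 1"
      using that by (intro cantor_Suc_one cantor_one) auto
    moreover have "cantor (Suc m) t = 0"
      using that gap by (intro cantor_Suc_zero cantor_zero) auto
    ultimately show ?thesis by simp
  qed
  then show ?thesis
    using gap by (auto simp: level_points_def)
qed

text \<open>The points of stage \<open>j + 1\<close> are the contracted copies of those of stage \<open>j\<close>. The copy that contains
  the point provides the increase; monotonicity makes the increments of the other copies nonnegative.\<close>

lemma level_points_Suc:
  assumes B: "level_points m j B"
  shows "level_points (Suc m) (Suc j) (\<Union>k<K. {t. (t - (gap + real k * \<delta>)) / \<delta> \<in> B})"
    (is "level_points _ _ (\<Union>k<K. ?V k)")
proof -
  have Bm: "B \<in> sets borel" and B01: "B \<subseteq> {0..<1}"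
    and Be: "emeasure lborel B = ennreal ((real K * \<delta>) ^ j * (gap / 2))"
    using B by (auto simp: level_points_def)
  have range: "gap + real k * \<delta> \<le> t" "t < gap + real (Suc k) * \<delta>" if "t \<in> ?V k" for t k
  proof -
    have "(t - (gap + real k * \<delta>)) / \<delta> \<in> {0..<1}" using that B01 by auto
    then show "gap + real k * \<delta> \<le> t" "t < gap + real (Suc k) * \<delta>"
      using \<delta> by (auto simp: field_simps)
  qed
  have top: "gap + real (Suc k) * \<delta> \<le> 1 - gap" if "k < K" for k
  proof -
    have "real (Suc k) * \<delta> \<le> real K * \<delta>"
      using that \<delta> by (intro mult_right_mono) auto
    then show ?thesis by (simp add: gap_def field_simps)
  qed
  have disj: "disjoint_family_on ?V {..<K}"
  proof -
    have "?V k \<inter> ?V l = {}" if "k < l" for k l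
    proof -
      have "real (Suc k) * \<delta> \<le> real l * \<delta>"
        using that \<delta> by (intro mult_right_mono) auto
      then have "\<not> (t \<in> ?V k \<and> t \<in> ?V l)" for t
        using range[of t k] range[of t l] by linarith
      then show ?thesis by blast
    qed
    then have "?V k \<inter> ?V l = {}" if "k \<noteq> l" for k l
      using that by (metis Int_commute linorder_neqE_nat)
    then show ?thesis by (simp add: disjoint_family_on_def)
  qed
  note V = emeasure_affine_preimage[OF Bm]
  have "emeasure lborel (\<Union>k<K. ?V k) = (\<Sum>k<K. emeasure lborel (?V k))"
    using V(1) disj by (intro sum_emeasure[symmetric]) auto
  also have "\<dots> = of_nat K * (ennreal \<delta> * emeasure lborel B)"
    by (simp add: V(2))
  also have "\<dots> = ennreal ((real K * \<delta>) ^ Suc j * (gap / 2))"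
    using \<delta> gap by (simp add: Be ennreal_of_nat_eq_real_of_nat ennreal_mult[symmetric] mult_ac)
  finally have em: "emeasure lborel (\<Union>k<K. ?V k) = ennreal ((real K * \<delta>) ^ Suc j * (gap / 2))" .
  have sub: "(\<Union>k<K. ?V k) \<subseteq> {0..<1}"
  proof
    fix t assume "t \<in> (\<Union>k<K. ?V k)"
    then obtain k where k: "k < K" "t \<in> ?V k" by blast
    have "0 \<le> gap + real k * \<delta>" using gap \<delta> by simp
    then show "t \<in> {0..<1}" using range[OF k(2)] top[OF k(1)] gap by simp
  qed
  have jump: "t + \<eta> \<le> 1 \<and> (1 / real K) ^ Suc j \<le> cantor (Suc m) (t + \<eta>) - cantor (Suc m) t"
    if t: "t \<in> (\<Union>k<K. ?V k)" and \<eta>: "\<delta> ^ Suc j * (1 - gap) \<le> \<eta>" "\<eta> \<le> \<delta> ^ Suc j * (1 - gap / 2)" for t \<eta>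
  proof -
    obtain k where k: "k < K" "t \<in> ?V k" using t by blast
    define g where "g l = cantor m ((t + \<eta> - (gap + real l * \<delta>)) / \<delta>) - cantor m ((t - (gap + real l * \<delta>)) / \<delta>)" for l
    have "0 \<le> \<delta> ^ Suc j * (1 - gap)" using \<delta> gap by simp
    then have "0 \<le> \<eta>" using \<eta> by linarith
    then have g0: "0 \<le> g l" for l
      unfolding g_def using \<delta> by (simp add: cantor_mono divide_right_mono)
    have "\<delta> ^ j * (1 - gap) \<le> \<eta> / \<delta>" "\<eta> / \<delta> \<le> \<delta> ^ j * (1 - gap / 2)"
      using \<eta> \<delta> by (auto simp: field_simps)
    then have "(t - (gap + real k * \<delta>)) / \<delta> + \<eta> / \<delta> \<le> 1 \<and>
        (1 / real K) ^ j \<le> cantor m ((t - (gap + real k * \<delta>)) / \<delta> + \<eta> / \<delta>) - cantor m ((t - (gap + real k * \<delta>)) / \<delta>)"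
      using B k(2) unfolding level_points_def by auto
    moreover have eq: "(t - (gap + real k * \<delta>)) / \<delta> + \<eta> / \<delta> = (t + \<eta> - (gap + real k * \<delta>)) / \<delta>"
      by (simp add: add_divide_distrib diff_divide_distrib)
    ultimately have le1: "(t + \<eta> - (gap + real k * \<delta>)) / \<delta> \<le> 1" and gk: "(1 / real K) ^ j \<le> g k"
      by (simp_all add: g_def)
    from le1 have "t + \<eta> \<le> gap + real (Suc k) * \<delta>"
      using \<delta> by (simp add: field_simps)
    then have "t + \<eta> \<le> 1" using top[OF k(1)] gap by linarith
    moreover have "(1 / real K) ^ Suc j = (1 / real K) ^ j / real K" by simp
    moreover have "(1 / real K) ^ j / real K \<le> (\<Sum>l<K. g l) / real K"
      using gk member_le_sum[of k "{..<K}" g] g0 k(1) by (intro divide_right_mono) auto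
    moreover have "(\<Sum>l<K. g l) / real K = cantor (Suc m) (t + \<eta>) - cantor (Suc m) t"
      by (simp add: g_def sum_subtractf diff_divide_distrib)
    ultimately show ?thesis by simp
  qed
  show ?thesis
    unfolding level_points_def
    using em sub jump V(1) by (intro conjI ballI allI impI) (auto simp del: cantor.simps)
qed

lemma ex_level_points: "j < m \<Longrightarrow> \<exists>B. level_points m j B"
proof (induction m arbitrary: j)
  case (Suc m)
  then show ?case
    using level_points_0 level_points_Suc by (cases j) blast+
qed simp

end

section \<open>Cantor functions cut off to a cube\<close>

lemma nn_integral_lborel_coords:
  fixes f :: "'n::finite \<Rightarrow> real \<Rightarrow> ennreal"
  assumes f: "\<And>k. f k \<in> borel_measurable borel"
  shows "(\<integral>\<^sup>+x. (\<Prod>k\<in>UNIV. f k (x $ k)) \<partial>(lborel :: (real^'n) measure)) = (\<Prod>k\<in>UNIV. \<integral>\<^sup>+t. f k t \<partial>lborel)"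
proof -
  define g where "g b = f (THE k. b = axis k 1)" for b :: "real^'n"
  have g: "g (axis k 1) = f k" for k
    by (simp add: g_def axis_eq_axis)
  have inj: "inj_on (\<lambda>k. axis k 1 :: real^'n) UNIV"
    by (auto simp: inj_on_def axis_eq_axis)
  have Basis: "(Basis :: (real^'n) set) = (\<lambda>k. axis k 1) ` UNIV"
    by (auto simp: Basis_vec_def)
  have "(\<integral>\<^sup>+x. (\<Prod>b\<in>Basis. g b (x \<bullet> b)) \<partial>(lborel :: (real^'n) measure)) = (\<Prod>b\<in>Basis. \<integral>\<^sup>+t. g b t \<partial>lborel)"
    by (rule nn_integral_lborel_prod) (auto simp: g_def f)
  then show ?thesis
    by (simp add: Basis prod.reindex[OF inj] g inner_axis)
qed

lemma emeasure_coordinate_box: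
  fixes i :: "'n::finite"
  assumes B [measurable]: "B \<in> sets borel" and c: "0 \<le> c"
  shows "{x :: real^'n. x $ i \<in> B \<and> (\<forall>k. k \<noteq> i \<longrightarrow> x $ k \<in> {0..c})} \<in> sets borel" (is "?S \<in> _")
    "emeasure lborel {x :: real^'n. x $ i \<in> B \<and> (\<forall>k. k \<noteq> i \<longrightarrow> x $ k \<in> {0..c})}
      = emeasure lborel B * ennreal (c ^ (CARD('n) - 1))"
proof -
  define f where "f k = (indicator (if k = i then B else {0..c}) :: real \<Rightarrow> ennreal)" for k
  have f [measurable]: "f k \<in> borel_measurable borel" for k
    by (simp add: f_def)
  have S_eq: "?S = (\<Inter>k\<in>UNIV. {x. x $ k \<in> (if k = i then B else {0..c})})" (is "_ = ?T")
  proof (intro equalityI subsetI)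
    fix x assume "x \<in> ?T"
    then have a: "x $ k \<in> (if k = i then B else {0..c})" for k by blast
    have "x $ k \<in> {0..c}" if "k \<noteq> i" for k using a[of k] that by simp
    then show "x \<in> ?S" using a[of i] by simp
  qed simp
  have ind: "indicator ?S x = (\<Prod>k\<in>UNIV. f k (x $ k))" for x
  proof (cases "x \<in> ?S")
    case False
    then obtain k where "x $ k \<notin> (if k = i then B else {0..c})" unfolding S_eq by blast
    then show ?thesis using False by (subst prod_zero) (auto simp: f_def intro!: bexI[of _ k])
  qed (auto simp: f_def intro!: prod.neutral[symmetric])
  have meas: "{x :: real^'n. x $ k \<in> (if k = i then B else {0..c})} \<in> sets borel" for k
  proof -
    have [measurable]: "(\<lambda>x :: real^'n. x $ k) \<in> borel_measurable borel"
      by (intro borel_measurable_continuous_onI continuous_intros)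
    have [measurable]: "(if k = i then B else {0..c}) \<in> sets borel" by simp
    show ?thesis by measurable
  qed
  show S [measurable]: "?S \<in> sets borel"
    unfolding S_eq by (intro sets.finite_INT meas) auto
  have "emeasure lborel ?S = (\<integral>\<^sup>+x. (\<Prod>k\<in>UNIV. f k (x $ k)) \<partial>lborel)"
    unfolding ind[symmetric] by simp
  also have "\<dots> = (\<Prod>k\<in>UNIV. \<integral>\<^sup>+t. f k t \<partial>lborel)"
    by (rule nn_integral_lborel_coords[OF f])
  also have "\<dots> = (\<integral>\<^sup>+t. f i t \<partial>lborel) * (\<Prod>k\<in>UNIV - {i}. \<integral>\<^sup>+t. f k t \<partial>lborel)"
    by (rule prod.remove) auto
  also have "(\<Prod>k\<in>UNIV - {i}. \<integral>\<^sup>+t. f k t \<partial>lborel) = (\<Prod>k\<in>UNIV - {i}. ennreal c)"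
    using c by (intro prod.cong) (auto simp: f_def)
  also have "\<dots> = ennreal (c ^ (CARD('n) - 1))"
    using c by (simp add: ennreal_power)
  finally show "emeasure lborel ?S = emeasure lborel B * ennreal (c ^ (CARD('n) - 1))"
    by (simp add: f_def)
qed

text \<open>Equal to one on the unit interval and supported in \<open>{-1..2}\<close>.\<close>

definition cutoff :: "real \<Rightarrow> real" where
  "cutoff t = step (t + 1) - step (t - 1)"

definition cutoff' :: "real \<Rightarrow> real" where
  "cutoff' t = step' (t + 1) - step' (t - 1)"

lemma cutoff_deriv: "(cutoff has_real_derivative cutoff' t) (at t)"
proof -
  have "((\<lambda>t. step (t + c)) has_real_derivative step' (t + c)) (at t)" for c
    using step_deriv[of "t + c"] by (simp add: DERIV_shift)
  from DERIV_diff[OF this[of 1] this[of "- 1"]] show ?thesis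
    by (simp add: cutoff_def[abs_def] cutoff'_def)
qed

lemma cutoff_bounds: "0 \<le> cutoff t" "cutoff t \<le> 1"
  using step_mono[of "t - 1" "t + 1"] step_bounds[of "t + 1"] step_bounds[of "t - 1"]
  by (auto simp: cutoff_def)

lemma cutoff_one: "0 \<le> t \<Longrightarrow> t \<le> 1 \<Longrightarrow> cutoff t = 1"
  by (simp add: cutoff_def step_one step_zero)

lemma cutoff_zero: "t \<notin> {-1..2} \<Longrightarrow> cutoff t = 0" "t \<notin> {-1..2} \<Longrightarrow> cutoff' t = 0"
  by (auto simp: cutoff_def cutoff'_def step_one step_zero step'_zero not_le)

lemma cutoff'_continuous: "continuous_on UNIV cutoff'"
  unfolding cutoff'_def[abs_def]
  by (intro continuous_intros continuous_on_compose2[OF step'_continuous]) auto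

lemma cutoff_continuous: "continuous_on UNIV cutoff"
  using DERIV_isCont[OF cutoff_deriv] by (simp add: continuous_on_eq_continuous_at)

definition cube :: "(real^'n) set" where
  "cube = {x. \<forall>k. x $ k \<in> {-1..2}}"

definition cube_bump :: "real^'n \<Rightarrow> real" where
  "cube_bump x = (\<Prod>k\<in>UNIV. cutoff (x $ k))"

definition cube_bump_grad :: "real^'n \<Rightarrow> real^'n" where
  "cube_bump_grad x = (\<chi> k. cutoff' (x $ k) * (\<Prod>j\<in>UNIV - {k}. cutoff (x $ j)))"

lemma cube_eq_cbox: "cube = cbox (\<chi> k. - 1) (\<chi> k. 2)"
  by (auto simp: cube_def mem_box_cart)

lemma cube_borel [measurable]: "cube \<in> sets borel"
  by (simp add: cube_eq_cbox)

lemma cube_bump_bounds: "0 \<le> cube_bump x" "cube_bump x \<le> 1"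
  unfolding cube_bump_def by (auto intro!: prod_nonneg prod_le_1 cutoff_bounds)

lemma cube_bump_one: "(\<And>k. 0 \<le> x $ k \<and> x $ k \<le> 1) \<Longrightarrow> cube_bump x = 1"
  by (simp add: cube_bump_def cutoff_one)

lemma cube_bump_zero: "x \<notin> cube \<Longrightarrow> cube_bump x = 0"
  unfolding cube_def cube_bump_def using cutoff_zero by (auto intro: prod_zero)

lemma cube_bump_grad_zero: "x \<notin> cube \<Longrightarrow> cube_bump_grad x = 0"
proof -
  assume "x \<notin> cube"
  then obtain l where l: "x $ l \<notin> {-1..2}" by (auto simp: cube_def)
  have "cutoff' (x $ k) * (\<Prod>j\<in>UNIV - {k}. cutoff (x $ j)) = 0" for k
  proof (cases "k = l")
    case False
    then have "(\<Prod>j\<in>UNIV - {k}. cutoff (x $ j)) = 0"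
      using cutoff_zero(1)[OF l] by (intro prod_zero) auto
    then show ?thesis by simp
  qed (simp add: cutoff_zero(2)[OF l])
  then show ?thesis by (simp add: cube_bump_grad_def vec_eq_iff)
qed

lemma coord_compose_derivative:
  fixes i :: "'n::finite"
  assumes "(f has_real_derivative f') (at (x $ i))"
  shows "((\<lambda>x::real^'n. f (x $ i)) has_derivative (\<lambda>h. f' * h $ i)) (at x)"
proof -
  have "((\<lambda>x::real^'n. x $ i) has_derivative (\<lambda>h. h $ i)) (at x)"
    by (rule bounded_linear_imp_has_derivative[OF bounded_linear_vec_nth])
  from has_derivative_compose[OF this has_field_derivative_imp_has_derivative[OF assms]]
  show ?thesis .
qed

lemma cube_bump_derivative: "(cube_bump has_derivative (\<lambda>h. cube_bump_grad x \<bullet> h)) (at x)"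
proof -
  have "((\<lambda>x. \<Prod>k\<in>UNIV. cutoff (x $ k)) has_derivative
      (\<lambda>h. \<Sum>k\<in>UNIV. cutoff' (x $ k) * h $ k * (\<Prod>j\<in>UNIV - {k}. cutoff (x $ j)))) (at x)"
    by (intro has_derivative_prod coord_compose_derivative cutoff_deriv)
  then show ?thesis
    by (simp add: cube_bump_def[abs_def] cube_bump_grad_def inner_vec_def mult_ac)
qed

lemma cube_bump_grad_continuous: "continuous_on UNIV (cube_bump_grad :: real^'n \<Rightarrow> real^'n)"
proof -
  have "continuous_on UNIV (\<lambda>x::real^'n. cutoff' (x $ k))" "continuous_on UNIV (\<lambda>x::real^'n. cutoff (x $ k))" for k :: 'n
    by (rule continuous_on_compose2[OF cutoff'_continuous] continuous_on_compose2[OF cutoff_continuous];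
        auto intro!: continuous_intros)+
  then show ?thesis
    unfolding cube_bump_grad_def[abs_def]
    by (intro continuous_on_vec_lambda continuous_on_mult continuous_on_prod)
qed

lemma cube_bounded: "bounded (cube :: (real^'n) set)"
  by (simp add: cube_eq_cbox bounded_cbox)

lemma emeasure_cube: "emeasure lborel (cube :: (real^'n) set) = ennreal (measure lborel (cube :: (real^'n) set))"
  using emeasure_lborel_cbox_finite[of "\<chi> k. - 1" "\<chi> k. 2"] unfolding cube_eq_cbox
  by (intro emeasure_eq_ennreal_measure) (auto simp: less_top)

context cantor_scheme
begin

definition block :: "'n::finite \<Rightarrow> nat \<Rightarrow> real^'n \<Rightarrow> real" where
  "block i m x = cantor m (x $ i) * cube_bump x"

definition block_grad :: "'n::finite \<Rightarrow> nat \<Rightarrow> real^'n \<Rightarrow> real^'n" where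
  "block_grad i m x = cantor m (x $ i) *\<^sub>R cube_bump_grad x + (cantor' m (x $ i) * cube_bump x) *\<^sub>R axis i 1"

lemma block_zero: "x \<notin> cube \<Longrightarrow> block i m x = 0"
  by (simp add: block_def cube_bump_zero)

lemma block_bounds: "0 \<le> block i m x" "block i m x \<le> 1"
  unfolding block_def
  by (auto intro!: mult_nonneg_nonneg mult_le_one cantor_bounds cube_bump_bounds)

lemma C1c_grad_block: "C1c_grad (block i m) (block_grad i m)"
  unfolding C1c_grad_def
proof (intro conjI allI)
  have cont: "continuous_on UNIV (\<lambda>x::real^'a. cantor m (x $ i))"
  proof (rule continuous_on_compose2[of UNIV "cantor m"])
    show "continuous_on UNIV (cantor m)"
      using DERIV_isCont[OF cantor_deriv] by (simp add: continuous_on_eq_continuous_at)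
  qed (auto intro!: continuous_intros)
  have cont': "continuous_on UNIV (\<lambda>x::real^'a. cantor' m (x $ i))"
    by (rule continuous_on_compose2[OF cantor'_continuous]) (auto intro!: continuous_intros)
  have contb: "continuous_on UNIV (cube_bump :: real^'a \<Rightarrow> real)"
    by (rule has_derivative_imp_continuous_on_UNIV[OF cube_bump_derivative])
  show "continuous_on UNIV (block_grad i m)"
    unfolding block_grad_def[abs_def]
    by (intro continuous_intros cont cont' contb cube_bump_grad_continuous)
  have "{x. block i m x \<noteq> 0} \<subseteq> cube"
    using block_zero by blast
  then show "bounded {x. block i m x \<noteq> 0}"
    by (rule bounded_subset[OF cube_bounded])
  fix x :: "real^'a"
  have "((\<lambda>x. cantor m (x $ i) * cube_bump x) has_derivative
      (\<lambda>h. cantor m (x $ i) * (cube_bump_grad x \<bullet> h) + cantor' m (x $ i) * h $ i * cube_bump x)) (at x)"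
    by (intro has_derivative_mult coord_compose_derivative cantor_deriv cube_bump_derivative)
  moreover have "block_grad i m x \<bullet> h
      = cantor m (x $ i) * (cube_bump_grad x \<bullet> h) + cantor' m (x $ i) * h $ i * cube_bump x" for h
    by (simp add: block_grad_def inner_add_left inner_axis' mult_ac)
  ultimately show "(block i m has_derivative (\<lambda>h. block_grad i m x \<bullet> h)) (at x)"
    by (simp add: block_def[abs_def])
qed

lemma cantor'_integral: "(\<integral>\<^sup>+t. ennreal (cantor' m t) * indicator {-1..2} t \<partial>lborel) = 1"
proof -
  have [measurable]: "cantor' m \<in> borel_measurable borel"
    using cantor'_continuous by (rule borel_measurable_continuous_onI)
  have "(\<integral>\<^sup>+t. ennreal (cantor' m t) * indicator {-1..2} t \<partial>lborel) = ennreal (cantor m 2 - cantor m (-1))"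
    by (rule nn_integral_FTC_Icc) (auto intro: cantor_deriv cantor'_nonneg has_field_derivative_at_within)
  then show ?thesis by (simp add: cantor_one cantor_zero)
qed

text \<open>The bound is uniform in \<open>m\<close>: whatever its shape, the derivative of a Cantor function has integral
  one along each line in direction \<open>i\<close>, and the cutoff leaves lines of bounded total mass.\<close>

lemma block_grad_integral_bound:
  obtains C where "0 \<le> C" "\<And>m. (\<integral>x. norm (block_grad (i :: 'n::finite) m x) \<partial>lborel) \<le> C"
proof -
  let ?V = "measure lborel (cube :: (real^'n) set)"
  obtain R where R: "\<And>x :: real^'n. x \<in> cube \<Longrightarrow> norm x \<le> R"
    using cube_bounded unfolding bounded_iff by blast
  have "cube_bump_grad x = 0" if "R < norm x" for x :: "real^'n"
    using R[of x] that by (intro cube_bump_grad_zero) auto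
  then obtain B where B: "0 \<le> B" "\<And>x :: real^'n. norm (cube_bump_grad x) \<le> B"
    using continuous_bounded_support_bounded[OF cube_bump_grad_continuous] by metis
  have "(\<integral>x. norm (block_grad i m x) \<partial>lborel) \<le> B * ?V + 3 ^ CARD('n)" for m
  proof -
    have int: "integrable lborel (block_grad i m)"
      by (rule C1c_grad_integrable(2)[OF C1c_grad_block])
    have [measurable]: "cantor' m \<in> borel_measurable borel"
      using cantor'_continuous by (rule borel_measurable_continuous_onI)
    have [measurable]: "(\<lambda>x::real^'n. x $ k) \<in> borel_measurable borel" for k
      by (intro borel_measurable_continuous_onI continuous_intros)
    have bound: "norm (block_grad i m x) \<le> B * indicator cube x + cantor' m (x $ i) * indicator cube x" for x
    proof (cases "x \<in> cube")
      case True
      have "norm (block_grad i m x) \<le> \<bar>cantor m (x $ i)\<bar> * norm (cube_bump_grad x) + \<bar>cantor' m (x $ i) * cube_bump x\<bar>"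
        unfolding block_grad_def by (rule order_trans[OF norm_triangle_ineq]) (simp add: norm_axis_1)
      also have "\<dots> \<le> 1 * B + cantor' m (x $ i) * 1"
        using cantor_bounds[of m "x $ i"] cantor'_nonneg[of m "x $ i"] cube_bump_bounds[of x] B(2)[of x]
        by (intro add_mono mult_mono) (auto simp: abs_mult intro: mult_left_le)
      finally show ?thesis using True by simp
    qed (simp add: block_grad_def cube_bump_zero cube_bump_grad_zero)
    have le3: "(\<integral>\<^sup>+x. (\<Prod>k\<in>UNIV. f k (x $ k)) \<partial>(lborel :: (real^'n) measure)) \<le> ennreal (3 ^ CARD('n))"
      if f: "\<And>k. f k \<in> borel_measurable borel" "\<And>k. (\<integral>\<^sup>+t. f k t \<partial>lborel) \<le> 3" for f :: "'n \<Rightarrow> real \<Rightarrow> ennreal"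
    proof -
      have "(\<Prod>k\<in>S. \<integral>\<^sup>+t. f k t \<partial>lborel) \<le> 3 ^ card S" if "finite S" for S :: "'n set"
        using that by (induction S rule: finite_induct) (auto intro!: mult_mono f(2))
      from this[of UNIV] have "(\<Prod>k\<in>(UNIV :: 'n set). \<integral>\<^sup>+t. f k t \<partial>lborel) \<le> 3 ^ CARD('n)"
        by simp
      also have "(3 :: ennreal) ^ CARD('n) = ennreal (3 ^ CARD('n))"
        by (simp add: ennreal_power[symmetric])
      finally show ?thesis
        unfolding nn_integral_lborel_coords[OF f(1)] .
    qed
    have ind: "indicator cube x = (\<Prod>k\<in>UNIV. indicator {-1..2} (x $ k) :: ennreal)" for x :: "real^'n"
    proof (cases "x \<in> cube")
      case False
      then obtain k where "x $ k \<notin> {-1..2}" by (auto simp: cube_def)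
      then have "(\<Prod>k\<in>UNIV. indicator {-1..2} (x $ k) :: ennreal) = 0"
        by (intro prod_zero bexI[of _ k]) auto
      then show ?thesis using False by simp
    next
      case True
      then show ?thesis by (simp add: cube_def)
    qed
    define f where "f k t = (if k = i then ennreal (cantor' m t) * indicator {-1..2} t else indicator {-1..2} t)"
      for k t
    have f: "f k \<in> borel_measurable borel" for k
      by (cases "k = i") (auto simp: f_def[abs_def])
    have "ennreal (cantor' m (x $ i)) * indicator cube x = (\<Prod>k\<in>UNIV. f k (x $ k))" for x :: "real^'n"
    proof -
      have "(\<Prod>k\<in>UNIV. f k (x $ k)) = f i (x $ i) * (\<Prod>k\<in>UNIV - {i}. f k (x $ k))"
        by (rule prod.remove) auto
      also have "(\<Prod>k\<in>UNIV - {i}. f k (x $ k)) = (\<Prod>k\<in>UNIV - {i}. indicator {-1..2} (x $ k))"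
        by (intro prod.cong) (auto simp: f_def)
      also have "f i (x $ i) = ennreal (cantor' m (x $ i)) * indicator {-1..2} (x $ i)"
        by (simp add: f_def)
      finally have "(\<Prod>k\<in>UNIV. f k (x $ k)) = ennreal (cantor' m (x $ i)) * indicator {-1..2} (x $ i)
          * (\<Prod>k\<in>UNIV - {i}. indicator {-1..2} (x $ k))" .
      moreover have "indicator cube x = indicator {-1..2} (x $ i) * (\<Prod>k\<in>UNIV - {i}. indicator {-1..2} (x $ k) :: ennreal)"
        unfolding ind by (rule prod.remove) auto
      ultimately show ?thesis by (simp add: mult.assoc)
    qed
    note * = this
    have I2: "(\<integral>\<^sup>+x. ennreal (cantor' m (x $ i)) * indicator (cube :: (real^'n) set) x \<partial>lborel) \<le> ennreal (3 ^ CARD('n))"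
    proof -
      have "(\<integral>\<^sup>+t. f k t \<partial>lborel) \<le> 3" for k
      proof (cases "k = i")
        case True
        then have "(\<integral>\<^sup>+t. f k t \<partial>lborel) = 1"
          using cantor'_integral[of m] by (simp add: f_def)
        then show ?thesis by simp
      next
        case False
        then have "(\<integral>\<^sup>+t. f k t \<partial>lborel) = emeasure lborel {-1..2::real}"
          unfolding f_def by simp
        then show ?thesis by simp
      qed
      with le3[OF f] *  show ?thesis by simp
    qed
    have "ennreal (\<integral>x. norm (block_grad i m x) \<partial>lborel) = (\<integral>\<^sup>+x. ennreal (norm (block_grad i m x)) \<partial>lborel)"
      using int by (intro nn_integral_eq_integral[symmetric]) auto
    also have "\<dots> \<le> (\<integral>\<^sup>+x. ennreal B * indicator cube x + ennreal (cantor' m (x $ i)) * indicator cube x \<partial>lborel)"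
    proof (intro nn_integral_mono)
      fix x :: "real^'n"
      have "ennreal (norm (block_grad i m x)) \<le> ennreal (B * indicator cube x + cantor' m (x $ i) * indicator cube x)"
        by (intro ennreal_leI bound)
      also have "\<dots> = ennreal B * indicator cube x + ennreal (cantor' m (x $ i)) * indicator cube x"
        using B cantor'_nonneg by (auto simp: indicator_def)
      finally show "ennreal (norm (block_grad i m x)) \<le> ennreal B * indicator cube x + ennreal (cantor' m (x $ i)) * indicator cube x" .
    qed
    also have "\<dots> = ennreal B * (\<integral>\<^sup>+x. indicator (cube :: (real^'n) set) x \<partial>lborel)
        + (\<integral>\<^sup>+x. ennreal (cantor' m (x $ i)) * indicator (cube :: (real^'n) set) x \<partial>lborel)"
      by (subst nn_integral_add, simp, simp, subst nn_integral_cmult, simp, simp)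
    also have "\<dots> \<le> ennreal B * ennreal ?V + ennreal (3 ^ CARD('n))"
      using I2 by (intro add_mono) (simp_all add: emeasure_cube)
    also have "\<dots> = ennreal (B * ?V + 3 ^ CARD('n))"
      using B by (simp add: ennreal_mult)
    finally show ?thesis
      using B by (simp add: ennreal_le_iff del: ennreal_plus)
  qed
  then show ?thesis
    using that[of "B * ?V + 3 ^ CARD('n)"] B by simp
qed

text \<open>Coordinate \<open>i\<close> ranges over the increments that cross an interval of stage \<open>j\<close>; these ranges are
  disjoint for different \<open>j\<close>. The other coordinates are of the same order, so that the whole set has
  volume comparable to \<open>(\<delta> ^ j) ^ N\<close> and the norm of its elements is comparable to \<open>\<delta> ^ j\<close>.\<close>

definition increments :: "'n::finite \<Rightarrow> nat \<Rightarrow> (real^'n) set" where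
  "increments i j = {h. h $ i \<in> {\<delta> ^ j * (1 - gap)..\<delta> ^ j * (1 - gap / 2)} \<and>
     (\<forall>k. k \<noteq> i \<longrightarrow> h $ k \<in> {0..\<delta> ^ j / 2})}"

lemma increments_borel: "increments i j \<in> sets borel"
  unfolding increments_def using \<delta> by (intro emeasure_coordinate_box(1)) auto

lemma increments_disjoint: "disjoint_family_on (increments i) S"
proof -
  have "increments i j \<inter> increments i k = {}" if "j < k" for j k
  proof -
    have "\<delta> ^ k \<le> \<delta> ^ Suc j"
    proof (rule power_decreasing)
      have "\<delta> \<le> real K * \<delta>" using K \<delta> by simp
      then show "\<delta> \<le> 1" using K\<delta> by linarith
    qed (use that \<delta> in auto)
    then have "\<delta> ^ k * (1 - gap / 2) \<le> \<delta> ^ Suc j * (1 - gap / 2)"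
      using gap by (intro mult_right_mono) auto
    also have "\<dots> = \<delta> ^ j * (\<delta> * (1 - gap / 2))" by simp
    also have "\<dots> < \<delta> ^ j * (1 - gap)"
      using gap \<delta> by (intro mult_strict_left_mono) auto
    finally show ?thesis by (auto simp: increments_def)
  qed
  then have "increments i j \<inter> increments i k = {}" if "j \<noteq> k" for j k
    using that by (metis Int_commute linorder_neqE_nat)
  then show ?thesis by (simp add: disjoint_family_on_def)
qed

lemma increments_norm_le:
  fixes i :: "'n::finite"
  assumes h: "h \<in> increments i j"
  shows "norm h \<le> real CARD('n) * \<delta> ^ j"
proof -
  have d: "0 \<le> \<delta> ^ j" using \<delta> by simp
  have "\<bar>h $ k\<bar> \<le> \<delta> ^ j" for k
  proof (cases "k = i")
    case True
    have "0 \<le> \<delta> ^ j * (1 - gap)" "\<delta> ^ j * (1 - gap / 2) \<le> \<delta> ^ j * 1"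
      using gap d mult_left_mono[of "1 - gap / 2" 1 "\<delta> ^ j"] by simp_all
    moreover have "\<delta> ^ j * (1 - gap) \<le> h $ i" "h $ i \<le> \<delta> ^ j * (1 - gap / 2)"
      using h by (auto simp: increments_def)
    ultimately show ?thesis using True by simp
  next
    case False
    then have "h $ k \<in> {0..\<delta> ^ j / 2}" using h by (simp add: increments_def)
    then show ?thesis using d by auto
  qed
  then have "(\<Sum>k\<in>UNIV. \<bar>h $ k\<bar>) \<le> (\<Sum>k\<in>(UNIV :: 'n set). \<delta> ^ j)"
    by (intro sum_mono)
  then show ?thesis
    using norm_le_l1_cart[of h] by simp
qed

lemma increments_nonzero: "h \<in> increments i j \<Longrightarrow> h \<noteq> 0"
proof
  assume "h \<in> increments i j" "h = 0"
  then have "\<delta> ^ j * (1 - gap) \<le> 0" by (simp add: increments_def)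
  moreover have "0 < \<delta> ^ j * (1 - gap)" using \<delta> gap by (intro mult_pos_pos) auto
  ultimately show False by simp
qed

text \<open>A lower bound for the mass contributed by one stage of the Cantor set: the lengths \<open>gap / 2\<close> of the
  ranges of base points and of increments in direction \<open>i\<close>, the lengths \<open>1 / 2\<close> in the other
  directions, and the loss from \<open>norm h \<le> N * \<delta> ^ j\<close>.\<close>

definition level_mass :: "'n::finite itself \<Rightarrow> real \<Rightarrow> real" where
  "level_mass _ \<gamma> = (gap / 2)\<^sup>2 * (1 / 4) ^ (CARD('n) - 1) * real CARD('n) powr (\<gamma> - real CARD('n))"

lemma level_mass_pos: "0 < level_mass TYPE('n::finite) \<gamma>"
  using gap by (simp add: level_mass_def)

definition level_base :: "'n::finite \<Rightarrow> nat \<Rightarrow> real \<Rightarrow> nat \<Rightarrow> (real^'n) set \<Rightarrow> bool" where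
  "level_base i m \<gamma> j A \<longleftrightarrow> A \<in> sets borel \<and> (\<forall>x\<in>A. \<forall>k. 0 \<le> x $ k \<and> x $ k \<le> 1) \<and>
     (\<forall>x\<in>A. \<forall>h\<in>increments i j. (\<forall>k. 0 \<le> (x + h) $ k \<and> (x + h) $ k \<le> 1) \<and>
       (1 / real K) ^ j \<le> block i m (x + h) - block i m x) \<and>
     ennreal (level_mass TYPE('n) \<gamma>) \<le> emeasure lborel A * increment_mass \<gamma> (increments i j)"

text \<open>The base points of stage \<open>j\<close> have measure of order \<open>(K * \<delta>) ^ j\<close> and the increments have weighted
  measure of order \<open>(\<delta> ^ j) powr \<gamma>\<close>. Their product is of order \<open>(K * \<delta> powr (1 + \<gamma>)) ^ j = 1\<close>; this is
  where the dimension \<open>1 + \<gamma>\<close> of the Cantor set is needed.\<close>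

lemma block_level:
  fixes i :: "'n::finite"
  assumes \<gamma>: "\<gamma> < 0" and dim: "real K * \<delta> powr (1 + \<gamma>) = 1" and j: "j < m"
  shows "\<exists>A. level_base i m \<gamma> j A"
proof -
  let ?N = "CARD('n)"
  obtain B where B: "level_points m j B" using ex_level_points[OF j] by blast
  have Bm: "B \<in> sets borel" and B01: "B \<subseteq> {0..<1}"
    using B by (auto simp: level_points_def)
  define A where "A = {x :: real^'n. x $ i \<in> B \<and> (\<forall>k. k \<noteq> i \<longrightarrow> x $ k \<in> {0..1/2})}"
  have dj: "0 < \<delta> ^ j" "\<delta> ^ j \<le> 1"
  proof -
    have "\<delta> \<le> real K * \<delta>" using K \<delta> by simp
    then have "\<delta> \<le> 1" using K\<delta> by linarith
    then show "\<delta> ^ j \<le> 1" using \<delta> by (intro power_le_one) auto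
  qed (use \<delta> in simp)
  have A: "A \<in> sets borel" "emeasure lborel A = emeasure lborel B * ennreal ((1/2) ^ (?N - 1))"
    unfolding A_def using Bm by (intro emeasure_coordinate_box; simp)+
  have A1: "0 \<le> x $ k \<and> x $ k \<le> 1" if "x \<in> A" for x k
    using that B01 by (cases "k = i") (auto simp: A_def)
  have jump: "(x + h) $ i \<le> 1 \<and> (1 / real K) ^ j \<le> cantor m ((x + h) $ i) - cantor m (x $ i)"
    if "x \<in> A" "h \<in> increments i j" for x h
    using that B by (auto simp: level_points_def A_def increments_def)
  have A2: "0 \<le> (x + h) $ k \<and> (x + h) $ k \<le> 1" if "x \<in> A" "h \<in> increments i j" for x h k
  proof (cases "k = i")
    case True
    have "0 \<le> \<delta> ^ j * (1 - gap)" using dj gap by simp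
    then have "0 \<le> h $ i" using that(2) by (auto simp: increments_def)
    then show ?thesis using A1[OF that(1), of i] jump[OF that] True by simp
  next
    case False
    then have "x $ k \<in> {0..1/2}" "h $ k \<in> {0..\<delta> ^ j / 2}"
      using that by (auto simp: A_def increments_def)
    then show ?thesis using dj by auto
  qed
  have A3: "(1 / real K) ^ j \<le> block i m (x + h) - block i m x" if "x \<in> A" "h \<in> increments i j" for x h
  proof -
    have "cube_bump (x + h) = 1" "cube_bump x = 1"
      using A1[OF that(1)] A2[OF that] by (auto intro!: cube_bump_one)
    then show ?thesis using jump[OF that] by (simp add: block_def)
  qed
  have "emeasure lborel (increments i j)
      = emeasure lborel {\<delta> ^ j * (1 - gap)..\<delta> ^ j * (1 - gap / 2)} * ennreal ((\<delta> ^ j / 2) ^ (?N - 1))"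
    unfolding increments_def using dj by (intro emeasure_coordinate_box(2)) auto
  also have "\<dots> = ennreal (\<delta> ^ j * (gap / 2)) * ennreal ((\<delta> ^ j / 2) ^ (?N - 1))"
    using dj gap by (subst emeasure_lborel_Icc) (auto simp: algebra_simps)
  also have "\<dots> = ennreal (\<delta> ^ j * (gap / 2) * (\<delta> ^ j / 2) ^ (?N - 1))"
    using dj gap by (intro ennreal_mult[symmetric]) auto
  finally have H: "emeasure lborel (increments i j) = ennreal (\<delta> ^ j * (gap / 2) * (\<delta> ^ j / 2) ^ (?N - 1))" .
  define w0 where "w0 = (real ?N * \<delta> ^ j) powr (\<gamma> - ?N)"
  have "ennreal w0 * emeasure lborel (increments i j)
      = (\<integral>\<^sup>+h. ennreal w0 * indicator (increments i j) h \<partial>lborel)"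
    by (rule nn_integral_cmult_indicator[symmetric]) (simp add: increments_borel)
  also have "\<dots> \<le> increment_mass \<gamma> (increments i j)"
    unfolding increment_mass_def
  proof (intro nn_integral_mono)
    fix h :: "real^'n"
    show "ennreal w0 * indicator (increments i j) h \<le> ennreal (norm h powr (\<gamma> - ?N)) * indicator (increments i j) h"
    proof (cases "h \<in> increments i j")
      case True
      have "w0 \<le> norm h powr (\<gamma> - ?N)"
        unfolding w0_def using \<gamma> increments_norm_le[OF True] increments_nonzero[OF True]
        by (intro powr_mono2') auto
      then show ?thesis using True by (simp add: ennreal_leI)
    qed simp
  qed
  finally have w: "ennreal w0 * emeasure lborel (increments i j) \<le> increment_mass \<gamma> (increments i j)" .
  have "real ?N \<ge> 1" by (simp add: Suc_leI)
  have pow: "(\<delta> ^ j) powr (\<gamma> - ?N) * (\<delta> ^ j * (\<delta> ^ j) ^ (?N - 1)) = (\<delta> ^ j) powr \<gamma>"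
  proof -
    have "\<delta> ^ j * (\<delta> ^ j) ^ (?N - 1) = (\<delta> ^ j) ^ ?N"
      using power_minus_mult[of ?N "\<delta> ^ j"] by (simp add: mult.commute)
    also have "\<dots> = (\<delta> ^ j) powr ?N" using dj by (simp add: powr_realpow)
    finally show ?thesis by (simp add: powr_add[symmetric])
  qed
  have "(real K * \<delta>) ^ j * (\<delta> ^ j) powr \<gamma> = (real K * \<delta> powr (1 + \<gamma>)) ^ j"
    using \<delta> by (simp add: power_mult_distrib powr_add powr_power powr_realpow[symmetric] powr_powr mult.commute)
  then have one: "(real K * \<delta>) ^ j * (\<delta> ^ j) powr \<gamma> = 1"
    by (simp add: dim)
  have "level_mass TYPE('n) \<gamma> = ((real K * \<delta>) ^ j * (\<delta> ^ j) powr \<gamma>) * level_mass TYPE('n) \<gamma>"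
    by (simp add: one)
  also have "\<dots> = ((real K * \<delta>) ^ j * (gap / 2) * (1/2) ^ (?N - 1)) *
      (w0 * (\<delta> ^ j * (gap / 2) * (\<delta> ^ j / 2) ^ (?N - 1)))"
  proof -
    have "w0 = real ?N powr (\<gamma> - ?N) * (\<delta> ^ j) powr (\<gamma> - ?N)"
      unfolding w0_def using dj by (simp add: powr_mult)
    moreover have "(1 / 4 :: real) ^ (?N - 1) = (1/2) ^ (?N - 1) * (1/2) ^ (?N - 1)"
      by (simp add: power_mult_distrib[symmetric])
    ultimately show ?thesis
      unfolding level_mass_def pow[symmetric] by (simp add: power_divide power2_eq_square mult_ac)
  qed
  finally have mass: "level_mass TYPE('n) \<gamma> = ((real K * \<delta>) ^ j * (gap / 2) * (1/2) ^ (?N - 1)) *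
      (w0 * (\<delta> ^ j * (gap / 2) * (\<delta> ^ j / 2) ^ (?N - 1)))" .
  have split: "ennreal (b * e * (w * h)) = ennreal b * ennreal e * (ennreal w * ennreal h)"
    if "0 \<le> b" "0 \<le> e" "0 \<le> w" "0 \<le> h" for b e w h
    using that by (simp add: ennreal_mult)
  have eB: "emeasure lborel B = ennreal ((real K * \<delta>) ^ j * (gap / 2))"
    using B by (simp add: level_points_def)
  have "ennreal (level_mass TYPE('n) \<gamma>) = emeasure lborel A * (ennreal w0 * emeasure lborel (increments i j))"
    unfolding A(2) H eB mass using gap \<delta> dj
    by (intro split mult_nonneg_nonneg zero_le_power) (auto simp: w0_def)
  also have "\<dots> \<le> emeasure lborel A * increment_mass \<gamma> (increments i j)"
    by (intro mult_left_mono w) simp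
  finally have "level_base i m \<gamma> j A"
    unfolding level_base_def using A(1) A1 A2 A3 by blast
  then show ?thesis ..
qed

end

section \<open>Weighted sums of translated blocks\<close>

text \<open>The gradient is uniformly continuous, so on short segments it exceeds its value at the starting
  point by as little as desired; the excess is confined to a fixed ball.\<close>

lemma C1c_grad_local_lipschitz:
  fixes u :: "real^'n \<Rightarrow> real"
  assumes u: "C1c_grad u g"
  obtains r G where "lipschitz_control u r G ((\<integral>x. norm (g x) \<partial>lborel) + 1)"
proof -
  obtain R where R: "0 < R" "\<And>x. R < norm x \<Longrightarrow> u x = 0" "\<And>x. R < norm x \<Longrightarrow> g x = 0"
    using C1c_grad_support[OF u] by metis
  have contg: "continuous_on UNIV g" using u by (simp add: C1c_grad_def)
  then have [measurable]: "g \<in> borel_measurable borel"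
    by (rule borel_measurable_continuous_onI)
  define V where "V = measure lborel (cball (0 :: real^'n) (R + 1))"
  \<comment> \<open>The excess \<open>\<eta>\<close> of the bound over the gradient has integral at most one over a ball of
    volume \<open>V\<close>.\<close>
  define \<eta> where "\<eta> = 1 / (1 + V)"
  have V: "0 \<le> V" by (simp add: V_def)
  then have \<eta>: "0 < \<eta>" by (simp add: \<eta>_def)
  have "uniformly_continuous_on (cball 0 (R + 2)) g"
    using contg by (intro compact_uniformly_continuous) (auto intro: continuous_on_subset)
  then obtain d where d: "0 < d"
    "\<And>x y. x \<in> cball 0 (R + 2) \<Longrightarrow> y \<in> cball 0 (R + 2) \<Longrightarrow> dist y x < d \<Longrightarrow> dist (g y) (g x) < \<eta>"
    unfolding uniformly_continuous_on_def using \<eta> by metis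
  define r where "r = min 1 (d / 2)"
  have r: "0 < r" "r \<le> 1" "r < d" using d(1) by (auto simp: r_def)
  define G where "G x = norm (g x) + \<eta> * indicator (cball 0 (R + 1)) x" for x
  have G0: "0 \<le> G x" for x using \<eta> by (simp add: G_def)
  have [measurable]: "cball (0 :: real^'n) (R + 1) \<in> sets borel" by simp
  have G_meas: "G \<in> borel_measurable borel"
    unfolding G_def[abs_def] by measurable
  have lip: "\<bar>u (x + h) - u x\<bar> \<le> norm h * G x" if h: "norm h \<le> r" for x h
  proof (cases "norm x \<le> R + 1")
    case True
    have "\<exists>s. 0 < s \<and> s < 1 \<and> u (x + 1 *\<^sub>R h) - u (x + 0 *\<^sub>R h) = (1 - 0) * (g (x + s *\<^sub>R h) \<bullet> h)"
      using u by (intro MVT2 line_derivative) (auto simp: C1c_grad_def)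
    then obtain s where s: "0 < s" "s < 1" "u (x + h) - u x = g (x + s *\<^sub>R h) \<bullet> h" by auto
    have sh: "norm (s *\<^sub>R h) \<le> norm h"
      using s by (simp add: mult_left_le_one_le)
    have "norm (x + s *\<^sub>R h) \<le> R + 2"
      using norm_triangle_ineq[of x "s *\<^sub>R h"] sh h r True by linarith
    then have "x + s *\<^sub>R h \<in> cball 0 (R + 2)" "x \<in> cball 0 (R + 2)"
      using True unfolding mem_cball_0 by simp_all
    moreover have "dist (x + s *\<^sub>R h) x < d"
      using sh h r by (simp add: dist_norm)
    ultimately have "dist (g (x + s *\<^sub>R h)) (g x) < \<eta>"
      by (intro d(2))
    then have "norm (g (x + s *\<^sub>R h)) \<le> norm (g x) + \<eta>"
      using norm_triangle_ineq2[of "g (x + s *\<^sub>R h)" "g x"] by (simp add: dist_norm)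
    then have "norm (g (x + s *\<^sub>R h)) * norm h \<le> G x * norm h"
      using True by (intro mult_right_mono) (auto simp: G_def)
    then show ?thesis
      using Cauchy_Schwarz_ineq2[of "g (x + s *\<^sub>R h)" h] s(3) by (simp add: mult.commute)
  next
    case False
    have "R < norm (x + h)" "R < norm x"
      using norm_diff_ineq[of x h] h r False by linarith+
    then show ?thesis using G0 by (simp add: R)
  qed
  have "(\<integral>\<^sup>+x. ennreal (G x) \<partial>lborel)
      = (\<integral>\<^sup>+x. ennreal (norm (g x)) + ennreal \<eta> * indicator (cball 0 (R + 1)) x \<partial>lborel)"
    using \<eta> by (intro nn_integral_cong) (auto simp: G_def indicator_def)
  also have "\<dots> = (\<integral>\<^sup>+x. ennreal (norm (g x)) \<partial>lborel) + ennreal \<eta> * emeasure lborel (cball (0 :: real^'n) (R + 1))"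
    by (subst nn_integral_add) (auto simp: nn_integral_cmult_indicator)
  also have "(\<integral>\<^sup>+x. ennreal (norm (g x)) \<partial>lborel) = ennreal (\<integral>x. norm (g x) \<partial>lborel)"
    using C1c_grad_integrable(2)[OF u] by (intro nn_integral_eq_integral) auto
  also have "emeasure lborel (cball (0 :: real^'n) (R + 1)) = ennreal V"
    unfolding V_def using emeasure_lborel_cball_finite by (intro emeasure_eq_ennreal_measure) (auto simp: less_top)
  also have "ennreal (\<integral>x. norm (g x) \<partial>lborel) + ennreal \<eta> * ennreal V = ennreal ((\<integral>x. norm (g x) \<partial>lborel) + \<eta> * V)"
    using \<eta> V by (simp add: ennreal_mult ennreal_plus)
  also have "\<dots> \<le> ennreal ((\<integral>x. norm (g x) \<partial>lborel) + 1)"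
    using V by (intro ennreal_leI) (auto simp: \<eta>_def field_simps)
  finally show ?thesis
    using that[of r G] r(1) G_meas G0 lip by (simp add: lipschitz_control_def)
qed

lemma C1c_grad_weak_seminorm_finite:
  fixes u :: "real^'n \<Rightarrow> real"
  assumes u: "C1c_grad u g" and \<gamma>: "- 1 \<le> \<gamma>" "\<gamma> < 0"
  shows "weak_seminorm \<gamma> u < \<infinity>"
proof -
  obtain r G where G: "lipschitz_control u r G ((\<integral>x. norm (g x) \<partial>lborel) + 1)"
    using C1c_grad_local_lipschitz[OF u] by blast
  have um [measurable]: "u \<in> borel_measurable borel"
    using C1c_grad_continuous[OF u] by (rule borel_measurable_continuous_onI)
  define b where "b = (\<integral>x. \<bar>u x\<bar> \<partial>lborel)"
  have "ennreal t * emeasure lborel {x. t \<le> \<bar>u x\<bar>} \<le> ennreal b" if t: "0 < t" for t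
  proof -
    have "ennreal t * emeasure lborel {x. t \<le> \<bar>u x\<bar>} = (\<integral>\<^sup>+x. ennreal t * indicator {x. t \<le> \<bar>u x\<bar>} x \<partial>lborel)"
      by (rule nn_integral_cmult_indicator[symmetric]) measurable
    also have "\<dots> \<le> (\<integral>\<^sup>+x. ennreal \<bar>u x\<bar> \<partial>lborel)"
      by (intro nn_integral_mono) (auto simp: indicator_def ennreal_leI)
    also have "\<dots> = ennreal b"
      unfolding b_def using C1c_grad_integrable(1)[OF u] by (intro nn_integral_eq_integral) auto
    finally show ?thesis .
  qed
  moreover have "0 \<le> b" by (simp add: b_def)
  ultimately have "weak_seminorm \<gamma> u \<le> ennreal (tail_const TYPE('n) \<gamma> * ((\<integral>x. norm (g x) \<partial>lborel) + 1 + 4 * b / r))"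
    by (intro weak_seminorm_le[OF \<gamma> um G])
  then show ?thesis by (rule order_le_less_trans) simp
qed

lemma emeasure_lborel_translate:
  fixes S :: "'a::euclidean_space set"
  assumes [measurable]: "S \<in> sets borel"
  shows "{x. x - z \<in> S} \<in> sets borel" "emeasure lborel {x. x - z \<in> S} = emeasure lborel S"
proof -
  show *[measurable]: "{x. x - z \<in> S} \<in> sets borel" by measurable
  have "emeasure lborel {x. x - z \<in> S} = (\<integral>\<^sup>+x. indicator {x. x - z \<in> S} x \<partial>lborel)"
    by simp
  also have "\<dots> = (\<integral>\<^sup>+x. indicator S (x + - z) \<partial>lborel)"
    by (intro nn_integral_cong) (auto split: split_indicator)
  also have "\<dots> = emeasure lborel S"
    by (subst nn_integral_lborel_translate) auto
  finally show "emeasure lborel {x. x - z \<in> S} = emeasure lborel S" .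
qed

text \<open>Multiples of 4 separate the translates, because the cube that carries a block has side length 3.\<close>

definition shift :: "'n::finite \<Rightarrow> nat \<Rightarrow> real^'n" where
  "shift i k = axis i (4 * real k)"

lemma cube_shift_disjoint:
  assumes "x - shift i k \<in> cube" "x - shift i l \<in> cube"
  shows "k = l"
proof (rule ccontr)
  assume "k \<noteq> l"
  then have "1 \<le> \<bar>real k - real l\<bar>" by (cases k l rule: linorder_cases) auto
  moreover have "x $ i - 4 * real k \<in> {-1..2}" "x $ i - 4 * real l \<in> {-1..2}"
    using assms by (auto simp: cube_def shift_def dest!: spec[of _ i])
  ultimately show False by auto
qed

context cantor_scheme
begin

definition block_sum :: "'n::finite \<Rightarrow> nat \<Rightarrow> nat \<Rightarrow> (nat \<Rightarrow> real) \<Rightarrow> real^'n \<Rightarrow> real" where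
  "block_sum i m n c x = (\<Sum>k<n. c k * block i m (x - shift i k))"

definition block_sum_grad :: "'n::finite \<Rightarrow> nat \<Rightarrow> nat \<Rightarrow> (nat \<Rightarrow> real) \<Rightarrow> real^'n \<Rightarrow> real^'n" where
  "block_sum_grad i m n c x = (\<Sum>k<n. c k *\<^sub>R block_grad i m (x - shift i k))"

lemma C1c_grad_block_sum: "C1c_grad (block_sum i m n c) (block_sum_grad i m n c)"
  unfolding block_sum_def[abs_def] block_sum_grad_def[abs_def]
  by (intro C1c_grad_sum C1c_grad_scale C1c_grad_translate C1c_grad_block)

lemma block_sum_at:
  assumes "k < n" "x - shift i k \<in> cube"
  shows "block_sum i m n c x = c k * block i m (x - shift i k)"
proof -
  have "block_sum i m n c x = (\<Sum>l<n. if l = k then c k * block i m (x - shift i k) else 0)"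
    unfolding block_sum_def
  proof (intro sum.cong refl)
    fix l
    show "c l * block i m (x - shift i l) = (if l = k then c k * block i m (x - shift i k) else 0)"
    proof (cases "l = k")
      case False
      then have "x - shift i l \<notin> cube"
        using cube_shift_disjoint[OF _ assms(2)] by blast
      then show ?thesis using False by (simp add: block_zero)
    qed simp
  qed
  then show ?thesis using assms(1) by simp
qed

lemma block_sum_grad_integral:
  assumes c: "\<And>k. 0 \<le> c k" "(\<Sum>k<n. c k) \<le> 1"
  shows "(\<integral>x. norm (block_sum_grad i m n c x) \<partial>lborel) \<le> (\<integral>x. norm (block_grad i m x) \<partial>lborel)"
proof -
  let ?I = "\<integral>x. norm (block_grad i m x) \<partial>lborel"
  have int: "integrable lborel (\<lambda>x. block_grad i m (x - shift i k))" for k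
    by (rule C1c_grad_integrable(2)[OF C1c_grad_translate[OF C1c_grad_block]])
  have meas: "(\<lambda>x. norm (block_grad i m x)) \<in> borel_measurable borel"
    using C1c_grad_integrable(2)[OF C1c_grad_block[of i m]] by auto
  have tr: "(\<integral>x. norm (block_grad i m (x - shift i k)) \<partial>lborel) = ?I" for k
    using integral_lborel_translate[OF meas, of "- shift i k"] by simp
  have "(\<integral>x. norm (block_sum_grad i m n c x) \<partial>lborel) \<le> (\<integral>x. (\<Sum>k<n. c k * norm (block_grad i m (x - shift i k))) \<partial>lborel)"
  proof (rule integral_mono)
    show "integrable lborel (\<lambda>x. norm (block_sum_grad i m n c x))"
      using C1c_grad_integrable(2)[OF C1c_grad_block_sum] by (rule integrable_norm)
    show "integrable lborel (\<lambda>x. \<Sum>k<n. c k * norm (block_grad i m (x - shift i k)))"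
      using int by (intro Bochner_Integration.integrable_sum integrable_mult_right integrable_norm)
    show "norm (block_sum_grad i m n c x) \<le> (\<Sum>k<n. c k * norm (block_grad i m (x - shift i k)))" for x
      unfolding block_sum_grad_def by (rule order_trans[OF norm_sum]) (simp add: c)
  qed
  also have "\<dots> = (\<Sum>k<n. c k * ?I)"
    using int by (subst Bochner_Integration.integral_sum) (auto intro: integrable_norm simp: tr)
  also have "\<dots> = (\<Sum>k<n. c k) * ?I" by (simp add: sum_distrib_right)
  also have "\<dots> \<le> 1 * ?I" by (intro mult_right_mono c) simp
  finally show ?thesis by simp
qed

text \<open>Blocks are disjointly supported and bounded by one, so a weighted sum exceeds \<open>t\<close> only on the
  cubes of those blocks whose weight is at least \<open>t\<close>.\<close>

lemma block_sum_weak_seminorm_le: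
  fixes i :: "'n::finite"
  assumes \<gamma>: "- 1 \<le> \<gamma>" "\<gamma> < 0" and ctrl: "lipschitz_control (block i m) r G a"
    and c: "\<And>k. 0 \<le> c k" "(\<Sum>k<n. c k) \<le> 1"
    and \<beta>: "0 \<le> \<beta>" "\<And>t. 0 < t \<Longrightarrow> t * real (card {k. k < n \<and> t \<le> c k}) \<le> \<beta>"
  shows "weak_seminorm \<gamma> (block_sum i m n c) \<le>
    ennreal (tail_const TYPE('n) \<gamma> * (a + 4 * (\<beta> * measure lborel (cube :: (real^'n) set)) / r))"
proof (rule weak_seminorm_le[OF \<gamma>])
  let ?V = "measure lborel (cube :: (real^'n) set)"
  let ?G = "\<lambda>x. \<Sum>k<n. c k * G (x - shift i k)"
  have r: "0 < r" and G [measurable]: "G \<in> borel_measurable borel" and G0: "\<And>x. 0 \<le> G x"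
    and lip: "\<And>x h. norm h \<le> r \<Longrightarrow> \<bar>block i m (x + h) - block i m x\<bar> \<le> norm h * G x"
    and a: "0 \<le> a" "(\<integral>\<^sup>+x. ennreal (G x) \<partial>lborel) \<le> ennreal a"
    using ctrl by (auto simp: lipschitz_control_def)
  show "block_sum i m n c \<in> borel_measurable borel"
    using C1c_grad_continuous[OF C1c_grad_block_sum] by (rule borel_measurable_continuous_onI)
  have l: "\<bar>block_sum i m n c (x + h) - block_sum i m n c x\<bar> \<le> norm h * ?G x"
    if h: "norm h \<le> r" for x h
  proof -
    have "\<bar>block_sum i m n c (x + h) - block_sum i m n c x\<bar>
        = \<bar>\<Sum>k<n. c k * (block i m (x - shift i k + h) - block i m (x - shift i k))\<bar>"
      by (simp add: block_sum_def sum_subtractf right_diff_distrib algebra_simps)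
    also have "\<dots> \<le> (\<Sum>k<n. c k * \<bar>block i m (x - shift i k + h) - block i m (x - shift i k)\<bar>)"
      by (rule order_trans[OF sum_abs]) (simp add: abs_mult c)
    also have "\<dots> \<le> (\<Sum>k<n. c k * (norm h * G (x - shift i k)))"
      by (intro sum_mono mult_left_mono lip h c)
    also have "\<dots> = norm h * ?G x"
      by (simp add: sum_distrib_left mult_ac)
    finally show ?thesis .
  qed
  have I: "(\<integral>\<^sup>+x. ennreal (?G x) \<partial>lborel) \<le> ennreal a"
  proof -
    have tr: "(\<integral>\<^sup>+x. ennreal (G (x - shift i k)) \<partial>lborel) = (\<integral>\<^sup>+x. ennreal (G x) \<partial>lborel)" for k
      using nn_integral_lborel_translate[of "\<lambda>x. ennreal (G x)" "- shift i k"] by simp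
    have "(\<integral>\<^sup>+x. ennreal (?G x) \<partial>lborel)
        = (\<integral>\<^sup>+x. (\<Sum>k<n. ennreal (c k) * ennreal (G (x - shift i k))) \<partial>lborel)"
      using c(1) G0 by (intro nn_integral_cong) (simp add: sum_ennreal[symmetric] ennreal_mult)
    also have "\<dots> = (\<Sum>k<n. ennreal (c k) * (\<integral>\<^sup>+x. ennreal (G x) \<partial>lborel))"
      by (subst nn_integral_sum) (simp_all add: nn_integral_cmult tr)
    also have "\<dots> = ennreal (\<Sum>k<n. c k) * (\<integral>\<^sup>+x. ennreal (G x) \<partial>lborel)"
      using c(1) by (simp add: sum_distrib_right[symmetric] sum_ennreal)
    also have "\<dots> \<le> 1 * ennreal a"
      using c(2) by (intro mult_mono a) (auto simp: ennreal_le_1)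
    finally show ?thesis by simp
  qed
  show "lipschitz_control (block_sum i m n c) r ?G a"
    unfolding lipschitz_control_def using r a l I c(1) G0 by (auto intro!: sum_nonneg)
  show "0 \<le> \<beta> * ?V" using \<beta> by simp
  show "ennreal t * emeasure lborel {x. t \<le> \<bar>block_sum i m n c x\<bar>} \<le> ennreal (\<beta> * ?V)" if t: "0 < t" for t
  proof -
    define J where "J = {k. k < n \<and> t \<le> c k}"
    have J: "finite J" by (simp add: J_def)
    have "{x. t \<le> \<bar>block_sum i m n c x\<bar>} \<subseteq> (\<Union>k\<in>J. {x. x - shift i k \<in> cube})"
    proof
      fix x assume x: "x \<in> {x. t \<le> \<bar>block_sum i m n c x\<bar>}"
      have "\<exists>k<n. x - shift i k \<in> cube"
      proof (rule ccontr)
        assume "\<not> (\<exists>k<n. x - shift i k \<in> cube)"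
        then have "block_sum i m n c x = 0"
          unfolding block_sum_def by (intro sum.neutral) (auto simp: block_zero)
        then show False using x t by simp
      qed
      then obtain k where k: "k < n" "x - shift i k \<in> cube" by blast
      have "\<bar>block_sum i m n c x\<bar> = c k * block i m (x - shift i k)"
        using c(1)[of k] block_bounds(1)[of i m "x - shift i k"] by (simp add: block_sum_at[OF k] abs_mult)
      also have "\<dots> \<le> c k" using c(1)[of k] block_bounds(2)[of i m "x - shift i k"] by (simp add: mult_left_le)
      finally have "t \<le> c k" using x by simp
      then show "x \<in> (\<Union>k\<in>J. {x. x - shift i k \<in> cube})"
        using k by (auto simp: J_def)
    qed
    then have "emeasure lborel {x. t \<le> \<bar>block_sum i m n c x\<bar>} \<le> emeasure lborel (\<Union>k\<in>J. {x. x - shift i k \<in> cube})"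
      using J emeasure_lborel_translate(1)[OF cube_borel] by (intro emeasure_mono sets.finite_UN) auto
    also have "\<dots> \<le> (\<Sum>k\<in>J. emeasure lborel {x. x - shift i k \<in> cube})"
      using J emeasure_lborel_translate(1)[OF cube_borel] by (intro emeasure_subadditive_finite) auto
    also have "\<dots> = of_nat (card J) * ennreal ?V"
      by (simp add: emeasure_lborel_translate(2)[OF cube_borel] emeasure_cube)
    finally have "ennreal t * emeasure lborel {x. t \<le> \<bar>block_sum i m n c x\<bar>} \<le> ennreal t * (of_nat (card J) * ennreal ?V)"
      by (rule mult_left_mono) simp
    also have "\<dots> = ennreal (t * real (card J) * ?V)"
      using t by (simp add: ennreal_mult ennreal_of_nat_eq_real_of_nat mult.assoc)
    also have "\<dots> \<le> ennreal (\<beta> * ?V)"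
      using \<beta>(2)[OF t] by (intro ennreal_leI mult_right_mono) (auto simp: J_def)
    finally show ?thesis .
  qed
qed

text \<open>Every one of the \<open>m\<close> Cantor levels contributes the same mass at the same height, and so does
  each of the \<open>n\<close> disjoint copies.\<close>

lemma block_average_weak_seminorm_ge:
  fixes i :: "'n::finite"
  assumes \<gamma>: "- 1 \<le> \<gamma>" "\<gamma> < 0" and dim: "real K * \<delta> powr (1 + \<gamma>) = 1" and n: "0 < n"
  shows "ennreal (real m * level_mass TYPE('n) \<gamma> / (2 * real CARD('n)))
    \<le> weak_seminorm \<gamma> (block_sum i m n (\<lambda>k. 1 / real n))"
proof -
  let ?N = "CARD('n)" and ?v = "block_sum i m n (\<lambda>k. 1 / real n)"
  have "\<forall>j. \<exists>A. j < m \<longrightarrow> level_base i m \<gamma> j A"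
    using block_level[OF \<gamma>(2) dim] by blast
  from choice[OF this] obtain A where A: "\<And>j. j < m \<Longrightarrow> level_base i m \<gamma> j (A j)" by blast
  define A' where "A' j = (if j < m then \<Union>k<n. {x. x - shift i k \<in> A j} else {})" for j
  \<comment> \<open>The difference quotients at all stages are at least \<open>1 / (N * n)\<close>; the factor 2 makes the
    inequality in the level set strict.\<close>
  define l where "l = 1 / (2 * real ?N * real n)"
  have N: "1 \<le> real ?N" by (simp add: Suc_leI)
  have l: "0 < l" using n N by (simp add: l_def)
  have unit_cube: "x \<in> cube" if "\<forall>k. 0 \<le> x $ k \<and> x $ k \<le> 1" for x :: "real^'n"
    unfolding cube_def using that by (auto intro: order_trans[of _ 0] order_trans[of _ 1])
  have "of_nat m * ennreal (real n * level_mass TYPE('n) \<gamma>) \<le> nu \<gamma> (level_set l \<gamma> ?v)"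
  proof (rule nu_ge[where A = A' and H = "increments i"])
    show "A' j \<in> sets borel" for j
      using A[of j] emeasure_lborel_translate(1)[of "A j"]
      by (auto simp: A'_def level_base_def intro!: sets.finite_UN)
    show "increments i j \<in> sets borel" for j by (rule increments_borel)
    show "disjoint_family_on (increments i) {..<m}" by (rule increments_disjoint)
    show "(x, x + h) \<in> level_set l \<gamma> ?v" if j: "j < m" and x: "x \<in> A' j" and h: "h \<in> increments i j" for j x h
    proof -
      obtain k where k: "k < n" and xk: "x - shift i k \<in> A j"
        using x j by (auto simp: A'_def)
      have eq: "x + h - shift i k = x - shift i k + h" by simp
      have in1: "x - shift i k \<in> cube" and in2: "x + h - shift i k \<in> cube"
        and jump: "(1 / real K) ^ j \<le> block i m (x - shift i k + h) - block i m (x - shift i k)"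
        using A[OF j] xk h unfolding level_base_def eq by (auto intro!: unit_cube)
      have "?v (x + h) - ?v x = (block i m (x - shift i k + h) - block i m (x - shift i k)) / real n"
        unfolding block_sum_at[OF k in1] block_sum_at[OF k in2] eq by (simp add: diff_divide_distrib)
      then have ge: "(1 / real K) ^ j / real n \<le> \<bar>?v x - ?v (x + h)\<bar>"
        using jump n divide_right_mono[OF jump, of "real n"] by simp
      have dj: "0 < \<delta> ^ j" using \<delta> by simp
      have h0: "h \<noteq> 0" using increments_nonzero[OF h] .
      have "norm h powr (1 + \<gamma>) \<le> (real ?N * \<delta> ^ j) powr (1 + \<gamma>)"
        using \<gamma> increments_norm_le[OF h] by (intro powr_mono2) auto
      also have "\<dots> = real ?N powr (1 + \<gamma>) * (\<delta> ^ j) powr (1 + \<gamma>)"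
        using dj by (simp add: powr_mult)
      also have "(\<delta> ^ j) powr (1 + \<gamma>) = (\<delta> powr (1 + \<gamma>)) ^ j"
        using \<delta> by (simp add: powr_realpow[symmetric] powr_powr mult.commute)
      also have "\<delta> powr (1 + \<gamma>) = 1 / real K"
        using dim K by (simp add: field_simps)
      also have "real ?N powr (1 + \<gamma>) * (1 / real K) ^ j \<le> real ?N * (1 / real K) ^ j"
        using \<gamma> N powr_mono[of "1 + \<gamma>" 1 "real ?N"] by (intro mult_right_mono) auto
      finally have hp: "norm h powr (1 + \<gamma>) \<le> real ?N * (1 / real K) ^ j" .
      have "l * norm h powr (1 + \<gamma>) \<le> l * (real ?N * (1 / real K) ^ j)"
        using hp l by (intro mult_left_mono) auto
      also have "\<dots> = (1 / real K) ^ j / real n / 2"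
        using n N by (simp add: l_def)
      also have "\<dots> < (1 / real K) ^ j / real n"
      proof -
        have "0 < (1 / real K) ^ j / real n" using n K by simp
        moreover have "y / 2 < y" if "0 < y" for y :: real using that by simp
        ultimately show ?thesis by blast
      qed
      also note ge
      finally have "l < \<bar>?v x - ?v (x + h)\<bar> / norm h powr (1 + \<gamma>)"
        using h0 by (simp add: less_divide_eq)
      then show ?thesis using h0 by (simp add: level_set_def)
    qed
    show "ennreal (real n * level_mass TYPE('n) \<gamma>) \<le> emeasure lborel (A' j) * increment_mass \<gamma> (increments i j)" if j: "j < m" for j
    proof -
      have Aj: "A j \<in> sets borel" using A[OF j] by (simp add: level_base_def)
      have "disjoint_family_on (\<lambda>k. {x. x - shift i k \<in> A j}) {..<n}"
        using A[OF j] cube_shift_disjoint[of _ i] unit_cube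
        unfolding disjoint_family_on_def level_base_def by blast
      then have "emeasure lborel (A' j) = (\<Sum>k<n. emeasure lborel {x. x - shift i k \<in> A j})"
        using j emeasure_lborel_translate(1)[OF Aj] unfolding A'_def
        by (simp, intro sum_emeasure[symmetric]) auto
      also have "\<dots> = of_nat n * emeasure lborel (A j)"
        by (simp add: emeasure_lborel_translate(2)[OF Aj])
      finally have em: "emeasure lborel (A' j) = of_nat n * emeasure lborel (A j)" .
      have "ennreal (real n * level_mass TYPE('n) \<gamma>) = of_nat n * ennreal (level_mass TYPE('n) \<gamma>)"
        using level_mass_pos[where 'n='n] by (simp add: ennreal_mult ennreal_of_nat_eq_real_of_nat less_imp_le)
      also have "\<dots> \<le> of_nat n * (emeasure lborel (A j) * increment_mass \<gamma> (increments i j))"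
        using A[OF j] by (intro mult_left_mono) (auto simp: level_base_def)
      finally show ?thesis unfolding em by (simp add: mult.assoc)
    qed
  qed
  then have "ennreal l * (of_nat m * ennreal (real n * level_mass TYPE('n) \<gamma>)) \<le> ennreal l * nu \<gamma> (level_set l \<gamma> ?v)"
    by (rule mult_left_mono) simp
  also have "\<dots> \<le> weak_seminorm \<gamma> ?v"
    unfolding weak_seminorm_def using l by (intro SUP_upper) simp
  also have "ennreal l * (of_nat m * ennreal (real n * level_mass TYPE('n) \<gamma>))
      = ennreal (l * (real m * (real n * level_mass TYPE('n) \<gamma>)))"
    using l level_mass_pos[where 'n='n, of \<gamma>]
    by (simp add: ennreal_mult ennreal_of_nat_eq_real_of_nat less_imp_le)
  also have "l * (real m * (real n * level_mass TYPE('n) \<gamma>)) = real m * level_mass TYPE('n) \<gamma> / (2 * real ?N)"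
    using n N by (simp add: l_def)
  finally show ?thesis .
qed

end

section \<open>Non-normability\<close>

text \<open>The norm is subadditive and homogeneous, so averaging costs nothing beyond the two passages between
  the norm and the quasi-norm.\<close>

lemma normable_average:
  fixes X :: "(real^'n \<Rightarrow> real) set"
  assumes "normable_mod_constants X q"
  obtains C where "\<And>n u M. 0 < n \<Longrightarrow> (\<And>l. u l \<in> X) \<Longrightarrow> (\<And>l. q (u l) \<le> M) \<Longrightarrow>
    (\<And>j. (\<lambda>x. \<Sum>l<j. u l x) \<in> X) \<Longrightarrow> (\<lambda>x. 1 / real n * (\<Sum>l<n. u l x)) \<in> X \<Longrightarrow>
    q (\<lambda>x. 1 / real n * (\<Sum>l<n. u l x)) \<le> C * M"
proof -
  obtain p C where p: "quotient_norm X p" and C: "1 \<le> C"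
    and pq: "\<And>u. u \<in> X \<Longrightarrow> inverse C * p (coset X u) \<le> q u \<and> q u \<le> C * p (coset X u)"
    using assms unfolding normable_mod_constants_def by blast
  have scale: "p (coset X (\<lambda>x. c * u x)) = \<bar>c\<bar> * p (coset X u)" if "u \<in> X" for c u
    using p that unfolding quotient_norm_def by blast
  have triangle: "p (coset X (\<lambda>x. u x + v x)) \<le> p (coset X u) + p (coset X v)" if "u \<in> X" "v \<in> X" for u v
    using p that unfolding quotient_norm_def by blast
  have "q (\<lambda>x. 1 / real n * (\<Sum>l<n. u l x)) \<le> C * C * M"
    if n: "0 < n" and u: "\<And>l. u l \<in> X" "\<And>l. q (u l) \<le> M" and sums: "\<And>j. (\<lambda>x. \<Sum>l<j. u l x) \<in> X"
      and avg: "(\<lambda>x. 1 / real n * (\<Sum>l<n. u l x)) \<in> X" for n M and u :: "nat \<Rightarrow> real^'n \<Rightarrow> real"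
  proof -
    have pu: "p (coset X (u l)) \<le> C * M" for l
    proof -
      have "p (coset X (u l)) = C * (inverse C * p (coset X (u l)))" using C by simp
      also have "\<dots> \<le> C * M" using pq[OF u(1)[of l]] u(2)[of l] C by (intro mult_left_mono) auto
      finally show ?thesis .
    qed
    have zero: "p (coset X (\<lambda>x. 0)) = 0"
      using scale[OF u(1)[of 0], of 0] by simp
    have "p (coset X (\<lambda>x. \<Sum>l<j. u l x)) \<le> real j * (C * M)" for j
    proof (induction j)
      case (Suc j)
      have "p (coset X (\<lambda>x. \<Sum>l<Suc j. u l x)) \<le> p (coset X (\<lambda>x. \<Sum>l<j. u l x)) + p (coset X (u j))"
        using triangle[OF sums[of j] u(1)[of j]] by simp
      then show ?case using Suc pu[of j] by (simp add: algebra_simps)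
    qed (simp add: zero)
    then have "1 / real n * p (coset X (\<lambda>x. \<Sum>l<n. u l x)) \<le> 1 / real n * (real n * (C * M))"
      by (intro mult_left_mono) auto
    then have "p (coset X (\<lambda>x. 1 / real n * (\<Sum>l<n. u l x))) \<le> C * M"
      unfolding scale[OF sums] using n by simp
    then have "C * p (coset X (\<lambda>x. 1 / real n * (\<Sum>l<n. u l x))) \<le> C * (C * M)"
      using C by (intro mult_left_mono) auto
    then show ?thesis using pq[OF avg] by simp
  qed
  then show ?thesis using that[of "C * C"] by blast
qed

lemma sum_mod_shift:
  fixes f :: "nat \<Rightarrow> real"
  shows "(\<Sum>k<n. f ((k + l) mod n)) = (\<Sum>k<n. f k)"
proof (induction l)
  case (Suc l)
  have "(\<Sum>k<Suc n. f ((k + l) mod n)) = f (l mod n) + (\<Sum>k<n. f ((k + Suc l) mod n))"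
    by (subst sum.lessThan_Suc_shift) simp
  then show ?case using Suc by (simp add: mod_add_self1)
qed simp

text \<open>The extremal sequence for the weak \<open>l\<^sup>1\<close> quasi-norm: its sum is one, although its weak \<open>l\<^sup>1\<close> norm is only
  \<open>1 / harm n\<close>.\<close>

definition harmonic_weight :: "nat \<Rightarrow> nat \<Rightarrow> real" where
  "harmonic_weight n k = 1 / (real (Suc k) * harm n)"

lemma harmonic_weight_sum:
  assumes "0 < n"
  shows "(\<Sum>k<n. harmonic_weight n k) = 1"
proof -
  have "(\<Sum>k<n. inverse (real (Suc k))) = harm n"
    unfolding harm_def using sum.shift_bounds_Suc_ivl[of "\<lambda>k. inverse (real k)" 0 n]
    by (simp add: atLeast0LessThan atLeastLessThanSuc_atLeastAtMost)
  moreover have "(\<Sum>k<n. harmonic_weight n k) = (\<Sum>k<n. inverse (real (Suc k))) / harm n"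
    unfolding sum_divide_distrib by (intro sum.cong) (auto simp: harmonic_weight_def field_simps)
  moreover have "0 < (harm n :: real)"
    by (rule harm_pos) (rule assms)
  ultimately show ?thesis by simp
qed

text \<open>A cyclic shift permutes the weights, and \<open>t \<le> 1 / ((k + 1) * harm n)\<close> restricts \<open>k\<close> to at most
  \<open>1 / (t * harm n)\<close> values.\<close>

lemma harmonic_weight_count:
  assumes n: "0 < n" and t: "0 < t"
  shows "t * real (card {k. k < n \<and> t \<le> harmonic_weight n ((k + l) mod n)}) \<le> 1 / harm n"
proof -
  have L: "0 < (harm n :: real)" using harm_pos[OF n] .
  have count: "real (card {k. k < n \<and> P k}) = (\<Sum>k<n. of_bool (P k))" for P :: "nat \<Rightarrow> bool"
  proof -
    have "(\<Sum>k<n. of_bool (P k)) = real (card ({..<n} \<inter> {k. P k}))"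
      by (simp add: sum_of_bool_eq)
    moreover have "{..<n} \<inter> {k. P k} = {k. k < n \<and> P k}" by auto
    ultimately show ?thesis by simp
  qed
  have "real (card {k. k < n \<and> t \<le> harmonic_weight n ((k + l) mod n)}) = real (card {k. k < n \<and> t \<le> harmonic_weight n k})"
    unfolding count using sum_mod_shift[of "\<lambda>k. of_bool (t \<le> harmonic_weight n k)" l n] by simp
  also have "\<dots> \<le> real (nat \<lfloor>1 / (t * harm n)\<rfloor>)"
  proof -
    have "{k. k < n \<and> t \<le> harmonic_weight n k} \<subseteq> {..<nat \<lfloor>1 / (t * harm n)\<rfloor>}"
    proof
      fix k assume "k \<in> {k. k < n \<and> t \<le> harmonic_weight n k}"
      then have "t * (real (Suc k) * harm n) \<le> 1"
        using L by (simp add: harmonic_weight_def le_divide_eq del: of_nat_Suc)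
      moreover have "0 < t * harm n" using t L by (rule mult_pos_pos)
      ultimately have "real (Suc k) \<le> 1 / (t * harm n)"
        by (simp add: le_divide_eq mult.left_commute mult.commute del: of_nat_Suc)
      then have "int (Suc k) \<le> \<lfloor>1 / (t * harm n)\<rfloor>"
        by (simp add: le_floor_iff)
      then show "k \<in> {..<nat \<lfloor>1 / (t * harm n)\<rfloor>}" by simp
    qed
    from card_mono[OF _ this] show ?thesis by simp
  qed
  also have "\<dots> \<le> 1 / (t * harm n)"
    using t by (intro of_nat_floor) (simp add: harm_nonneg)
  finally have "t * real (card {k. k < n \<and> t \<le> harmonic_weight n ((k + l) mod n)}) \<le> t * (1 / (t * harm n))"
    using t by (intro mult_left_mono) auto
  then show ?thesis using t by simp
qed

lemma harm_unbounded: "\<exists>n>0. B \<le> (harm n :: real)"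
proof -
  obtain n where n: "exp B \<le> real n" using real_arch_simple by blast
  have "B \<le> ln (real n + 1)"
    using n by (subst ln_ge_iff) (auto intro: add_pos_nonneg)
  also have "\<dots> \<le> ln (real (Suc n) + 1)" by simp
  also have "\<dots> \<le> harm (Suc n)" by (rule ln_le_harm)
  finally show ?thesis by blast
qed

text \<open>For \<open>\<gamma> = - 1\<close> the dimension is zero and a single copy is kept at each stage; otherwise two copies of
  ratio \<open>2 powr (- 1 / (1 + \<gamma>))\<close> have the required dimension.\<close>

lemma ex_cantor_scheme:
  assumes \<gamma>: "- 1 \<le> \<gamma>" "\<gamma> < 0"
  shows "\<exists>K \<delta>. cantor_scheme K \<delta> \<and> real K * \<delta> powr (1 + \<gamma>) = 1"
proof (cases "\<gamma> = - 1")
  case True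
  then have "cantor_scheme 1 (1 / 2) \<and> real 1 * (1 / 2) powr (1 + \<gamma>) = 1"
    by (simp add: cantor_scheme_def)
  then show ?thesis by blast
next
  case False
  define \<delta> where "\<delta> = 2 powr (- 1 / (1 + \<gamma>))"
  have s: "0 < 1 + \<gamma>" "1 + \<gamma> < 1" using False \<gamma> by auto
  have "- 1 / (1 + \<gamma>) < - 1" using s by (simp add: field_simps)
  then have "2 powr (- 1 / (1 + \<gamma>)) < 2 powr (- 1)" by (intro powr_less_mono) auto
  then have "2 * \<delta> < 1" by (simp add: \<delta>_def powr_minus_divide)
  then have "cantor_scheme 2 \<delta>"
    by unfold_locales (auto simp: \<delta>_def)
  moreover have "\<delta> powr (1 + \<gamma>) = 2 powr (- 1)"
    using s by (simp add: \<delta>_def powr_powr)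
  then have "real 2 * \<delta> powr (1 + \<gamma>) = 1"
    by (simp add: powr_minus_divide)
  ultimately show ?thesis by blast
qed

text \<open>The order of choices matters: the bound \<open>M\<close> for the quasi-norms of the \<open>u l\<close> is fixed first, then the
  number \<open>m\<close> of Cantor stages that the average needs in order to exceed \<open>C * M\<close>, and finally the number \<open>n\<close> of
  translates, which has to compensate for the radius \<open>r\<close> on which the block with \<open>m\<close> stages is
  controlled by its gradient.\<close>

lemma not_normable_mod_constants:
  fixes X :: "(real^'n \<Rightarrow> real) set"
  assumes \<gamma>: "- 1 \<le> \<gamma>" "\<gamma> < 0"
    and X: "\<And>u g. C1c_grad u g \<Longrightarrow> u \<in> X"
    and q_le: "\<And>u g. C1c_grad u g \<Longrightarrow> q u \<le> (\<integral>x. norm (g x) \<partial>lborel) + enn2real (weak_seminorm \<gamma> u)"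
    and le_q: "\<And>u. enn2real (weak_seminorm \<gamma> u) \<le> q u"
  shows "\<not> normable_mod_constants X q"
proof
  assume "normable_mod_constants X q"
  then obtain C where C: "\<And>n u M. 0 < n \<Longrightarrow> (\<And>l. u l \<in> X) \<Longrightarrow> (\<And>l. q (u l) \<le> M) \<Longrightarrow>
    (\<And>j. (\<lambda>x. \<Sum>l<j. u l x) \<in> X) \<Longrightarrow> (\<lambda>x. 1 / real n * (\<Sum>l<n. u l x)) \<in> X \<Longrightarrow>
    q (\<lambda>x. 1 / real n * (\<Sum>l<n. u l x)) \<le> C * M"
    using normable_average by metis
  obtain K \<delta> where "cantor_scheme K \<delta>" and dim: "real K * \<delta> powr (1 + \<gamma>) = 1"
    using ex_cantor_scheme[OF \<gamma>] by blast
  then interpret cantor_scheme K \<delta> by simp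
  fix i :: 'n
  obtain D where D: "0 \<le> D" "\<And>m. (\<integral>x. norm (block_grad i m x) \<partial>lborel) \<le> D"
    using block_grad_integral_bound[of i] by metis
  define T where "T = tail_const TYPE('n) \<gamma>"
  have T: "0 \<le> T" unfolding T_def by (rule tail_const_nonneg[OF \<gamma>(2)])
  define M where "M = D + T * (D + 2)"
  define c where "c = level_mass TYPE('n) \<gamma> / (2 * real CARD('n))"
  have c: "0 < c" unfolding c_def using level_mass_pos[where 'n='n, of \<gamma>] by simp
  obtain m where "C * M / c < real m" using reals_Archimedean2 by blast
  then have m: "C * M < real m * c" using c by (simp add: field_simps)
  obtain r G where "lipschitz_control (block i m) r G ((\<integral>x. norm (block_grad i m x) \<partial>lborel) + 1)"
    using C1c_grad_local_lipschitz[OF C1c_grad_block[of i m]] by blast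
  then have ctrl: "lipschitz_control (block i m) r G (D + 1)"
    using D by (auto simp: lipschitz_control_def intro: order_trans ennreal_leI)
  \<comment> \<open>With this \<open>n\<close> the long increments contribute at most one inside the bracket of
    \<open>block_sum_weak_seminorm_le\<close>.\<close>
  define V where "V = measure lborel (cube :: (real^'n) set)"
  obtain n where n: "0 < n" "4 * V / r \<le> harm n"
    using harm_unbounded by blast
  have L: "0 < (harm n :: real)" using harm_pos[OF n(1)] .
  define w where "w l k = harmonic_weight n ((k + l) mod n)" for l k
  have w0: "0 \<le> w l k" for l k
    by (simp add: w_def harmonic_weight_def harm_nonneg)
  have w_sum: "(\<Sum>k<n. w l k) = 1" for l
    unfolding w_def using sum_mod_shift[of "harmonic_weight n" l n] harmonic_weight_sum[OF n(1)] by simp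
  have w_sum': "(\<Sum>l<n. w l k) = 1" for k
    unfolding w_def using sum_mod_shift[of "harmonic_weight n" k n] harmonic_weight_sum[OF n(1)]
    by (simp add: add.commute)
  define u where "u l = block_sum i m n (w l)" for l
  have grad: "C1c_grad (u l) (block_sum_grad i m n (w l))" for l
    unfolding u_def by (rule C1c_grad_block_sum)
  have "q (u l) \<le> M" for l
  proof -
    have "weak_seminorm \<gamma> (u l) \<le> ennreal (T * (D + 1 + 4 * (1 / harm n * V) / r))"
      unfolding u_def T_def V_def
    proof (rule block_sum_weak_seminorm_le[OF \<gamma> ctrl w0])
      show "(\<Sum>k<n. w l k) \<le> 1" by (simp add: w_sum)
      show "0 \<le> 1 / (harm n :: real)" by (simp add: harm_nonneg)
      show "t * real (card {k. k < n \<and> t \<le> w l k}) \<le> 1 / harm n" if "0 < t" for t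
        unfolding w_def by (rule harmonic_weight_count[OF n(1) that])
    qed
    also have "\<dots> \<le> ennreal (T * (D + 2))"
    proof (intro ennreal_leI mult_left_mono T)
      have "4 * (1 / harm n * V) / r = 4 * V / r / harm n" by simp
      also have "\<dots> \<le> 1" unfolding divide_le_eq_1_pos[OF L] by (rule n(2))
      finally show "D + 1 + 4 * (1 / harm n * V) / r \<le> D + 2" by simp
    qed
    finally have "enn2real (weak_seminorm \<gamma> (u l)) \<le> T * (D + 2)"
      using T D by (intro enn2real_leI) auto
    moreover have "(\<integral>x. norm (block_sum_grad i m n (w l) x) \<partial>lborel) \<le> D"
      using block_sum_grad_integral[of "w l" n i m] w0 w_sum D(2)[of m] by (auto intro: order_trans)
    ultimately show ?thesis
      using q_le[OF grad[of l]] by (simp add: M_def)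
  qed
  moreover have avg: "(\<lambda>x. 1 / real n * (\<Sum>l<n. u l x)) = block_sum i m n (\<lambda>k. 1 / real n)"
  proof
    fix x
    have "(\<Sum>l<n. u l x) = (\<Sum>k<n. \<Sum>l<n. w l k * block i m (x - shift i k))"
      unfolding u_def block_sum_def by (rule sum.swap)
    also have "\<dots> = (\<Sum>k<n. block i m (x - shift i k))"
      by (simp add: sum_distrib_right[symmetric] w_sum')
    finally show "1 / real n * (\<Sum>l<n. u l x) = block_sum i m n (\<lambda>k. 1 / real n) x"
      by (simp add: block_sum_def sum_distrib_left sum_divide_distrib)
  qed
  moreover have "(\<lambda>x. \<Sum>l<j. u l x) \<in> X" for j
    by (rule X[OF C1c_grad_sum[OF grad]])
  moreover have "block_sum i m n (\<lambda>k. 1 / real n) \<in> X"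
    by (rule X[OF C1c_grad_block_sum])
  ultimately have "q (block_sum i m n (\<lambda>k. 1 / real n)) \<le> C * M"
    using C[OF n(1), of u M] X[OF grad] by simp
  then have upper: "enn2real (weak_seminorm \<gamma> (block_sum i m n (\<lambda>k. 1 / real n))) \<le> C * M"
    using le_q order_trans by blast
  have "weak_seminorm \<gamma> (block_sum i m n (\<lambda>k. 1 / real n)) < \<infinity>"
    by (rule C1c_grad_weak_seminorm_finite[OF C1c_grad_block_sum \<gamma>])
  then have "enn2real (ennreal (real m * c)) \<le> enn2real (weak_seminorm \<gamma> (block_sum i m n (\<lambda>k. 1 / real n)))"
    using block_average_weak_seminorm_ge[OF \<gamma> dim n(1), of m i] by (intro enn2real_mono) (auto simp: c_def)
  then have "real m * c \<le> C * M"
    using upper c by simp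
  with m show False by simp
qed

theorem theorem1p4:
  fixes \<gamma> :: real
  assumes "\<gamma> \<in> {-1..<0}"
  shows "\<not> normable_mod_constants (W11_gamma \<gamma> :: (real^'n \<Rightarrow> real) set) (W11_gamma_norm \<gamma>)
       \<and> \<not> normable_mod_constants (BV_gamma \<gamma> :: (real^'n \<Rightarrow> real) set) (BV_gamma_norm \<gamma>)"
proof -
  have \<gamma>: "- 1 \<le> \<gamma>" "\<gamma> < 0" using assms by auto
  note norms = C1c_grad_norms[OF _ C1c_grad_weak_seminorm_finite[OF _ \<gamma>]]
  show ?thesis
    by (intro conjI not_normable_mod_constants[OF \<gamma>] weak_seminorm_le_norms) (rule norms; assumption)+
qed

end
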